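(* Let $d\ge 3$ and let $\bm{X}=(X_1,\dots,X_d)$ be a random vector whose joint distribution $F_{\bm{X}}$ has support $\mathbb{R}^d_+=\{\bm{x}\in\mathbb{R}^d:\bm{x}\ge 0\}$, is absolutely continuous with density $f_{\bm{X}}$, has absolutely continuous marginal distributions $F_1,\dots,F_d$ with densities $f_1,\dots,f_d$, and has a copula $C$ with density $c$, so that $f_{\bm{X}}(\bm{x})=c(F_1(x_1),\dots,F_d(x_d))\,f_1(x_1)\cdots f_d(x_d)$. Let $S=X_1+\cdots+X_d$, assumed absolutely continuous with density $f_S$, and fix $v>0$ with $f_S(v)>0$. Put $d'=d-1$, $\bm{1}_{d'}=(1,\dots,1)\in\mathbb{R}^{d'}$, and let $\pi$ be the conditional density of $\bm{X}'=(X_1,\dots,X_{d'})$ given $S=v$, i.e. $$\pi(\bm{x})=\frac{f_{\bm{X}}(\bm{x},\,v-\bm{1}_{d'}^{\top}\bm{x})}{f_S(v)},\qquad \bm{x}\in\mathbb{R}^{d'},$$ which is supported on the simplex $\mathcal{S}_v=\{\bm{x}\in\mathbb{R}^{d'}:\bm{x}\ge 0,\ x_1+\cdots+x_{d'}\le v\}$. Let $q:\mathbb{R}^{d'}\times\mathbb{R}^{d'}\to\mathbb{R}_+$ be a proposal function (measurable in $\bm{x}$ and a probability density in $\bm{y}$ for each $\bm{x}$), and let $(\bm{X}'^{(n)})_{n\ge1}$ be the Metropolis–Hastings Markov chain with target $\pi$ and proposal $q$, started at some $\bm{x}^{(1)}\in\operatorname{supp}(\pi)$; that is, its transition kernel is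 $P(\bm{x},d\bm{y})=q(\bm{x},\bm{y})\alpha(\bm{x},\bm{y})\,d\bm{y}+r(\bm{x})\delta_{\bm{x}}(d\bm{y})$ with $\alpha(\bm{x},\bm{y})=\min\big[\frac{\pi(\bm{y})q(\bm{y},\bm{x})}{\pi(\bm{x})q(\bm{x},\bm{y})},1\big]$ if $\pi(\bm{x})q(\bm{x},\bm{y})>0$ and $\alpha(\bm{x},\bm{y})=0$ otherwise, and $r(\bm{x})=1-\int q(\bm{x},\bm{y})\alpha(\bm{x},\bm{y})\,d\bm{y}$. Define $\bm{X}^{(n)}=(\bm{X}'^{(n)},\,v-\bm{1}_{d'}^{\top}\bm{X}'^{(n)})\in\mathbb{R}^d$ and the MCMC estimator $\widehat{\mathrm{AC}}_N=\frac1N\sum_{n=1}^N\bm{X}^{(n)}$ of $\mathrm{AC}=\mathbb{E}[\bm{X}\mid S=v]$. Suppose that: (C1) $\epsilon:=\inf_{\bm{x},\bm{y}\in[0,v]^{d'}}q(\bm{x},\bm{y})>0$; (C2) for every $j=1,\dots,d$, $f_j$ is positive and bounded above on $[0,v]$; (C3) $c$ is positive and bounded above on $F_1([0,v])\times\cdots\times F_d([0,v])$. Then a $\sqrt{N}$-central limit theorem holds for $\widehat{\mathrm{AC}}_N$: $\sqrt{N}\,(\widehat{\mathrm{AC}}_N-\mathbb{E}[\bm{X}\mid S=v])$ converges in distribution, as $N\to\infty$, to a centered normal distribution with covariance $\Sigma=\mathrm{Var}_\pi[\bm{X}^{(1)}]+2\sum_{k\ge1}\mathrm{Cov}_\pi[\bm{X}^{(1)},\bm{X}^{(1+k)}]$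 (computed for the stationary chain).
   Context: $\mathrm{AC}=\mathbb{E}[\bm{X}\mid S=\mathrm{VaR}_p(S)]$ are the VaR contributions; here $v$ plays the role of (an estimate of) $\mathrm{VaR}_p(S)$ and is treated as a fixed constant. The Metropolis–Hastings chain has $\pi$ as a stationary distribution; computing its acceptance probability only requires ratios $\pi(\bm{y})/\pi(\bm{x})=f_{\bm{X}}(\bm{y},v-\bm{1}_{d'}^\top\bm{y})/f_{\bm{X}}(\bm{x},v-\bm{1}_{d'}^\top\bm{x})$. $\mathrm{Var}_\pi$ and $\mathrm{Cov}_\pi$ denote (co)variances under the chain started in stationarity. *)

theory Defs
  imports "HOL-Probability.Probability"
begin

text \<open>Coordinates: a vector in R^d is indexed by the finite type 'n option; the
  coordinates Some i (i :: 'n) are X_1,...,X_{d'} and None is the last coordinate X_d.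
  Hence d' = CARD('n) and d = CARD('n) + 1.\<close>

definition join_last :: "real^'n \<Rightarrow> real \<Rightarrow> real^('n option)" where
  "join_last x s = (\<chi> i. case i of None \<Rightarrow> s | Some j \<Rightarrow> x $ j)"

definition full_vec :: "real \<Rightarrow> real^'n \<Rightarrow> real^('n option)" where
  "full_vec v x = join_last x (v - (\<Sum>j\<in>UNIV. x $ j))"

definition support_of :: "'a::metric_space measure \<Rightarrow> 'a set" where
  "support_of \<mu> = {x. \<forall>e>0. emeasure \<mu> (ball x e) > 0}"

definition copula_density :: "(real^'d \<Rightarrow> real) \<Rightarrow> bool" where
  "copula_density c \<longleftrightarrow> (\<forall>u. 0 \<le> c u) \<and> c \<in> borel_measurable borel \<and>
     (\<forall>u. u \<notin> cbox 0 1 \<longrightarrow> c u = 0) \<and>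
     (\<forall>j. \<forall>t\<in>{0..1}. (\<integral>u. indicator {u. u $ j \<le> t} u * c u \<partial>lborel) = t)"

definition copula_of_density :: "(real^'d \<Rightarrow> real) \<Rightarrow> real^'d \<Rightarrow> real" where
  "copula_of_density c u = (\<integral>w. indicator (cbox 0 u) w * c w \<partial>lborel)"

definition mh_alpha :: "('a \<Rightarrow> real) \<Rightarrow> ('a \<Rightarrow> 'a \<Rightarrow> real) \<Rightarrow> 'a \<Rightarrow> 'a \<Rightarrow> real" where
  "mh_alpha \<pi> q x y = (if \<pi> x * q x y > 0 then min ((\<pi> y * q y x) / (\<pi> x * q x y)) 1 else 0)"

definition mh_rej :: "('a::euclidean_space \<Rightarrow> real) \<Rightarrow> ('a \<Rightarrow> 'a \<Rightarrow> real) \<Rightarrow> 'a \<Rightarrow> real" where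
  "mh_rej \<pi> q x = 1 - (\<integral>y. q x y * mh_alpha \<pi> q x y \<partial>lborel)"

definition mh_kernel :: "('a::euclidean_space \<Rightarrow> real) \<Rightarrow> ('a \<Rightarrow> 'a \<Rightarrow> real) \<Rightarrow> 'a \<Rightarrow> 'a measure" where
  "mh_kernel \<pi> q x = measure_of UNIV (sets borel)
     (\<lambda>A. (\<integral>\<^sup>+ y. indicator A y * ennreal (q x y * mh_alpha \<pi> q x y) \<partial>lborel)
          + ennreal (mh_rej \<pi> q x) * indicator A x)"

primrec kernel_pow :: "('a \<Rightarrow> 'a measure) \<Rightarrow> nat \<Rightarrow> 'a::topological_space \<Rightarrow> 'a measure" where
  "kernel_pow K 0 x = return borel x"
| "kernel_pow K (Suc k) x = bind (kernel_pow K k x) K"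

definition markov_chain_from ::
  "'b measure \<Rightarrow> (nat \<Rightarrow> 'b \<Rightarrow> 'a::topological_space) \<Rightarrow> ('a \<Rightarrow> 'a measure) \<Rightarrow> 'a \<Rightarrow> bool" where
  "markov_chain_from P Y K x1 \<longleftrightarrow>
     (\<forall>n. Y n \<in> P \<rightarrow>\<^sub>M borel) \<and>
     (\<forall>\<omega>\<in>space P. Y 1 \<omega> = x1) \<and>
     (\<forall>n\<ge>1. \<forall>A :: nat \<Rightarrow> 'a set. (\<forall>i. A i \<in> sets borel) \<longrightarrow>
        measure P {\<omega>\<in>space P. \<forall>i\<in>{1..Suc n}. Y i \<omega> \<in> A i}
        = (\<integral>\<omega>. indicator {\<omega>\<in>space P. \<forall>i\<in>{1..n}. Y i \<omega> \<in> A i} \<omega>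
                 * measure (K (Y n \<omega>)) (A (Suc n)) \<partial>P))"

definition weak_conv_to :: "(nat \<Rightarrow> 'a::metric_space measure) \<Rightarrow> 'a measure \<Rightarrow> bool" where
  "weak_conv_to \<mu>s \<mu> \<longleftrightarrow>
     (\<forall>f :: 'a \<Rightarrow> real. continuous_on UNIV f \<and> bounded (range f) \<longrightarrow>
        (\<lambda>N. \<integral>x. f x \<partial>\<mu>s N) \<longlonglongrightarrow> (\<integral>x. f x \<partial>\<mu>))"

definition centered_gaussian :: "real^'d^'d \<Rightarrow> (real^'d) measure \<Rightarrow> bool" where
  "centered_gaussian \<Sigma> \<mu> \<longleftrightarrow> prob_space \<mu> \<and> sets \<mu> = sets borel \<and>
     (\<forall>t. distr \<mu> borel (\<lambda>x. t \<bullet> x) =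
        (if t \<bullet> (\<Sigma> *v t) = 0 then return borel 0
         else density lborel (normal_density 0 (sqrt (t \<bullet> (\<Sigma> *v t))))))"

text \<open>Lag-k cross-covariance matrix Cov_pi[X^(1), X^(1+k)] of the stationary chain with
  (normalized) stationary density pi, kernel K and observable g with mean m.\<close>
definition stat_cov ::
  "(real^'n \<Rightarrow> real) \<Rightarrow> (real^'n \<Rightarrow> (real^'n) measure) \<Rightarrow> (real^'n \<Rightarrow> real^'d) \<Rightarrow> real^'d
     \<Rightarrow> nat \<Rightarrow> real^'d^'d" where
  "stat_cov \<pi> K g m k = (\<chi> i j. \<integral>x. \<pi> x * (g x $ i - m $ i) *
       (\<integral>y. (g y $ j - m $ j) \<partial>kernel_pow K k x) \<partial>lborel)"

end

theory Submission
  imports Defs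
begin

text \<open>
  On the simplex the target density is bounded, say by $B$, and the proposal is bounded below by
  $\epsilon$, so the Metropolis--Hastings kernel satisfies Doeblin's condition
  $K(x, \cdot) \ge (\epsilon / B)\, \pi$. Since $K$ preserves $\pi$, it contracts mean-zero functions
  in the supremum norm by the factor $1 - \epsilon / B$, and the Poisson equation is solved by a
  geometric series.

  For a bounded mean-zero $h$ two such solutions give correctors $a, b$ for which
  $1 + i\theta a + \theta^2 b$ is, up to $O(\theta^3)$, an eigenfunction of $u \mapsto K(e^{i\theta h} u)$
  with eigenvalue $1 - \theta^2\sigma^2/2$. Iterating $N$ times with $\theta = N^{-1/2}$ yields
  convergence of the characteristic functions, without any martingale argument. Nonnegativity of
  $\sigma^2$ comes for free because characteristic functions are bounded by $1$.
\<close>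

subsection \<open>Weak convergence from characteristic functions\<close>

text \<open>The correctors come from matching powers of \<open>\<theta>\<close>: order one asks for
  \<open>K(h + a) = a\<close>, order two for \<open>K(b - h^2/2 - h a) = b - sigma^2/2\<close>. The
  second equation is solvable only when \<open>h^2/2 + h a\<close> has stationary mean
  \<open>sigma^2/2\<close>, and this is what identifies the variance. Two orders are needed because
  the error per step has to be \<open>o(1/N)\<close> to survive \<open>N\<close> steps.

  The observable is unbounded off the simplex, and there \<open>\<pi>\<close> vanishes, so every
  proposal is rejected and the kernel is a point mass: no minorization can hold at such points. The
  simplex is absorbing, which permits changing the kernel and truncating the observable outside it.

  The coordinates of \<open>full_vec v x\<close> add up to \<open>v\<close>, so the limit law is
  always degenerate and has no density on the full space. It is built as a sum of independent
  one-dimensional normals and handled through its characteristic function. Convergence then has to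
  pass from characters to all bounded continuous functions; trigonometric polynomials approximate
  these on compact sets only, and the mass far away is controlled coordinate by coordinate.\<close>

inductive trig_poly :: "('a::euclidean_space \<Rightarrow> real) \<Rightarrow> bool" where
  trig_poly_cos: "trig_poly (\<lambda>x. c * cos (t \<bullet> x + b))"
| trig_poly_add: "trig_poly g \<Longrightarrow> trig_poly h \<Longrightarrow> trig_poly (\<lambda>x. g x + h x)"

lemma trig_poly_const: "trig_poly (\<lambda>x. c)"
  using trig_poly_cos[of c 0 0] by simp

text \<open>The product-to-sum formula. The free phase \<open>b\<close> is what closes the class: it
  makes sines available and absorbs the phases of the two factors.\<close>

lemma trig_poly_mult_cos:
  assumes "trig_poly h"
  shows "trig_poly (\<lambda>x. (c * cos (t \<bullet> x + b)) * h x)"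
  using assms
proof induction
  case (trig_poly_cos c' t' b')
  have "(c * cos u) * (c' * cos u') = c * c' / 2 * cos (u - u') + c * c' / 2 * cos (u + u')" for u u' :: real
    by (simp add: cos_diff cos_add field_simps)
  moreover have "t \<bullet> x + b - (t' \<bullet> x + b') = (t - t') \<bullet> x + (b - b')"
    "t \<bullet> x + b + (t' \<bullet> x + b') = (t + t') \<bullet> x + (b + b')" for x
    by (simp_all add: inner_diff_left inner_add_left)
  ultimately have "(c * cos (t \<bullet> x + b)) * (c' * cos (t' \<bullet> x + b')) =
        c * c' / 2 * cos ((t - t') \<bullet> x + (b - b')) + c * c' / 2 * cos ((t + t') \<bullet> x + (b + b'))" for x
    by metis
  then show ?case
    by (simp only:) (intro trig_poly.intros)
next
  case (trig_poly_add g h)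
  then show ?case
    by (simp add: distrib_left trig_poly.trig_poly_add)
qed

lemma trig_poly_mult:
  assumes "trig_poly g" "trig_poly h"
  shows "trig_poly (\<lambda>x. g x * h x)"
  using assms(1)
proof induction
  case (trig_poly_cos c t b)
  show ?case by (rule trig_poly_mult_cos[OF assms(2)])
next
  case (trig_poly_add g1 g2)
  then show ?case
    by (simp add: distrib_right trig_poly.trig_poly_add)
qed

lemma trig_poly_continuous: "trig_poly g \<Longrightarrow> continuous_on S g"
  by (induction rule: trig_poly.induct) (auto intro!: continuous_intros)

lemma trig_poly_bounded: "trig_poly g \<Longrightarrow> \<exists>B. \<forall>x. \<bar>g x\<bar> \<le> B"
proof (induction rule: trig_poly.induct)
  case (trig_poly_cos c t b)
  have "\<bar>c * cos (t \<bullet> x + b)\<bar> \<le> \<bar>c\<bar>" for x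
    by (simp add: abs_mult mult_left_le)
  then show ?case by blast
next
  case (trig_poly_add g h)
  then show ?case by (meson abs_triangle_ineq add_mono order_trans)
qed

lemma trig_poly_separates:
  assumes "x \<noteq> (y::'a::euclidean_space)"
  shows "\<exists>g. trig_poly g \<and> g x \<noteq> g y"
proof -
  \<comment> \<open>Scaled so that \<open>t \<bullet> (x - y) = 1\<close>; after the phase shift the
    two arguments are \<open>1\<close> and \<open>0\<close>, and cosine is injective on
    \<open>[0, pi]\<close>.\<close>
  define t where "t = (1 / (norm (x - y))\<^sup>2) *\<^sub>R (x - y)"
  have "cos (t \<bullet> x + - (t \<bullet> y)) \<noteq> cos (t \<bullet> y + - (t \<bullet> y))"
  proof -
    have "t \<bullet> x + - (t \<bullet> y) = t \<bullet> (x - y)" by (simp add: inner_diff_right)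
    also have "\<dots> = 1"
      using assms by (simp add: t_def dot_square_norm)
    finally have "t \<bullet> x + - (t \<bullet> y) = 1" .
    then show ?thesis
      using cos_monotone_0_pi[of 0 1] pi_gt3 by simp
  qed
  then show ?thesis
    using trig_poly_cos[of 1 t "- (t \<bullet> y)"] by (intro exI[of _ "\<lambda>x. 1 * cos (t \<bullet> x + - (t \<bullet> y))"]) simp
qed

lemma trig_poly_compose:
  assumes "real_polynomial_function p" "trig_poly g"
  shows "trig_poly (\<lambda>x. p (g x))"
  using assms(1)
proof induction
  case (linear f)
  have "f (g x) = g x * f 1" for x
    using linear_cmul[OF bounded_linear.linear[OF linear], of "g x" 1] by simp
  then show ?case
    using trig_poly_mult[OF assms(2) trig_poly_const] by simp
qed (use assms(2) in \<open>auto intro: trig_poly_const trig_poly_mult trig_poly_add\<close>)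

text \<open>Composing with a polynomial that approximates the clamp to $[-B, B]$ makes the
  approximant bounded on the whole space, not just on the compact set.\<close>
lemma trig_poly_approx:
  fixes f :: "'a::euclidean_space \<Rightarrow> real"
  assumes "compact S" "continuous_on S f" "\<And>x. x \<in> S \<Longrightarrow> \<bar>f x\<bar> \<le> B" "0 \<le> B" "0 < e"
  obtains g where "trig_poly g" "\<And>x. x \<in> S \<Longrightarrow> \<bar>f x - g x\<bar> < e" "\<And>x. \<bar>g x\<bar> < B + e"
proof -
  have "\<exists>g. trig_poly g \<and> (\<forall>x\<in>S. \<bar>f x - g x\<bar> < e / 2)"
    by (rule Stone_Weierstrass_HOL[OF assms(1), of trig_poly])
       (use assms trig_poly_const trig_poly_continuous trig_poly_add trig_poly_mult trig_poly_separates
         in \<open>auto\<close>)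
  then obtain h where h: "trig_poly h" "\<And>x. x \<in> S \<Longrightarrow> \<bar>f x - h x\<bar> < e / 2" by blast
  obtain L where L: "\<And>x. \<bar>h x\<bar> \<le> L" using trig_poly_bounded[OF h(1)] by blast
  obtain p where p: "real_polynomial_function p"
    "\<And>s. s \<in> {-L..L} \<Longrightarrow> \<bar>max (-B) (min B s) - p s\<bar> < e / 2"
    by (rule Stone_Weierstrass_real_polynomial_function[of "{-L..L}" "\<lambda>s. max (-B) (min B s)" "e / 2"])
       (use assms(5) in \<open>auto intro!: continuous_intros\<close>)
  have p': "\<bar>max (-B) (min B (h x)) - p (h x)\<bar> < e / 2" for x
    using L[of x] by (intro p(2)) auto
  show thesis
  proof (rule that)
    show "trig_poly (\<lambda>x. p (h x))" by (rule trig_poly_compose[OF p(1) h(1)])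
    \<comment> \<open>The values of \<open>f\<close> on \<open>S\<close> lie in
      \<open>[-B, B]\<close>, so clamping \<open>h x\<close> does not move it away from
      \<open>f x\<close>; the two halves of \<open>e\<close> are the two approximation
      errors.\<close>
    show "\<bar>f x - p (h x)\<bar> < e" if "x \<in> S" for x
      using p'[of x] h(2)[OF that] assms(3)[OF that] by linarith
    show "\<bar>p (h x)\<bar> < B + e" for x
      using p'[of x] assms(4,5) by linarith
  qed
qed

lemma integrable_bounded_continuous:
  fixes f :: "'a::topological_space \<Rightarrow> 'b::{banach, second_countable_topology}"
  assumes "prob_space M" "sets M = sets borel" "continuous_on UNIV f" "\<And>x. norm (f x) \<le> B"
  shows "integrable M f"
proof -
  interpret prob_space M by fact
  have "f \<in> borel_measurable M"
    using borel_measurable_continuous_onI[OF assms(3)] measurable_cong_sets[OF assms(2) refl] by blast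
  then show ?thesis
    by (intro integrable_const_bound[of _ B]) (use assms(4) in auto)
qed

text \<open>A generator is \<open>c\<close> times the real part of a rotated character, so the
  hypothesis covers it; sums follow by linearity, boundedness giving integrability.\<close>

lemma tendsto_integral_trig_poly:
  fixes \<mu>s :: "nat \<Rightarrow> 'a::euclidean_space measure"
  assumes "\<And>N. prob_space (\<mu>s N)" "\<And>N. sets (\<mu>s N) = sets borel"
    and "prob_space \<mu>" "sets \<mu> = sets borel"
    and conv: "\<And>t. (\<lambda>N. \<integral>x. iexp (t \<bullet> x) \<partial>\<mu>s N) \<longlonglongrightarrow> (\<integral>x. iexp (t \<bullet> x) \<partial>\<mu>)"
    and "trig_poly g"
  shows "(\<lambda>N. \<integral>x. g x \<partial>\<mu>s N) \<longlonglongrightarrow> (\<integral>x. g x \<partial>\<mu>)"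
  using assms(6)
proof induction
  case (trig_poly_cos c t b)
  have *: "(\<integral>x. c * cos (t \<bullet> x + b) \<partial>\<nu>) = c * Re (iexp b * (\<integral>x. iexp (t \<bullet> x) \<partial>\<nu>))"
    if "prob_space \<nu>" "sets \<nu> = sets borel" for \<nu> :: "'a measure"
  proof -
    interpret prob_space \<nu> by fact
    have i: "integrable \<nu> (\<lambda>x. iexp (t \<bullet> x))"
      by (rule integrable_bounded_continuous[OF that, where B=1]) (auto intro!: continuous_intros)
    have "iexp b * (\<integral>x. iexp (t \<bullet> x) \<partial>\<nu>) = (\<integral>x. iexp b * iexp (t \<bullet> x) \<partial>\<nu>)" by simp
    also have "Re \<dots> = (\<integral>x. Re (iexp b * iexp (t \<bullet> x)) \<partial>\<nu>)"
      by (subst integral_Re) (use i in auto)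
    also have "\<dots> = (\<integral>x. cos (t \<bullet> x + b) \<partial>\<nu>)"
      by (simp add: cos_add Re_exp Im_exp algebra_simps)
    finally show ?thesis by simp
  qed
  show ?case
    by (simp only: *[OF assms(1,2)] *[OF assms(3,4)]) (intro tendsto_intros conv)
next
  case (trig_poly_add g h)
  have i: "integrable \<nu> g'" if g': "trig_poly g'" and \<nu>: "prob_space \<nu>" "sets \<nu> = sets borel" for g' and \<nu> :: "'a measure"
  proof -
    obtain B where "\<And>x. \<bar>g' x\<bar> \<le> B" using trig_poly_bounded[OF g'] by blast
    then show ?thesis
      by (intro integrable_bounded_continuous[OF \<nu>, where B=B] g' trig_poly_continuous) auto
  qed
  show ?case
    using tendsto_add[OF trig_poly_add.IH] i[OF trig_poly_add.hyps(1)] i[OF trig_poly_add.hyps(2)] assms(1-4)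
    by (simp add: Bochner_Integration.integral_add)
qed

text \<open>A continuous substitute for the indicator of \<open>\<bar>s\<bar> > R\<close>, so that
  tail mass is measured by an admissible test function.\<close>

definition cutoff :: "real \<Rightarrow> real \<Rightarrow> real" where
  "cutoff R s = min 1 (max 0 (\<bar>s\<bar> - R))"

lemma cutoff_bounds: "0 \<le> cutoff R s" "cutoff R s \<le> 1"
  by (auto simp: cutoff_def)

lemma isCont_cutoff: "isCont (cutoff R) s"
  unfolding cutoff_def[abs_def] by (intro continuous_intros)

lemma continuous_on_cutoff: "continuous_on S (\<lambda>x. cutoff R (b \<bullet> x))"
  unfolding cutoff_def[abs_def] by (intro continuous_intros)

text \<open>The tightness that the Stone--Weierstrass argument needs comes from the one-dimensional
  Levy continuity theorem applied to each coordinate.\<close>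
lemma tendsto_integral_cutoff:
  fixes \<mu>s :: "nat \<Rightarrow> 'a::euclidean_space measure"
  assumes "\<And>N. prob_space (\<mu>s N)" "\<And>N. sets (\<mu>s N) = sets borel"
    and "prob_space \<mu>" "sets \<mu> = sets borel"
    and conv: "\<And>t. (\<lambda>N. \<integral>x. iexp (t \<bullet> x) \<partial>\<mu>s N) \<longlonglongrightarrow> (\<integral>x. iexp (t \<bullet> x) \<partial>\<mu>)"
  shows "(\<lambda>N. \<integral>x. cutoff R (b \<bullet> x) \<partial>\<mu>s N) \<longlonglongrightarrow> (\<integral>x. cutoff R (b \<bullet> x) \<partial>\<mu>)"
proof -
  have ms: "(\<lambda>x. b \<bullet> x) \<in> borel_measurable (\<mu>s N)" for N
    by (subst measurable_cong_sets[OF assms(2) refl]) auto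
  have m: "(\<lambda>x. b \<bullet> x) \<in> borel_measurable \<mu>"
    by (subst measurable_cong_sets[OF assms(4) refl]) auto
  have rds: "real_distribution (distr (\<mu>s N) borel (\<lambda>x. b \<bullet> x))" for N
    using prob_space.real_distribution_distr[OF assms(1) ms] .
  have rd: "real_distribution (distr \<mu> borel (\<lambda>x. b \<bullet> x))"
    using prob_space.real_distribution_distr[OF assms(3) m] .
  have "weak_conv_m (\<lambda>N. distr (\<mu>s N) borel (\<lambda>x. b \<bullet> x)) (distr \<mu> borel (\<lambda>x. b \<bullet> x))"
  proof (rule levy_continuity[OF rds rd])
    fix t
    have "(\<lambda>N. \<integral>x. iexp ((t *\<^sub>R b) \<bullet> x) \<partial>\<mu>s N) \<longlonglongrightarrow> (\<integral>x. iexp ((t *\<^sub>R b) \<bullet> x) \<partial>\<mu>)"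
      by (rule conv)
    then show "(\<lambda>N. char (distr (\<mu>s N) borel (\<lambda>x. b \<bullet> x)) t) \<longlonglongrightarrow> char (distr \<mu> borel (\<lambda>x. b \<bullet> x)) t"
      unfolding char_def by (simp add: integral_distr[OF ms] integral_distr[OF m])
  qed
  then have "(\<lambda>N. \<integral>s. cutoff R s \<partial>distr (\<mu>s N) borel (\<lambda>x. b \<bullet> x))
      \<longlonglongrightarrow> (\<integral>s. cutoff R s \<partial>distr \<mu> borel (\<lambda>x. b \<bullet> x))"
    by (intro weak_conv_imp_integral_bdd_continuous_conv[OF rds rd, where B=1])
       (auto simp: isCont_cutoff cutoff_bounds)
  then show ?thesis
    by (subst (asm) (1 2) integral_distr)
       (auto intro: m ms borel_measurable_continuous_onI continuous_at_imp_continuous_on isCont_cutoff)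
qed

text \<open>A trigonometric polynomial \<open>T\<close> replaces \<open>f\<close> on a large ball.
  Outside the ball both are bounded, and the error is charged to the continuous tail function
  \<open>G\<close>, whose integral is small under \<open>\<mu>\<close> and hence, eventually, under
  \<open>\<mu>s N\<close>.\<close>

theorem weak_conv_to_char:
  fixes \<mu>s :: "nat \<Rightarrow> 'a::euclidean_space measure"
  assumes ps: "\<And>N. prob_space (\<mu>s N)" and ss: "\<And>N. sets (\<mu>s N) = sets borel"
    and p: "prob_space \<mu>" and s: "sets \<mu> = sets borel"
    and conv: "\<And>t. (\<lambda>N. \<integral>x. iexp (t \<bullet> x) \<partial>\<mu>s N) \<longlonglongrightarrow> (\<integral>x. iexp (t \<bullet> x) \<partial>\<mu>)"
  shows "weak_conv_to \<mu>s \<mu>"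
  unfolding weak_conv_to_def
proof (intro allI impI, elim conjE)
  fix f :: "'a \<Rightarrow> real"
  assume f: "continuous_on UNIV f" and "bounded (range f)"
  then obtain B0 where B0: "\<And>x. \<bar>f x\<bar> \<le> B0" unfolding bounded_iff by auto
  define B where "B = max B0 1"
  have B: "\<And>x. \<bar>f x\<bar> \<le> B" and B1: "B \<ge> 1" using B0 unfolding B_def by (auto simp: le_max_iff_disj)
  interpret \<mu>: prob_space \<mu> by fact
  define G where "G k x = (\<Sum>b\<in>Basis. cutoff (real k) (b \<bullet> x))" for k :: nat and x :: 'a
  have G0: "0 \<le> G k x" for k x unfolding G_def by (intro sum_nonneg cutoff_bounds)
  have Gb: "G k x \<le> DIM('a)" for k x
    unfolding G_def using sum_bounded_above[of Basis "\<lambda>b. cutoff (real k) (b \<bullet> x)" 1] by (simp add: cutoff_bounds)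
  have Gc: "continuous_on UNIV (G k)" for k
    unfolding G_def by (intro continuous_intros continuous_on_cutoff)
  have Gi: "integrable \<nu> (G k)" if "prob_space \<nu>" "sets \<nu> = sets borel" for k and \<nu> :: "'a measure"
    by (rule integrable_bounded_continuous[OF that Gc, where B="DIM('a)"]) (use G0 Gb in auto)
  have ci: "integrable \<nu> (\<lambda>x. cutoff R (b \<bullet> x))" if "prob_space \<nu>" "sets \<nu> = sets borel" for R b and \<nu> :: "'a measure"
    by (rule integrable_bounded_continuous[OF that continuous_on_cutoff, where B=1]) (use cutoff_bounds in auto)
  have Gconv: "(\<lambda>N. \<integral>x. G k x \<partial>\<mu>s N) \<longlonglongrightarrow> (\<integral>x. G k x \<partial>\<mu>)" for k
    unfolding G_def
    by (subst (1 2) Bochner_Integration.integral_sum)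
       (auto intro!: ci ps ss p s tendsto_sum tendsto_integral_cutoff conv)
  \<comment> \<open>Tightness of the single law \<open>\<mu>\<close>; combined with
    \<open>Gconv\<close> it controls the tails of \<open>\<mu>s N\<close> for all large
    \<open>N\<close>.\<close>
  have Glim: "(\<lambda>k. \<integral>x. G k x \<partial>\<mu>) \<longlonglongrightarrow> (\<integral>x. 0 \<partial>\<mu>)"
  proof (rule integral_dominated_convergence[where w="\<lambda>_. DIM('a)"])
    show "G k \<in> borel_measurable \<mu>" for k using Gi[OF p s] by auto
    show "AE x in \<mu>. (\<lambda>k. G k x) \<longlonglongrightarrow> 0"
    proof (rule AE_I2)
      fix x :: 'a
      obtain n :: nat where n: "norm x \<le> real n" using real_arch_simple by blast
      have "G k x = 0" if "k \<ge> n" for k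
        unfolding G_def
      proof (intro sum.neutral ballI)
        fix b :: 'a assume "b \<in> Basis"
        then have "\<bar>b \<bullet> x\<bar> \<le> norm x" by (metis Basis_le_norm inner_commute)
        then show "cutoff (real k) (b \<bullet> x) = 0" using n that by (simp add: cutoff_def)
      qed
      then show "(\<lambda>k. G k x) \<longlonglongrightarrow> 0"
        by (intro tendsto_eventually eventually_sequentiallyI[of n])
    qed
  qed (use Gb G0 in auto)
  show "(\<lambda>N. \<integral>x. f x \<partial>\<mu>s N) \<longlonglongrightarrow> (\<integral>x. f x \<partial>\<mu>)"
  proof (rule LIMSEQ_I)
    fix r :: real assume r: "r > 0"
    \<comment> \<open>The comparison at the end costs \<open>(4 * B + 5) * e\<close>, which the
      denominator covers with room to spare.\<close>
    define e where "e = min 1 (r / (8 * B + 20))"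
    have e: "e > 0" "e \<le> 1" and er: "(8 * B + 20) * e \<le> r"
    proof -
      have p: "8 * B + 20 > 0" using B1 by linarith
      then show "e > 0" "e \<le> 1" using r unfolding e_def by auto
      have "e \<le> r / (8 * B + 20)" unfolding e_def by simp
      then show "(8 * B + 20) * e \<le> r" using p by (simp add: pos_le_divide_eq mult.commute)
    qed
    obtain k where k: "(\<integral>x. G k x \<partial>\<mu>) < e"
      using order_tendstoD(2)[OF Glim, of e] e unfolding eventually_sequentially by auto
    define K where "K = cball (0::'a) (DIM('a) * (real k + 1))"
    have inK: "x \<in> K" if "G k x < 1" for x
    proof -
      have "\<bar>b \<bullet> x\<bar> \<le> real k + 1" if b: "b \<in> Basis" for b
      proof -
        have "cutoff (real k) (b \<bullet> x) \<le> G k x"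
          unfolding G_def by (rule member_le_sum) (use b in \<open>auto simp: cutoff_bounds\<close>)
        then show ?thesis using \<open>G k x < 1\<close> unfolding cutoff_def by linarith
      qed
      then have "(\<Sum>b\<in>Basis. \<bar>x \<bullet> b\<bar>) \<le> of_nat DIM('a) * (real k + 1)"
        by (intro sum_bounded_above) (auto simp: inner_commute)
      then show ?thesis unfolding K_def using norm_le_l1[of x] by simp
    qed
    obtain T where T: "trig_poly T" "\<And>x. x \<in> K \<Longrightarrow> \<bar>f x - T x\<bar> < e" "\<And>x. \<bar>T x\<bar> < B + e"
      by (rule trig_poly_approx[of K f B e])
         (use B B1 e f in \<open>auto simp: K_def intro: continuous_on_subset\<close>)
    \<comment> \<open>Where \<open>G k x < 1\<close> the point lies in \<open>K\<close> and the
      approximation applies; elsewhere the trivial bound \<open>2 * B + e\<close> is paid for by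
      \<open>G k x \<ge> 1\<close>.\<close>
    have fT: "\<bar>f x - T x\<bar> \<le> e + (2 * B + 1) * G k x" for x
    proof (cases "G k x < 1")
      case True
      then have "\<bar>f x - T x\<bar> < e" using T(2) inK by blast
      moreover have "0 \<le> (2 * B + 1) * G k x" using B1 G0[of k x] by simp
      ultimately show ?thesis by linarith
    next
      case False
      then have "(2 * B + 1) * 1 \<le> (2 * B + 1) * G k x" using B1 by (intro mult_left_mono) auto
      moreover have "\<bar>f x - T x\<bar> \<le> e + 2 * B" using B[of x] T(3)[of x] by arith
      ultimately show ?thesis by simp
    qed
    have diff: "\<bar>(\<integral>x. f x \<partial>\<nu>) - (\<integral>x. T x \<partial>\<nu>)\<bar> \<le> e + (2 * B + 1) * (\<integral>x. G k x \<partial>\<nu>)"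
      if \<nu>: "prob_space \<nu>" "sets \<nu> = sets borel" for \<nu> :: "'a measure"
    proof -
      interpret \<nu>: prob_space \<nu> by fact
      have fi: "integrable \<nu> f" by (rule integrable_bounded_continuous[OF \<nu> f]) (use B in auto)
      have Ti: "integrable \<nu> T"
        by (rule integrable_bounded_continuous[OF \<nu> trig_poly_continuous[OF T(1)], where B="B + e"])
           (use T(3) in \<open>auto intro: less_imp_le\<close>)
      have "\<bar>(\<integral>x. f x \<partial>\<nu>) - (\<integral>x. T x \<partial>\<nu>)\<bar> = \<bar>\<integral>x. f x - T x \<partial>\<nu>\<bar>"
        using fi Ti by simp
      also have "\<dots> \<le> (\<integral>x. \<bar>f x - T x\<bar> \<partial>\<nu>)" by (rule integral_abs_bound)
      also have "\<dots> \<le> (\<integral>x. e + (2 * B + 1) * G k x \<partial>\<nu>)"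
        by (intro integral_mono fT) (use fi Ti Gi[OF \<nu>] in auto)
      also have "\<dots> = e + (2 * B + 1) * (\<integral>x. G k x \<partial>\<nu>)"
        using Gi[OF \<nu>] by (simp add: \<nu>.prob_space)
      finally show ?thesis .
    qed
    have ev1: "\<forall>\<^sub>F N in sequentially. (\<integral>x. G k x \<partial>\<mu>s N) < e"
      by (rule order_tendstoD(2)[OF Gconv k])
    have ev2: "\<forall>\<^sub>F N in sequentially. \<bar>(\<integral>x. T x \<partial>\<mu>s N) - (\<integral>x. T x \<partial>\<mu>)\<bar> < e"
      using tendstoD[OF tendsto_integral_trig_poly[OF ps ss p s conv T(1)] e(1)] by (simp add: dist_real_def)
    have "\<forall>\<^sub>F N in sequentially. norm ((\<integral>x. f x \<partial>\<mu>s N) - (\<integral>x. f x \<partial>\<mu>)) < r"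
      using ev1 ev2
    proof eventually_elim
      case (elim N)
      have "(2 * B + 1) * (\<integral>x. G k x \<partial>\<mu>s N) \<le> (2 * B + 1) * e"
        using elim(1) B1 by (intro mult_left_mono) auto
      moreover have "(2 * B + 1) * (\<integral>x. G k x \<partial>\<mu>) \<le> (2 * B + 1) * e"
        using k B1 by (intro mult_left_mono) auto
      moreover have "e + (2 * B + 1) * e + (e + (2 * B + 1) * e) + e < (8 * B + 20) * e"
        using B1 e(1) by (simp add: algebra_simps add_pos_nonneg)
      ultimately have "\<bar>(\<integral>x. f x \<partial>\<mu>s N) - (\<integral>x. f x \<partial>\<mu>)\<bar> < (8 * B + 20) * e"
        using diff[OF ps ss, of N] diff[OF p s] elim(2) by linarith
      then show ?case using er by simp
    qed
    then show "\<exists>no. \<forall>n\<ge>no. norm ((\<integral>x. f x \<partial>\<mu>s n) - (\<integral>x. f x \<partial>\<mu>)) < r"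
      unfolding eventually_sequentially .
  qed
qed

subsection \<open>Gaussian measures on Euclidean spaces\<close>

text \<open>Describing the law by its characteristic function treats degenerate forms
  \<open>Q\<close> like all others, and independent sums simply add their forms.\<close>

definition gaussian_char :: "('a::euclidean_space \<Rightarrow> real) \<Rightarrow> 'a measure \<Rightarrow> bool" where
  "gaussian_char Q \<mu> \<longleftrightarrow> prob_space \<mu> \<and> sets \<mu> = sets borel \<and>
     (\<forall>t. (\<integral>x. iexp (t \<bullet> x) \<partial>\<mu>) = complex_of_real (exp (- Q t / 2)))"

lemma gaussian_char_zero: "gaussian_char (\<lambda>_. 0) (return borel 0)"
  unfolding gaussian_char_def by (auto simp: prob_space_return integral_return)

text \<open>The witness is the law of \<open>x + z *\<^sub>R a\<close> with \<open>z\<close> an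
  independent standard normal, which contributes the factor
  \<open>exp (- (t \<bullet> a)^2 / 2)\<close>.\<close>

lemma gaussian_char_add_square:
  fixes a :: "'a::euclidean_space"
  assumes "gaussian_char Q \<mu>"
  shows "\<exists>\<nu>. gaussian_char (\<lambda>t. Q t + (t \<bullet> a)\<^sup>2) \<nu>"
proof -
  have p: "prob_space \<mu>" and s: "sets \<mu> = sets borel"
    and c: "\<And>t. (\<integral>x. iexp (t \<bullet> x) \<partial>\<mu>) = complex_of_real (exp (- Q t / 2))"
    using assms unfolding gaussian_char_def by auto
  interpret \<mu>: prob_space \<mu> by fact
  interpret N: real_distribution std_normal_distribution by (rule real_dist_normal_dist)
  interpret pair: pair_prob_space \<mu> std_normal_distribution ..
  let ?N = "\<mu> \<Otimes>\<^sub>M std_normal_distribution"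
  let ?g = "\<lambda>p. fst p + snd p *\<^sub>R a"
  have fm: "fst \<in> borel_measurable ?N"
    using measurable_fst[of \<mu> std_normal_distribution] measurable_cong_sets[OF refl s] by blast
  have sm: "snd \<in> borel_measurable ?N"
    using measurable_snd[of \<mu> std_normal_distribution] measurable_cong_sets[of _ _ std_normal_distribution borel] by auto
  have gm: "?g \<in> borel_measurable ?N"
    using fm sm by (intro borel_measurable_add borel_measurable_scaleR) auto
  have "(\<integral>x. iexp (t \<bullet> x) \<partial>distr ?N borel ?g) = complex_of_real (exp (- (Q t + (t \<bullet> a)\<^sup>2) / 2))" for t
  proof -
    have "(\<integral>x. iexp (t \<bullet> x) \<partial>distr ?N borel ?g) = (\<integral>p. iexp (t \<bullet> ?g p) \<partial>?N)"
      by (rule integral_distr[OF gm]) (auto intro!: borel_measurable_continuous_onI continuous_intros)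
    also have "\<dots> = (\<integral>p. (case p of (x, z) \<Rightarrow> iexp (t \<bullet> x) * iexp ((t \<bullet> a) * z)) \<partial>?N)"
      by (intro Bochner_Integration.integral_cong refl)
         (simp add: inner_add_right algebra_simps exp_add case_prod_beta)
    also have "\<dots> = (\<integral>x. (\<integral>z. iexp (t \<bullet> x) * iexp ((t \<bullet> a) * z) \<partial>std_normal_distribution) \<partial>\<mu>)"
    proof (rule pair.integral_fst[symmetric], rule pair.P.integrable_const_bound[of _ 1])
      have "(\<lambda>p. iexp (t \<bullet> fst p) * iexp ((t \<bullet> a) * snd p)) \<in> borel_measurable ?N"
        by (intro borel_measurable_times measurable_compose[OF fm] measurable_compose[OF sm])
           (auto intro!: borel_measurable_continuous_onI continuous_intros)
      then show "(\<lambda>(x, z). iexp (t \<bullet> x) * iexp ((t \<bullet> a) * z)) \<in> borel_measurable ?N"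
        by (simp add: case_prod_beta')
    qed (auto simp: norm_mult)
    also have "\<dots> = (\<integral>x. iexp (t \<bullet> x) * char std_normal_distribution (t \<bullet> a) \<partial>\<mu>)"
      unfolding char_def by simp
    also have "\<dots> = complex_of_real (exp (- Q t / 2)) * complex_of_real (exp (- (t \<bullet> a)\<^sup>2 / 2))"
      by (simp add: c char_std_normal_distribution)
    also have "\<dots> = complex_of_real (exp (- Q t / 2 + - (t \<bullet> a)\<^sup>2 / 2))"
      by (simp only: exp_add of_real_mult)
    also have "- Q t / 2 + - (t \<bullet> a)\<^sup>2 / 2 = - (Q t + (t \<bullet> a)\<^sup>2) / 2" by (simp add: field_simps)
    finally show ?thesis .
  qed
  then have "gaussian_char (\<lambda>t. Q t + (t \<bullet> a)\<^sup>2) (distr ?N borel ?g)"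
    unfolding gaussian_char_def using pair.P.prob_space_distr[OF gm] by auto
  then show ?thesis by blast
qed

text \<open>Along the line \<open>i + r *\<^sub>R j\<close> the form is affine in \<open>r\<close>
  when \<open>B j j = 0\<close>; a nonzero slope would make it negative, and \<open>r\<close> is
  chosen to reach the value \<open>-1\<close>.\<close>

lemma psd_null:
  fixes B :: "'a::real_vector \<Rightarrow> 'a \<Rightarrow> real"
  assumes bil: "bilinear B" and sym: "\<And>s t. B s t = B t s" and psd: "\<And>t. 0 \<le> B t t"
    and null: "B j j = 0"
  shows "B i j = 0"
proof (rule ccontr)
  assume ne: "B i j \<noteq> 0"
  define r where "r = - (B i i + 1) / (2 * B i j)"
  have "B (i + r *\<^sub>R j) (i + r *\<^sub>R j) = B i i + 2 * r * B i j + r * r * B j j"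
    by (simp add: bilinear_ladd[OF bil] bilinear_radd[OF bil] bilinear_lmul[OF bil] bilinear_rmul[OF bil]
          sym[of j i] algebra_simps)
  also have "\<dots> = -1" using ne null by (simp add: r_def field_simps)
  finally show False using psd[of "i + r *\<^sub>R j"] by simp
qed

text \<open>Completing the square: \<open>r\<close> minimizes the form along
  \<open>t + r *\<^sub>R j\<close>. In this shape the inequality says that the form stays
  semidefinite once the square belonging to \<open>j\<close> is split off.\<close>

lemma psd_cauchy_schwarz:
  fixes B :: "'a::real_vector \<Rightarrow> 'a \<Rightarrow> real"
  assumes bil: "bilinear B" and sym: "\<And>s t. B s t = B t s" and psd: "\<And>t. 0 \<le> B t t"
    and pos: "B j j \<noteq> 0"
  shows "(B t j)\<^sup>2 / B j j \<le> B t t"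
proof -
  define r where "r = - B t j / B j j"
  have "B (t + r *\<^sub>R j) (t + r *\<^sub>R j) = B t t + 2 * r * B t j + r * r * B j j"
    by (simp add: bilinear_ladd[OF bil] bilinear_radd[OF bil] bilinear_lmul[OF bil] bilinear_rmul[OF bil]
          sym[of j t] algebra_simps)
  also have "\<dots> = B t t - (B t j)\<^sup>2 / B j j" using pos by (simp add: r_def field_simps power2_eq_square)
  finally show ?thesis using psd[of "t + r *\<^sub>R j"] by simp
qed

text \<open>Lagrange reduction: splitting off the square of a linear functional kills one
  diagonal entry of the form.\<close>
lemma gaussian_char_exists:
  fixes B :: "'a::euclidean_space \<Rightarrow> 'a \<Rightarrow> real"
  assumes "bilinear B" "\<And>s t. B s t = B t s" "\<And>t. 0 \<le> B t t"
  shows "\<exists>\<mu>. gaussian_char (\<lambda>t. B t t) \<mu>"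
proof -
  \<comment> \<open>Induction on a set \<open>J\<close> of basis vectors outside which the diagonal
    vanishes. \<open>B\<close> is generalized because each reduction replaces the form.\<close>
  have "\<exists>\<mu>. gaussian_char (\<lambda>t. B t t) \<mu>"
    if "finite J" "J \<subseteq> Basis" "bilinear B" "\<And>s t. B s t = B t s" "\<And>t. 0 \<le> B t t"
      "\<And>i. i \<in> Basis - J \<Longrightarrow> B i i = 0" for J and B :: "'a \<Rightarrow> 'a \<Rightarrow> real"
    using that
  proof (induction J arbitrary: B rule: finite_induct)
    case empty
    have "B t t = 0" for t
    proof -
      have lin: "linear (\<lambda>s. B s t)" using empty.prems(2) by (simp add: bilinear_def)
      have "B i t = 0" if "i \<in> Basis" for i
        using psd_null[OF empty.prems(2-4), of i t] empty.prems(5)[of i] empty.prems(3)[of i t] that by simp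
      then have "(\<lambda>s. B s t) = (\<lambda>s. 0)"
        by (intro linear_eq_stdbasis[OF lin]) (auto intro: linear_zero)
      then show ?thesis by metis
    qed
    then show ?case using gaussian_char_zero by auto
  next
    case (insert j J)
    show ?case
    proof (cases "B j j = 0")
      case True
      then show ?thesis using insert.prems by (intro insert.IH[of B]) auto
    next
      case False
      note bil = insert.prems(2) and sym = insert.prems(3) and psd = insert.prems(4)
      define B' where "B' s t = B s t - B s j * B t j / B j j" for s t
      have pos: "B j j > 0" using False psd[of j] by simp
      have "bilinear B'"
        unfolding B'_def bilinear_def
        by (auto intro!: linearI simp: bilinear_ladd[OF bil] bilinear_radd[OF bil] bilinear_lmul[OF bil]
              bilinear_rmul[OF bil] algebra_simps add_divide_distrib)
      moreover have "B' s t = B' t s" for s t unfolding B'_def using sym[of s t] by simp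
      moreover have "0 \<le> B' t t" for t
        using psd_cauchy_schwarz[OF bil sym psd False, of t] by (simp add: B'_def power2_eq_square)
      moreover have "B' i i = 0" if "i \<in> Basis - J" for i
      proof (cases "i = j")
        case True
        then show ?thesis using False by (simp add: B'_def)
      next
        assume "i \<noteq> j"
        then have "B i i = 0" using insert.prems(5) that by auto
        then have "B i j = 0" using psd_null[OF bil sym psd, of i j] sym by simp
        then show ?thesis using \<open>B i i = 0\<close> by (simp add: B'_def)
      qed
      ultimately obtain \<mu> where \<mu>: "gaussian_char (\<lambda>t. B' t t) \<mu>"
        using insert.IH[of B'] insert.prems(1) by auto
      \<comment> \<open>The vector representing the linear functional
        \<open>B t j / sqrt (B j j)\<close>, whose square is exactly what was subtracted in
        \<open>B'\<close>.\<close>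
      define a where "a = (\<Sum>b\<in>Basis. (B b j / sqrt (B j j)) *\<^sub>R b)"
      have ta: "t \<bullet> a = B t j / sqrt (B j j)" for t
      proof -
        have lin: "linear (\<lambda>s. B s j)" using bil by (simp add: bilinear_def)
        have "B t j = B (\<Sum>b\<in>Basis. (t \<bullet> b) *\<^sub>R b) j" by (simp add: euclidean_representation)
        also have "\<dots> = (\<Sum>b\<in>Basis. (t \<bullet> b) * B b j)"
          using linear_sum[OF lin, of "\<lambda>b. (t \<bullet> b) *\<^sub>R b" Basis] by (simp add: linear_cmul[OF lin])
        finally show ?thesis
          by (simp add: a_def inner_sum_right sum_divide_distrib mult.commute)
      qed
      have "B' t t + (t \<bullet> a)\<^sup>2 = B t t" for t
        using pos by (simp add: ta B'_def power_divide power2_eq_square)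
      then show ?thesis
        using gaussian_char_add_square[OF \<mu>, of a] by simp
    qed
  qed
  from this[of Basis B] show ?thesis using assms by auto
qed

lemma char_normal_density:
  assumes "0 < s"
  shows "char (density lborel (normal_density 0 s)) t = complex_of_real (exp (- (s * t)\<^sup>2 / 2))"
proof -
  interpret N: real_distribution std_normal_distribution by (rule real_dist_normal_dist)
  have "distributed std_normal_distribution lborel (\<lambda>x. x) (normal_density 0 1)"
    by (auto simp: distributed_def distr_id2)
  from N.normal_density_affine[OF this, of s 0]
  have "distributed std_normal_distribution lborel (\<lambda>x. s * x) (normal_density 0 s)"
    using assms by simp
  then have "density lborel (normal_density 0 s) = distr std_normal_distribution borel (\<lambda>x. s * x)"
    unfolding distributed_def by (simp cong: distr_cong)
  then have "char (density lborel (normal_density 0 s)) t = char std_normal_distribution (s * t)"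
    by (simp add: char_def integral_distr mult_ac)
  then show ?thesis by (simp add: char_std_normal_distribution)
qed

text \<open>The characteristic function of \<open>t \<bullet> x\<close> at \<open>r\<close> is that
  of \<open>\<mu>\<close> at \<open>r *\<^sub>R t\<close>; one-dimensional uniqueness then
  identifies the projection, as a point mass if the variance is zero.\<close>

lemma centered_gaussian_char:
  fixes \<Sigma> :: "real^'d^'d"
  assumes "gaussian_char (\<lambda>t. t \<bullet> (\<Sigma> *v t)) \<mu>" and psd: "\<And>t. 0 \<le> t \<bullet> (\<Sigma> *v t)"
  shows "centered_gaussian \<Sigma> \<mu>"
proof -
  have p: "prob_space \<mu>" and s: "sets \<mu> = sets borel"
    and c: "\<And>t. (\<integral>x. iexp (t \<bullet> x) \<partial>\<mu>) = complex_of_real (exp (- (t \<bullet> (\<Sigma> *v t)) / 2))"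
    using assms(1) unfolding gaussian_char_def by auto
  have m: "(\<lambda>x. t \<bullet> x) \<in> borel_measurable \<mu>" for t
    by (subst measurable_cong_sets[OF s refl]) auto
  have rd: "real_distribution (distr \<mu> borel (\<lambda>x. t \<bullet> x))" for t
    by (rule prob_space.real_distribution_distr[OF p m])
  have ch: "char (distr \<mu> borel (\<lambda>x. t \<bullet> x)) r = complex_of_real (exp (- (r\<^sup>2 * (t \<bullet> (\<Sigma> *v t))) / 2))" for t r
  proof -
    have "char (distr \<mu> borel (\<lambda>x. t \<bullet> x)) r = (\<integral>x. iexp ((r *\<^sub>R t) \<bullet> x) \<partial>\<mu>)"
      unfolding char_def by (simp add: integral_distr[OF m])
    also have "\<dots> = complex_of_real (exp (- ((r *\<^sub>R t) \<bullet> (\<Sigma> *v (r *\<^sub>R t))) / 2))" by (rule c)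
    finally show ?thesis
      by (simp add: matrix_vector_mult_scaleR power2_eq_square mult_ac)
  qed
  have "distr \<mu> borel (\<lambda>x. t \<bullet> x) = return borel 0" if "t \<bullet> (\<Sigma> *v t) = 0" for t
  proof (rule Levy_uniqueness[OF rd])
    show "real_distribution (return borel (0::real))"
      by (auto simp: real_distribution_def real_distribution_axioms_def prob_space_return)
    show "char (distr \<mu> borel (\<lambda>x. t \<bullet> x)) = char (return borel 0)"
      by (rule ext) (simp add: ch that, simp add: char_def integral_return)
  qed
  moreover have "distr \<mu> borel (\<lambda>x. t \<bullet> x) = density lborel (normal_density 0 (sqrt (t \<bullet> (\<Sigma> *v t))))"
    if "t \<bullet> (\<Sigma> *v t) \<noteq> 0" for t
  proof (rule Levy_uniqueness[OF rd])
    have pos: "0 < sqrt (t \<bullet> (\<Sigma> *v t))" using psd[of t] that by simp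
    show "real_distribution (density lborel (normal_density 0 (sqrt (t \<bullet> (\<Sigma> *v t)))))"
      using prob_space_normal_density[OF pos]
      by (auto simp: real_distribution_def real_distribution_axioms_def)
    show "char (distr \<mu> borel (\<lambda>x. t \<bullet> x)) = char (density lborel (normal_density 0 (sqrt (t \<bullet> (\<Sigma> *v t)))))"
      by (rule ext) (use psd[of t] in \<open>simp add: ch char_normal_density[OF pos] power_mult_distrib mult_ac\<close>)
  qed
  ultimately show ?thesis
    unfolding centered_gaussian_def using p s by auto
qed

lemma centered_gaussian_exists:
  fixes \<Sigma> :: "real^'d^'d"
  assumes psd: "\<And>t. 0 \<le> t \<bullet> (\<Sigma> *v t)"
  shows "\<exists>\<mu>. centered_gaussian \<Sigma> \<mu> \<and> gaussian_char (\<lambda>t. t \<bullet> (\<Sigma> *v t)) \<mu>"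
proof -
  \<comment> \<open>Only the quadratic form of \<open>\<Sigma>\<close> enters the claim, so
    symmetrizing changes nothing and spares a proof that \<open>\<Sigma>\<close> is
    symmetric.\<close>
  define B where "B s t = (s \<bullet> (\<Sigma> *v t) + t \<bullet> (\<Sigma> *v s)) / 2" for s t
  have "bilinear B"
    unfolding B_def bilinear_def
    by (auto intro!: linearI simp: matrix_vector_right_distrib matrix_vector_mult_scaleR
          inner_add_left inner_add_right field_simps)
  then have "\<exists>\<mu>. gaussian_char (\<lambda>t. B t t) \<mu>"
    by (rule gaussian_char_exists) (use psd in \<open>auto simp: B_def\<close>)
  then obtain \<mu> where "gaussian_char (\<lambda>t. t \<bullet> (\<Sigma> *v t)) \<mu>" by (auto simp: B_def)
  with centered_gaussian_char[OF this psd] show ?thesis by blast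
qed

subsection \<open>Markov kernels\<close>

text \<open>The class of observables on which the Markov operator acts. The bound holds everywhere,
  not almost everywhere, since the contraction takes place in the supremum norm.\<close>

definition bounded_measurable :: "('a::topological_space \<Rightarrow> real) \<Rightarrow> bool" where
  "bounded_measurable u \<longleftrightarrow> u \<in> borel_measurable borel \<and> (\<exists>C. \<forall>x. \<bar>u x\<bar> \<le> C)"

lemma bounded_measurableI:
  "u \<in> borel_measurable borel \<Longrightarrow> (\<And>x. \<bar>u x\<bar> \<le> C) \<Longrightarrow> bounded_measurable u"
  unfolding bounded_measurable_def by blast

lemma bounded_measurableD: "bounded_measurable u \<Longrightarrow> u \<in> borel_measurable borel"
  unfolding bounded_measurable_def by blast

lemma bounded_measurableE:
  assumes "bounded_measurable u"
  obtains C where "0 \<le> C" "\<And>x. \<bar>u x\<bar> \<le> C"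
proof -
  from assms obtain C where "\<And>x. \<bar>u x\<bar> \<le> C" unfolding bounded_measurable_def by blast
  then have "0 \<le> C" by (meson abs_ge_zero order_trans)
  then show ?thesis using that \<open>\<And>x. \<bar>u x\<bar> \<le> C\<close> by blast
qed

lemma bounded_measurable_const: "bounded_measurable (\<lambda>_. c)"
  by (rule bounded_measurableI[of _ "\<bar>c\<bar>"]) auto

lemma bounded_measurable_add:
  assumes "bounded_measurable u" "bounded_measurable w"
  shows "bounded_measurable (\<lambda>x. u x + w x)"
proof -
  obtain C D where "\<And>x. \<bar>u x\<bar> \<le> C" "\<And>x. \<bar>w x\<bar> \<le> D" using assms by (meson bounded_measurableE)
  then have "\<bar>u x + w x\<bar> \<le> C + D" for x by (meson abs_triangle_ineq add_mono order_trans)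
  then show ?thesis
    by (intro bounded_measurableI borel_measurable_add bounded_measurableD[OF assms(1)] bounded_measurableD[OF assms(2)])
qed

lemma bounded_measurable_mult:
  assumes "bounded_measurable u" "bounded_measurable w"
  shows "bounded_measurable (\<lambda>x. u x * w x)"
proof -
  obtain C D where "0 \<le> C" "\<And>x. \<bar>u x\<bar> \<le> C" "\<And>x. \<bar>w x\<bar> \<le> D" using assms by (meson bounded_measurableE)
  then have "\<bar>u x * w x\<bar> \<le> C * D" for x by (simp add: abs_mult mult_mono)
  then show ?thesis
    by (intro bounded_measurableI borel_measurable_times bounded_measurableD[OF assms(1)] bounded_measurableD[OF assms(2)])
qed

lemma bounded_measurable_cmult: "bounded_measurable u \<Longrightarrow> bounded_measurable (\<lambda>x. c * u x)"
  by (intro bounded_measurable_mult bounded_measurable_const)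

lemma bounded_measurable_diff:
  "bounded_measurable u \<Longrightarrow> bounded_measurable w \<Longrightarrow> bounded_measurable (\<lambda>x. u x - w x)"
  using bounded_measurable_add[of u "\<lambda>x. -1 * w x"] bounded_measurable_cmult[of w "-1"] by simp

lemma bounded_measurable_sum:
  "(\<And>i. i \<in> I \<Longrightarrow> bounded_measurable (u i)) \<Longrightarrow> bounded_measurable (\<lambda>x. \<Sum>i\<in>I. u i x)"
  by (induction I rule: infinite_finite_induct)
     (auto intro: bounded_measurable_const bounded_measurable_add)

lemma bounded_measurable_integrable:
  assumes "bounded_measurable u" "prob_space M" "sets M = sets borel"
  shows "integrable M u"
proof -
  interpret prob_space M by fact
  obtain C where "\<And>x. \<bar>u x\<bar> \<le> C" using assms(1) by (meson bounded_measurableE)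
  moreover have "u \<in> borel_measurable M"
    using bounded_measurableD[OF assms(1)] measurable_cong_sets[OF assms(3) refl] by blast
  ultimately show ?thesis by (intro integrable_const_bound[of _ C]) auto
qed

text \<open>Both integrals are suprema over the same simple functions, which are compared level set
  by level set. This carries a minorization of measures over to integrals.\<close>

lemma nn_integral_mono_emeasure:
  assumes sets: "sets M = sets N" and le: "\<And>A. A \<in> sets N \<Longrightarrow> emeasure N A \<le> emeasure M A"
  shows "(\<integral>\<^sup>+x. f x \<partial>N) \<le> (\<integral>\<^sup>+x. f x \<partial>M)"
  unfolding nn_integral_def
proof (rule SUP_mono)
  have sp: "space M = space N" by (rule sets_eq_imp_space_eq[OF sets])
  fix g assume g: "g \<in> {g. simple_function N g \<and> g \<le> f}"
  then have "simple_function M g" by (simp add: simple_function_def sp sets)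
  moreover have "integral\<^sup>S N g \<le> integral\<^sup>S M g"
    unfolding simple_integral_def sp
    by (intro sum_mono mult_left_mono le) (use g in \<open>auto simp: simple_function_def\<close>)
  ultimately show "\<exists>m\<in>{g. simple_function M g \<and> g \<le> f}. integral\<^sup>S N g \<le> integral\<^sup>S M m"
    using g by blast
qed

locale markov_kernel =
  fixes K :: "'a::topological_space \<Rightarrow> 'a measure"
  assumes kernel [measurable]: "K \<in> borel \<rightarrow>\<^sub>M subprob_algebra borel"
    and prob_kernel: "\<And>x. prob_space (K x)"
begin

lemma sets_K [simp]: "sets (K x) = sets borel"
  using sets_kernel[OF kernel] by simp

lemma space_K [simp]: "space (K x) = UNIV"
  using sets_eq_imp_space_eq[OF sets_K] by simp

text \<open>The Markov operator of \<open>K\<close>, acting backwards on functions.\<close>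

definition op :: "('a \<Rightarrow> real) \<Rightarrow> 'a \<Rightarrow> real" where
  "op u x = (\<integral>y. u y \<partial>K x)"

lemma integrable_K: "bounded_measurable u \<Longrightarrow> integrable (K x) u"
  by (rule bounded_measurable_integrable[OF _ prob_kernel sets_K])

lemma op_bound:
  assumes "bounded_measurable u" "\<And>y. \<bar>u y\<bar> \<le> C"
  shows "\<bar>op u x\<bar> \<le> C"
proof -
  interpret K: prob_space "K x" by (rule prob_kernel)
  have "\<bar>op u x\<bar> \<le> (\<integral>y. \<bar>u y\<bar> \<partial>K x)" unfolding op_def by (rule integral_abs_bound)
  also have "\<dots> \<le> (\<integral>y. C \<partial>K x)"
    by (intro integral_mono) (use integrable_K[OF assms(1)] assms(2) in auto)
  finally show ?thesis by (simp add: K.prob_space[unfolded space_K])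
qed

lemma bounded_measurable_op:
  assumes "bounded_measurable u" shows "bounded_measurable (op u)"
proof -
  obtain C where C: "\<And>x. \<bar>u x\<bar> \<le> C" using assms by (meson bounded_measurableE)
  have [measurable]: "u \<in> borel_measurable borel" using assms by (rule bounded_measurableD)
  have "op u \<in> borel_measurable borel" unfolding op_def[abs_def] by measurable
  then show ?thesis using op_bound[OF assms C] by (intro bounded_measurableI)
qed

lemma op_add: "bounded_measurable u \<Longrightarrow> bounded_measurable w \<Longrightarrow> op (\<lambda>y. u y + w y) x = op u x + op w x"
  unfolding op_def by (simp add: integrable_K)

lemma op_diff: "bounded_measurable u \<Longrightarrow> bounded_measurable w \<Longrightarrow> op (\<lambda>y. u y - w y) x = op u x - op w x"
  unfolding op_def by (simp add: integrable_K)

lemma op_cmult: "op (\<lambda>y. c * u y) x = c * op u x"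
  unfolding op_def by simp

lemma op_const: "op (\<lambda>y. c) x = c"
  unfolding op_def by (simp add: prob_space.prob_space[OF prob_kernel, unfolded space_K])

lemma bounded_measurable_op_pow: "bounded_measurable u \<Longrightarrow> bounded_measurable ((op ^^ k) u)"
  by (induction k) (auto intro: bounded_measurable_op)

lemma kernel_pow_kernel: "kernel_pow K k \<in> borel \<rightarrow>\<^sub>M subprob_algebra borel"
proof (induction k)
  case (Suc k)
  show ?case using measurable_bind2[OF Suc kernel] by simp
qed simp

lemma prob_kernel_pow: "prob_space (kernel_pow K k x)"
proof (induction k)
  case (Suc k)
  then interpret prob_space "kernel_pow K k x" .
  have "K \<in> kernel_pow K k x \<rightarrow>\<^sub>M subprob_algebra borel"
    by (subst measurable_cong_sets[OF sets_kernel[OF kernel_pow_kernel] refl]) auto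
  then show ?case using prob_space_bind[OF AE_I2[OF prob_kernel]] by simp
qed (simp add: prob_space_return)

lemma sets_kernel_pow: "sets (kernel_pow K k x) = sets borel"
  using sets_kernel[OF kernel_pow_kernel] by simp

lemma integral_bind_K:
  assumes "bounded_measurable u" "prob_space M" "sets M = sets borel"
  shows "(\<integral>y. u y \<partial>(M \<bind> K)) = (\<integral>x. op u x \<partial>M)"
proof -
  obtain C where C: "\<And>x. \<bar>u x\<bar> \<le> C" using assms(1) by (meson bounded_measurableE)
  have "K \<in> M \<rightarrow>\<^sub>M subprob_algebra borel"
    by (subst measurable_cong_sets[OF assms(3) refl]) auto
  then show ?thesis
    unfolding op_def
    by (intro integral_bind[where B=C and B'=1 and K=borel])
       (use C bounded_measurableD[OF assms(1)] assms(2) prob_space.emeasure_space_1[OF prob_kernel]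
         in \<open>auto simp: prob_space_def\<close>)
qed

text \<open>Moving a law forward is dual to pulling a function back. \<open>kernel_pow\<close>
  appends its new step at the end, so the induction passes from \<open>u\<close> to
  \<open>op u\<close> and needs \<open>u\<close> arbitrary.\<close>

lemma integral_kernel_pow:
  "bounded_measurable u \<Longrightarrow> (\<integral>y. u y \<partial>kernel_pow K k x) = (op ^^ k) u x"
proof (induction k arbitrary: u)
  case 0
  then show ?case by (simp add: integral_return bounded_measurableD)
next
  case (Suc k)
  have "(\<integral>y. u y \<partial>kernel_pow K (Suc k) x) = (\<integral>y. op u y \<partial>kernel_pow K k x)"
    by (simp add: integral_bind_K[OF Suc.prems prob_kernel_pow sets_kernel_pow])
  also have "\<dots> = (op ^^ k) (op u) x" by (rule Suc.IH[OF bounded_measurable_op[OF Suc.prems]])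
  finally show ?case by (simp add: funpow_swap1)
qed

text \<open>The chain hypothesis gives the joint law of $Y_1, \dots, Y_{n+1}$ on rectangles; uniqueness of
  measures on the finite product extends it to all bounded functionals.\<close>
lemma markov_chain_expectation:
  fixes F :: "(nat \<Rightarrow> 'a) \<Rightarrow> real"
  assumes P: "prob_space P" and chain: "markov_chain_from P Y K x1" and n: "n \<ge> 1"
    and F: "F \<in> borel_measurable (PiM {1..Suc n} (\<lambda>_. borel))" and Fb: "\<And>z. \<bar>F z\<bar> \<le> C"
  shows "(\<integral>\<omega>. F (\<lambda>i\<in>{1..Suc n}. Y i \<omega>) \<partial>P) =
         (\<integral>\<omega>. (\<integral>y. F ((\<lambda>i\<in>{1..n}. Y i \<omega>)(Suc n := y)) \<partial>K (Y n \<omega>)) \<partial>P)"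
proof -
  interpret P: prob_space P by fact
  let ?M = "PiM {1..Suc n} (\<lambda>_. borel) :: (nat \<Rightarrow> 'a) measure"
  have Ym [measurable]: "Y i \<in> P \<rightarrow>\<^sub>M borel" for i using chain unfolding markov_chain_from_def by blast
  define Z where "Z \<omega> = (\<lambda>i\<in>{1..n}. Y i \<omega>)" for \<omega>
  define Z' where "Z' \<omega> = (\<lambda>i\<in>{1..Suc n}. Y i \<omega>)" for \<omega>
  have Zm: "Z \<in> P \<rightarrow>\<^sub>M PiM {1..n} (\<lambda>_. borel)" unfolding Z_def[abs_def] by measurable
  have Z'm: "Z' \<in> P \<rightarrow>\<^sub>M ?M" unfolding Z'_def[abs_def] by measurable
  have ins: "insert (Suc n) {1..n} = {1..Suc n}" by auto
  have upd: "(\<lambda>(\<omega>, y). (Z \<omega>)(Suc n := y)) \<in> P \<Otimes>\<^sub>M borel \<rightarrow>\<^sub>M ?M"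
  proof -
    have "(\<lambda>p. (Z (fst p), snd p)) \<in> P \<Otimes>\<^sub>M borel \<rightarrow>\<^sub>M PiM {1..n} (\<lambda>_. borel) \<Otimes>\<^sub>M borel"
      using Zm by measurable
    from measurable_compose[OF this measurable_add_dim[of "Suc n" "{1..n}" "\<lambda>_. borel"]]
    show ?thesis unfolding ins by (simp add: case_prod_beta')
  qed
  have KY: "(\<lambda>\<omega>. K (Y n \<omega>)) \<in> P \<rightarrow>\<^sub>M subprob_algebra borel" by measurable
  \<comment> \<open>The law of the extended path given the first \<open>n\<close> states; the goal
    becomes that the path law is \<open>P \<bind> R\<close>.\<close>
  define R where "R \<omega> = distr (K (Y n \<omega>)) ?M (\<lambda>y. (Z \<omega>)(Suc n := y))" for \<omega>
  have Rm: "R \<in> P \<rightarrow>\<^sub>M subprob_algebra ?M"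
    unfolding R_def[abs_def] using measurable_distr2[OF upd KY] .
  have updm: "(\<lambda>y. (Z \<omega>)(Suc n := y)) \<in> K (Y n \<omega>) \<rightarrow>\<^sub>M ?M" if "\<omega> \<in> space P" for \<omega>
    using measurable_Pair2[OF upd that] by (subst measurable_cong_sets[OF sets_K refl]) simp
  have Rp: "prob_space (R \<omega>)" if "\<omega> \<in> space P" for \<omega>
    unfolding R_def using prob_space.prob_space_distr[OF prob_kernel updm[OF that]] .
  have eq: "distr P ?M Z' = P \<bind> R"
  proof (rule measure_eqI_PiM_finite)
    show "sets (P \<bind> R) = sets ?M" by (rule sets_bind) (use Rm P.not_empty in \<open>auto dest: sets_kernel\<close>)
    fix A assume A: "\<And>i. i \<in> {1..Suc n} \<Longrightarrow> A i \<in> sets (borel :: 'a measure)"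
    \<comment> \<open>The chain hypothesis wants a Borel set for every index, so \<open>A\<close> is
      completed by \<open>UNIV\<close> outside the relevant times.\<close>
    define A' where "A' i = (if i \<in> {1..Suc n} then A i else UNIV)" for i
    have A' [measurable]: "A' i \<in> sets borel" for i using A by (auto simp: A'_def)
    have PA: "Pi\<^sub>E {1..Suc n} A \<in> sets ?M" using A by (intro sets_PiM_I_finite) auto
    let ?E = "{\<omega>\<in>space P. \<forall>i\<in>{1..n}. Y i \<omega> \<in> A' i}"
    have E: "?E \<in> sets P" by measurable
    have mK [measurable]: "(\<lambda>\<omega>. measure (K (Y n \<omega>)) (A' (Suc n))) \<in> borel_measurable P" by measurable
    have "emeasure (distr P ?M Z') (Pi\<^sub>E {1..Suc n} A) =
        emeasure P {\<omega>\<in>space P. \<forall>i\<in>{1..Suc n}. Y i \<omega> \<in> A' i}"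
      by (subst emeasure_distr[OF Z'm PA])
         (auto intro!: arg_cong[of _ _ "emeasure P"] simp: Z'_def A'_def PiE_iff)
    also have "\<dots> = ennreal (measure P {\<omega>\<in>space P. \<forall>i\<in>{1..Suc n}. Y i \<omega> \<in> A' i})"
      by (rule P.emeasure_eq_measure)
    also have "measure P {\<omega>\<in>space P. \<forall>i\<in>{1..Suc n}. Y i \<omega> \<in> A' i} =
        (\<integral>\<omega>. indicator ?E \<omega> * measure (K (Y n \<omega>)) (A' (Suc n)) \<partial>P)"
      using chain n A' unfolding markov_chain_from_def by blast
    also have "ennreal \<dots> = (\<integral>\<^sup>+\<omega>. ennreal (indicator ?E \<omega> * measure (K (Y n \<omega>)) (A' (Suc n))) \<partial>P)"
    proof (rule nn_integral_eq_integral[symmetric])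
      show "integrable P (\<lambda>\<omega>. indicator ?E \<omega> * measure (K (Y n \<omega>)) (A' (Suc n)))"
        by (rule P.integrable_const_bound[of _ 1])
           (use E prob_space.prob_le_1[OF prob_kernel] in \<open>auto simp: indicator_def\<close>)
    qed auto
    also have "\<dots> = (\<integral>\<^sup>+\<omega>. emeasure (R \<omega>) (Pi\<^sub>E {1..Suc n} A) \<partial>P)"
    proof (rule nn_integral_cong)
      fix \<omega> assume \<omega>: "\<omega> \<in> space P"
      have "emeasure (R \<omega>) (Pi\<^sub>E {1..Suc n} A) =
          emeasure (K (Y n \<omega>)) ((\<lambda>y. (Z \<omega>)(Suc n := y)) -` Pi\<^sub>E {1..Suc n} A \<inter> space (K (Y n \<omega>)))"
        unfolding R_def by (rule emeasure_distr[OF updm[OF \<omega>] PA])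
      also have "(\<lambda>y. (Z \<omega>)(Suc n := y)) -` Pi\<^sub>E {1..Suc n} A = (if \<omega> \<in> ?E then A' (Suc n) else {})"
      proof -
        have "(Z \<omega>)(Suc n := y) \<in> Pi\<^sub>E {1..Suc n} A \<longleftrightarrow> \<omega> \<in> ?E \<and> y \<in> A' (Suc n)" for y
        proof -
          have "(Z \<omega>)(Suc n := y) \<in> extensional {1..Suc n}" by (auto simp: Z_def extensional_def)
          then have "(Z \<omega>)(Suc n := y) \<in> Pi\<^sub>E {1..Suc n} A \<longleftrightarrow>
              (\<forall>i\<in>insert (Suc n) {1..n}. ((Z \<omega>)(Suc n := y)) i \<in> A i)"
            unfolding ins by (simp only: PiE_iff simp_thms)
          also have "\<dots> \<longleftrightarrow> (\<forall>i\<in>{1..n}. Y i \<omega> \<in> A i) \<and> y \<in> A (Suc n)" by (auto simp: Z_def)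
          also have "\<dots> \<longleftrightarrow> \<omega> \<in> ?E \<and> y \<in> A' (Suc n)" using \<omega> by (auto simp: A'_def)
          finally show ?thesis .
        qed
        then show ?thesis by auto
      qed
      also have "emeasure (K (Y n \<omega>)) (\<dots> \<inter> space (K (Y n \<omega>))) =
          ennreal (indicator ?E \<omega> * measure (K (Y n \<omega>)) (A' (Suc n)))"
        by (simp add: indicator_def finite_measure.emeasure_eq_measure[OF prob_space.finite_measure[OF prob_kernel]])
      finally show "ennreal (indicator ?E \<omega> * measure (K (Y n \<omega>)) (A' (Suc n))) =
          emeasure (R \<omega>) (Pi\<^sub>E {1..Suc n} A)" by simp
    qed
    also have "\<dots> = emeasure (P \<bind> R) (Pi\<^sub>E {1..Suc n} A)"
      by (rule emeasure_bind[symmetric, OF P.not_empty Rm PA])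
    finally show "emeasure (distr P ?M Z') (Pi\<^sub>E {1..Suc n} A) = emeasure (P \<bind> R) (Pi\<^sub>E {1..Suc n} A)" .
  next
    show "range (\<lambda>_. space ?M) \<subseteq> prod_algebra {1..Suc n} (\<lambda>_. borel)"
      by (auto simp: space_PiM intro!: prod_algebraI_finite)
    have "finite_measure (distr P ?M Z')"
      using P.prob_space_distr[OF Z'm] by (rule prob_space.finite_measure)
    then show "emeasure (distr P ?M Z') (space ?M) \<noteq> \<infinity>" for i :: nat
      by (simp add: finite_measure.emeasure_finite)
  qed auto
  have "(\<integral>\<omega>. F (Z' \<omega>) \<partial>P) = (\<integral>z. F z \<partial>distr P ?M Z')" by (rule integral_distr[OF Z'm F, symmetric])
  also have "\<dots> = (\<integral>z. F z \<partial>(P \<bind> R))" by (simp only: eq)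
  also have "\<dots> = (\<integral>\<omega>. (\<integral>z. F z \<partial>R \<omega>) \<partial>P)"
    by (rule integral_bind[OF F _ Rm P.finite_measure_axioms, where B=C and B'=1])
       (use Fb prob_space.emeasure_space_1[OF Rp] in auto)
  also have "\<dots> = (\<integral>\<omega>. (\<integral>y. F ((Z \<omega>)(Suc n := y)) \<partial>K (Y n \<omega>)) \<partial>P)"
    unfolding R_def by (intro Bochner_Integration.integral_cong refl integral_distr[OF updm F])
  finally show ?thesis unfolding Z_def Z'_def .
qed

end

subsection \<open>Doeblin kernels and the Poisson equation\<close>

text \<open>The minorizing law is the stationary law itself, which makes the part of the kernel
  split off by \<open>\<delta>\<close> act as zero on mean-zero functions.\<close>

locale doeblin_kernel = markov_kernel K for K :: "'a::topological_space \<Rightarrow> 'a measure" +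
  fixes \<nu> :: "'a measure" and \<delta> :: real
  assumes prob_stat: "prob_space \<nu>" and sets_stat: "sets \<nu> = sets borel"
    and stationary: "\<nu> \<bind> K = \<nu>"
    and minorization: "\<And>x A. A \<in> sets borel \<Longrightarrow> \<delta> * measure \<nu> A \<le> measure (K x) A"
    and delta_pos: "0 < \<delta>"
begin

lemma delta_le_1: "\<delta> \<le> 1"
  using minorization[of UNIV] prob_space.prob_space[OF prob_stat] sets_eq_imp_space_eq[OF sets_stat]
    prob_space.prob_space[OF prob_kernel, unfolded space_K] by simp

lemma integrable_stat: "bounded_measurable u \<Longrightarrow> integrable \<nu> u"
  by (rule bounded_measurable_integrable[OF _ prob_stat sets_stat])

lemma integral_stat_op: "bounded_measurable u \<Longrightarrow> (\<integral>x. op u x \<partial>\<nu>) = (\<integral>x. u x \<partial>\<nu>)"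
  using integral_bind_K[OF _ prob_stat sets_stat, of u] stationary by simp

lemma integral_stat_const: "(\<integral>x. c \<partial>\<nu>) = (c::real)"
  using prob_space.prob_space[OF prob_stat] by simp

lemma op_lower:
  assumes u: "bounded_measurable u" and nonneg: "\<And>y. 0 \<le> u y"
  shows "\<delta> * (\<integral>y. u y \<partial>\<nu>) \<le> op u x"
proof -
  interpret S: prob_space \<nu> by (rule prob_stat)
  interpret K: prob_space "K x" by (rule prob_kernel)
  have um: "u \<in> borel_measurable \<nu>" using integrable_stat[OF u] by simp
  have "ennreal (\<delta> * (\<integral>y. u y \<partial>\<nu>)) = ennreal \<delta> * (\<integral>\<^sup>+y. ennreal (u y) \<partial>\<nu>)"
    using delta_pos nonneg by (subst nn_integral_eq_integral[OF integrable_stat[OF u]]) (auto simp: ennreal_mult')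
  also have "\<dots> = (\<integral>\<^sup>+y. ennreal (u y) \<partial>scale_measure (ennreal \<delta>) \<nu>)"
    by (rule nn_integral_scale_measure[symmetric]) (use um in measurable)
  also have "\<dots> \<le> (\<integral>\<^sup>+y. ennreal (u y) \<partial>K x)"
  proof (rule nn_integral_mono_emeasure)
    fix A assume "A \<in> sets (scale_measure (ennreal \<delta>) \<nu>)"
    then have "A \<in> sets borel" by (simp add: sets_stat)
    then show "emeasure (scale_measure (ennreal \<delta>) \<nu>) A \<le> emeasure (K x) A"
      using minorization[of A x] delta_pos
      by (simp add: S.emeasure_eq_measure K.emeasure_eq_measure ennreal_mult'[symmetric])
  qed (simp add: sets_stat)
  also have "\<dots> = ennreal (op u x)"
    unfolding op_def using nonneg by (intro nn_integral_eq_integral[OF integrable_K[OF u]]) auto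
  finally show ?thesis
    using nonneg by (subst (asm) ennreal_le_iff) (simp_all add: op_def)
qed

text \<open>The functions \<open>C - u\<close> and \<open>C + u\<close> are nonnegative with
  stationary integral \<open>C\<close>, so each keeps at least \<open>\<delta> * C\<close> after one
  step. This is a two-sided bound on \<open>op u\<close>.\<close>

lemma op_contraction:
  assumes u: "bounded_measurable u" and mean: "(\<integral>y. u y \<partial>\<nu>) = 0" and C: "\<And>y. \<bar>u y\<bar> \<le> C"
  shows "\<bar>op u x\<bar> \<le> (1 - \<delta>) * C"
proof -
  have nonneg: "0 \<le> C - u y" "0 \<le> C + u y" for y using C[of y] by auto
  have "\<delta> * (\<integral>y. C - u y \<partial>\<nu>) \<le> op (\<lambda>y. C - u y) x"
    by (rule op_lower[OF bounded_measurable_diff[OF bounded_measurable_const u] nonneg(1)])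
  moreover have "\<delta> * (\<integral>y. C + u y \<partial>\<nu>) \<le> op (\<lambda>y. C + u y) x"
    by (rule op_lower[OF bounded_measurable_add[OF bounded_measurable_const u] nonneg(2)])
  moreover have "(\<integral>y. C - u y \<partial>\<nu>) = C" "(\<integral>y. C + u y \<partial>\<nu>) = C"
    using integrable_stat[OF u] integrable_stat[OF bounded_measurable_const[of C]] mean
    by (simp_all only: Bochner_Integration.integral_diff Bochner_Integration.integral_add integral_stat_const)
  moreover have "op (\<lambda>y. C - u y) x = C - op u x" "op (\<lambda>y. C + u y) x = C + op u x"
    using op_diff[OF bounded_measurable_const u] op_add[OF bounded_measurable_const u]
    by (simp_all add: op_const)
  ultimately have "\<delta> * C \<le> C - op u x" "\<delta> * C \<le> C + op u x" by simp_all
  then show ?thesis by (simp add: algebra_simps abs_le_iff)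
qed

lemma integral_stat_op_pow:
  "bounded_measurable u \<Longrightarrow> (\<integral>y. (op ^^ k) u y \<partial>\<nu>) = (\<integral>y. u y \<partial>\<nu>)"
  by (induction k) (auto simp: integral_stat_op bounded_measurable_op_pow)

lemma op_pow_contraction:
  assumes u: "bounded_measurable u" and mean: "(\<integral>y. u y \<partial>\<nu>) = 0" and C: "\<And>y. \<bar>u y\<bar> \<le> C"
  shows "\<bar>(op ^^ k) u x\<bar> \<le> (1 - \<delta>) ^ k * C"
proof (induction k arbitrary: x)
  case (Suc k)
  have "\<bar>op ((op ^^ k) u) x\<bar> \<le> (1 - \<delta>) * ((1 - \<delta>) ^ k * C)"
    by (rule op_contraction) (use Suc u mean in \<open>auto simp: bounded_measurable_op_pow integral_stat_op_pow\<close>)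
  then show ?case by (simp add: mult_ac)
qed (simp add: C)

text \<open>The Neumann series for the inverse of \<open>1 - op\<close>. Its convergence is only
  established for bounded functions of stationary mean zero.\<close>

definition poisson :: "('a \<Rightarrow> real) \<Rightarrow> 'a \<Rightarrow> real" where
  "poisson u x = (\<Sum>k. (op ^^ k) u x)"

context
  fixes u assumes u: "bounded_measurable u" and mean: "(\<integral>y. u y \<partial>\<nu>) = 0"
begin

lemma summable_geometric_bound: "summable (\<lambda>k. (1 - \<delta>) ^ k * C)"
  using delta_pos delta_le_1 by (intro summable_mult2 summable_geometric) auto

lemma summable_norm_op_pow: "summable (\<lambda>k. norm ((op ^^ k) u x))"
proof -
  obtain C where C: "\<And>x. \<bar>u x\<bar> \<le> C" using u by (meson bounded_measurableE)
  show ?thesis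
    by (rule summable_comparison_test'[OF summable_geometric_bound[of C], of 0])
       (use op_pow_contraction[OF u mean C] in auto)
qed

lemma summable_op_pow: "summable (\<lambda>k. (op ^^ k) u x)"
  by (rule summable_norm_cancel[OF summable_norm_op_pow])

lemma bounded_measurable_poisson: "bounded_measurable (poisson u)"
proof -
  obtain C where C: "\<And>x. \<bar>u x\<bar> \<le> C" using u by (meson bounded_measurableE)
  show ?thesis
  proof (rule bounded_measurableI)
    have [measurable]: "(op ^^ k) u \<in> borel_measurable borel" for k
      by (rule bounded_measurableD[OF bounded_measurable_op_pow[OF u]])
    show "poisson u \<in> borel_measurable borel" unfolding poisson_def[abs_def] by measurable
    fix x
    have "\<bar>poisson u x\<bar> \<le> (\<Sum>k. norm ((op ^^ k) u x))"
      unfolding poisson_def using summable_norm[OF summable_norm_op_pow] by simp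
    also have "\<dots> \<le> (\<Sum>k. (1 - \<delta>) ^ k * C)"
      by (intro suminf_le summable_norm_op_pow summable_geometric_bound)
         (use op_pow_contraction[OF u mean C] in auto)
    finally show "\<bar>poisson u x\<bar> \<le> (\<Sum>k. (1 - \<delta>) ^ k * C)" .
  qed
qed

text \<open>Integrating term by term covers both the kernels $K\,x$ and weighted integrals against
  the stationary law.\<close>
lemma sums_integral_op_pow:
  assumes M: "prob_space M" "sets M = sets borel" and g: "bounded_measurable g"
  shows "(\<lambda>k. \<integral>y. g y * (op ^^ k) u y \<partial>M) sums (\<integral>y. g y * poisson u y \<partial>M)"
proof -
  interpret M: prob_space M by fact
  obtain C where C: "\<And>x. \<bar>u x\<bar> \<le> C" using u by (meson bounded_measurableE)
  obtain D where D: "0 \<le> D" "\<And>x. \<bar>g x\<bar> \<le> D" using g by (meson bounded_measurableE)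
  have le: "norm (g y * (op ^^ k) u y) \<le> (1 - \<delta>) ^ k * (D * C)" for k y
  proof -
    have "\<bar>g y\<bar> * \<bar>(op ^^ k) u y\<bar> \<le> D * ((1 - \<delta>) ^ k * C)"
      by (intro mult_mono D op_pow_contraction[OF u mean C]) auto
    then show ?thesis by (simp add: abs_mult mult_ac)
  qed
  have gu: "bounded_measurable (\<lambda>y. g y * (op ^^ k) u y)" for k
    by (intro bounded_measurable_mult g bounded_measurable_op_pow u)
  have int: "integrable M (\<lambda>y. g y * (op ^^ k) u y)" for k
    by (rule bounded_measurable_integrable[OF gu M])
  have "(\<lambda>k. \<integral>y. g y * (op ^^ k) u y \<partial>M) sums (\<integral>y. (\<Sum>k. g y * (op ^^ k) u y) \<partial>M)"
  proof (rule sums_integral[OF int])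
    show "AE y in M. summable (\<lambda>k. norm (g y * (op ^^ k) u y))"
      by (intro AE_I2 summable_comparison_test'[OF summable_geometric_bound[of "D * C"], of 0])
         (use le in auto)
    show "summable (\<lambda>k. \<integral>y. norm (g y * (op ^^ k) u y) \<partial>M)"
    proof (rule summable_comparison_test'[OF summable_geometric_bound[of "D * C"], of 0])
      fix k
      have "(\<integral>y. norm (g y * (op ^^ k) u y) \<partial>M) \<le> (\<integral>y. (1 - \<delta>) ^ k * (D * C) \<partial>M)"
        by (intro integral_mono le) (use int in auto)
      then show "norm (\<integral>y. norm (g y * (op ^^ k) u y) \<partial>M) \<le> (1 - \<delta>) ^ k * (D * C)"
        by (simp add: M.prob_space)
    qed
  qed
  also have "(\<integral>y. (\<Sum>k. g y * (op ^^ k) u y) \<partial>M) = (\<integral>y. g y * poisson u y \<partial>M)"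
    unfolding poisson_def by (simp add: suminf_mult[OF summable_op_pow])
  finally show ?thesis .
qed

text \<open>Applying \<open>op\<close> termwise shifts the series by one index, so the difference is
  the term of index \<open>0\<close>.\<close>

lemma poisson_equation: "poisson u x - op (poisson u) x = u x"
proof -
  have "(\<lambda>k. op ((op ^^ k) u) x) sums op (poisson u) x"
    using sums_integral_op_pow[OF prob_kernel sets_K bounded_measurable_const[of 1], of x]
    by (simp add: op_def)
  then have 1: "(\<lambda>k. (op ^^ Suc k) u x) sums op (poisson u) x" by (simp only: funpow.simps o_apply)
  have "(\<lambda>k. (op ^^ k) u x) sums poisson u x"
    unfolding poisson_def by (rule summable_sums[OF summable_op_pow])
  then have "(\<lambda>k. (op ^^ Suc k) u x) sums (poisson u x - u x)"
    by (subst sums_Suc_iff[of "\<lambda>k. (op ^^ k) u x"]) (simp only: funpow_0 diff_add_cancel)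
  from sums_unique2[OF 1 this] show ?thesis by simp
qed

end

text \<open>This is the first-order corrector equation for \<open>a = op (poisson h)\<close>, since
  then \<open>h + a\<close> is \<open>poisson h\<close>.\<close>

lemma op_add_op_poisson:
  assumes "bounded_measurable h" "(\<integral>y. h y \<partial>\<nu>) = 0"
  shows "op (\<lambda>y. h y + op (poisson h) y) x = op (poisson h) x"
proof -
  have "(\<lambda>y. h y + op (poisson h) y) = poisson h"
  proof (rule ext)
    show "h y + op (poisson h) y = poisson h y" for y
      using poisson_equation[OF assms, of y] by linarith
  qed
  then show ?thesis by simp
qed

text \<open>The Green--Kubo formula in closed form: \<open>op (poisson h)\<close> is the sum of
  \<open>(op ^^ k) h\<close> over \<open>k \<ge> 1\<close>, so the second integral collects all
  positive lags.\<close>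

definition asymptotic_variance :: "('a \<Rightarrow> real) \<Rightarrow> real" where
  "asymptotic_variance h = (\<integral>y. h y * h y \<partial>\<nu>) + 2 * (\<integral>y. h y * op (poisson h) y \<partial>\<nu>)"

text \<open>Removing the lag \<open>0\<close> term turns \<open>poisson h\<close> into
  \<open>op (poisson h)\<close>. The separate \<open>g\<close> serves the cross-covariances of
  different coordinates.\<close>

lemma sums_autocovariance:
  assumes h: "bounded_measurable h" "(\<integral>y. h y \<partial>\<nu>) = 0" and g: "bounded_measurable g"
  shows "(\<lambda>k. \<integral>y. g y * (op ^^ Suc k) h y \<partial>\<nu>) sums (\<integral>y. g y * op (poisson h) y \<partial>\<nu>)"
proof -
  have "(\<integral>y. g y * op (poisson h) y \<partial>\<nu>) = (\<integral>y. g y * poisson h y - g y * h y \<partial>\<nu>)"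
  proof (intro Bochner_Integration.integral_cong refl)
    fix y
    have "op (poisson h) y = poisson h y - h y" using poisson_equation[OF h, of y] by linarith
    then show "g y * op (poisson h) y = g y * poisson h y - g y * h y" by (simp only: right_diff_distrib)
  qed
  also have "\<dots> = (\<integral>y. g y * poisson h y \<partial>\<nu>) - (\<integral>y. g y * h y \<partial>\<nu>)"
    by (intro Bochner_Integration.integral_diff integrable_stat bounded_measurable_mult g h bounded_measurable_poisson)
  finally show ?thesis
    using sums_integral_op_pow[OF h prob_stat sets_stat g]
    by (subst sums_Suc_iff[of "\<lambda>k. \<integral>y. g y * (op ^^ k) h y \<partial>\<nu>"]) (simp only: funpow_0 diff_add_cancel)
qed

end

subsection \<open>The central limit theorem for Doeblin kernels\<close>

text \<open>The subtracted expression is the product expanded to order two in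
  \<open>\<theta>\<close>, with real and imaginary parts grouped as the corrector equations need
  them.\<close>

lemma perturbed_exp_bound:
  fixes h a b \<theta> H :: real
  assumes "\<bar>h\<bar> \<le> H" "\<bar>a\<bar> \<le> H" "\<bar>b\<bar> \<le> H" "0 \<le> \<theta>" "\<theta> \<le> 1"
  shows "cmod (iexp (\<theta> * h) * (1 + \<i> * of_real (\<theta> * a) + of_real (\<theta>\<^sup>2 * b)) -
      (of_real (1 + \<theta>\<^sup>2 * (b - (h * h / 2 + h * a))) + \<i> * of_real (\<theta> * (h + a))))
    \<le> (H ^ 3 * (1 + 2 * H) + H\<^sup>2 + H ^ 3) * \<theta> ^ 3"
proof -
  have H: "0 \<le> H" using assms(1) by linarith
  define g where "g = 1 + \<i> * complex_of_real (\<theta> * a) + complex_of_real (\<theta>\<^sup>2 * b)"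
  \<comment> \<open>\<open>R\<close> is the Taylor remainder of the exponential and \<open>Q\<close>
    collects the terms of order three and four of the product of the two quadratic polynomials,
    divided by \<open>\<theta> ^ 3\<close>.\<close>
  define R where "R = iexp (\<theta> * h) - (1 + \<i> * of_real (\<theta> * h) - of_real (\<theta>\<^sup>2 * h\<^sup>2 / 2))"
  define Q where "Q = \<i> * of_real (h * b) - \<i> * of_real (h\<^sup>2 * a / 2) - of_real (\<theta> * h\<^sup>2 * b / 2)"
  have e: "iexp (\<theta> * h) = R + (1 + \<i> * of_real (\<theta> * h) - of_real (\<theta>\<^sup>2 * h\<^sup>2 / 2))" by (simp add: R_def)
  have eq: "iexp (\<theta> * h) * g - (of_real (1 + \<theta>\<^sup>2 * (b - (h * h / 2 + h * a))) + \<i> * of_real (\<theta> * (h + a)))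
      = R * g + of_real (\<theta> ^ 3) * Q"
    unfolding e g_def Q_def
    by (simp add: complex_eq_iff algebra_simps power2_eq_square power3_eq_cube)
  have "(\<Sum>k\<le>2. (\<i> * complex_of_real (\<theta> * h)) ^ k / fact k) =
      1 + \<i> * of_real (\<theta> * h) - of_real (\<theta>\<^sup>2 * h\<^sup>2 / 2)"
    by (simp add: numeral_2_eq_2 power_mult_distrib)
  then have "cmod R \<le> \<bar>\<theta> * h\<bar> ^ 3 / 6"
    unfolding R_def using iexp_approx1[of "\<theta> * h" 2] by (simp add: fact_numeral eval_nat_numeral)
  also have "\<dots> \<le> \<bar>\<theta> * h\<bar> ^ 3" by simp
  also have "\<dots> \<le> (\<theta> * H) ^ 3"
    using assms by (intro power_mono) (auto simp: abs_mult mult_left_mono)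
  finally have R: "cmod R \<le> \<theta> ^ 3 * H ^ 3" by (simp add: power_mult_distrib)
  have sq: "\<theta>\<^sup>2 \<le> 1" using assms(4,5) by (simp add: power_le_one)
  have "cmod g \<le> cmod 1 + cmod (\<i> * of_real (\<theta> * a)) + cmod (complex_of_real (\<theta>\<^sup>2 * b))"
    unfolding g_def by (meson norm_triangle_ineq add_right_mono order_trans)
  then have "cmod g \<le> 1 + \<bar>\<theta> * a\<bar> + \<bar>\<theta>\<^sup>2 * b\<bar>"
    by (simp only: norm_mult norm_of_real norm_ii mult_1 norm_one)
  moreover have "\<bar>\<theta> * a\<bar> \<le> 1 * H" "\<bar>\<theta>\<^sup>2 * b\<bar> \<le> 1 * H"
    unfolding abs_mult using assms sq by (intro mult_mono; simp)+
  ultimately have g: "cmod g \<le> 1 + 2 * H" by linarith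
  have "cmod Q \<le> \<bar>h * b\<bar> + \<bar>h\<^sup>2 * a / 2\<bar> + \<bar>\<theta> * h\<^sup>2 * b / 2\<bar>"
  proof -
    have "cmod Q \<le> cmod (\<i> * complex_of_real (h * b)) + cmod (\<i> * complex_of_real (h\<^sup>2 * a / 2)) +
        cmod (complex_of_real (\<theta> * h\<^sup>2 * b / 2))"
      unfolding Q_def by (meson norm_triangle_ineq4 add_right_mono order_trans)
    then show ?thesis by (simp only: norm_mult norm_of_real norm_ii mult_1)
  qed
  moreover have "\<bar>h * b\<bar> \<le> H * H" unfolding abs_mult using assms H by (intro mult_mono) auto
  moreover have h2: "h\<^sup>2 \<le> H\<^sup>2" using assms(1) H by (simp add: abs_le_square_iff[symmetric])
  moreover have h2a: "\<bar>h\<^sup>2 * a\<bar> \<le> H\<^sup>2 * H" unfolding abs_mult using assms H h2 by (intro mult_mono) auto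
  moreover have "\<bar>\<theta> * h\<^sup>2 * b\<bar> \<le> 1 * H\<^sup>2 * H" unfolding abs_mult using assms H h2 by (intro mult_mono) auto
  ultimately have "cmod Q \<le> H\<^sup>2 + H ^ 3" by (simp add: power2_eq_square power3_eq_cube)
  then have "cmod (R * g + of_real (\<theta> ^ 3) * Q) \<le> (\<theta> ^ 3 * H ^ 3) * (1 + 2 * H) + \<theta> ^ 3 * (H\<^sup>2 + H ^ 3)"
    using R g H assms(4)
    by (intro norm_triangle_le add_mono) (auto simp: norm_mult norm_power intro!: mult_mono)
  then show ?thesis unfolding eq[unfolded g_def] g_def by (simp add: algebra_simps)
qed

lemma integral_complex_parts:
  fixes f g :: "'a \<Rightarrow> real"
  assumes "integrable M f" "integrable M g"
  shows "(\<integral>x. complex_of_real (f x) + \<i> * complex_of_real (g x) \<partial>M) =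
    of_real (\<integral>x. f x \<partial>M) + \<i> * of_real (\<integral>x. g x \<partial>M)"
  using assms by (subst Bochner_Integration.integral_add) auto

lemma Complex_mult_iexp:
  "Complex u w * iexp s = of_real (cos s * u - sin s * w) + \<i> * of_real (sin s * u + cos s * w)"
  by (simp add: complex_eq_iff Re_exp Im_exp algebra_simps)

text \<open>Here \<open>s\<close> stands for the variance. All orders up to two cancel identically,
  which leaves \<open>\<theta> ^ 3 * Q\<close>.\<close>

lemma perturbed_eigenvalue_bound:
  fixes s a b \<theta> H :: real
  assumes "\<bar>a\<bar> \<le> H" "\<bar>b\<bar> \<le> H" "0 \<le> \<theta>" "\<theta> \<le> 1"
  shows "cmod (of_real (1 + \<theta>\<^sup>2 * (b - s / 2)) + \<i> * of_real (\<theta> * a) -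
      of_real (1 - \<theta>\<^sup>2 * s / 2) * (1 + \<i> * of_real (\<theta> * a) + of_real (\<theta>\<^sup>2 * b))) \<le> (\<bar>s\<bar> * H) * \<theta> ^ 3"
proof -
  define Q where "Q = \<i> * of_real (s * a / 2) + complex_of_real (\<theta> * s * b / 2)"
  have eq: "of_real (1 + \<theta>\<^sup>2 * (b - s / 2)) + \<i> * of_real (\<theta> * a) -
      of_real (1 - \<theta>\<^sup>2 * s / 2) * (1 + \<i> * of_real (\<theta> * a) + of_real (\<theta>\<^sup>2 * b)) = of_real (\<theta> ^ 3) * Q"
    unfolding Q_def by (simp add: complex_eq_iff algebra_simps power2_eq_square power3_eq_cube)
  have "cmod Q \<le> cmod (\<i> * of_real (s * a / 2)) + cmod (complex_of_real (\<theta> * s * b / 2))"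
    unfolding Q_def by (rule norm_triangle_ineq)
  also have "\<dots> = \<bar>s * a / 2\<bar> + \<bar>\<theta> * s * b / 2\<bar>" by (simp only: norm_mult norm_of_real norm_ii mult_1)
  also have "\<dots> = \<bar>s\<bar> * \<bar>a\<bar> / 2 + \<theta> * (\<bar>s\<bar> * \<bar>b\<bar>) / 2" using assms by (simp add: abs_mult)
  also have "\<dots> \<le> \<bar>s\<bar> * H / 2 + 1 * (\<bar>s\<bar> * H) / 2"
    using assms by (intro add_mono divide_right_mono mult_mono mult_left_mono) auto
  finally have "cmod Q \<le> \<bar>s\<bar> * H" by (simp add: mult.commute)
  then have "\<theta> ^ 3 * cmod Q \<le> \<theta> ^ 3 * (\<bar>s\<bar> * H)" using assms by (intro mult_left_mono) auto
  then show ?thesis unfolding eq using assms by (simp add: norm_mult norm_power mult.commute)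
qed

text \<open>A discrete Gronwall estimate. The factor is bounded by \<open>exp s\<close> and not by
  \<open>1\<close> because at the point of use the sign of the variance is still unknown.\<close>

lemma recursion_error_bound:
  fixes x :: "nat \<Rightarrow> complex" and r s C :: real
  assumes step: "\<And>n. cmod (x (Suc n) - of_real r * x n) \<le> C" and r: "\<bar>r\<bar> \<le> exp s" and "0 \<le> s" "0 \<le> C"
  shows "cmod (x n - of_real (r ^ n) * x 0) \<le> n * C * exp (s * n)"
proof (induction n)
  case (Suc n)
  have "cmod (x (Suc n) - of_real (r ^ Suc n) * x 0) \<le>
      cmod (x (Suc n) - of_real r * x n) + cmod (of_real r * (x n - of_real (r ^ n) * x 0))"
    using norm_triangle_ineq[of "x (Suc n) - of_real r * x n" "of_real r * (x n - of_real (r ^ n) * x 0)"]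
    by (simp add: algebra_simps)
  also have "\<dots> \<le> C + exp s * (n * C * exp (s * n))"
    unfolding norm_mult norm_of_real by (intro add_mono step mult_mono r Suc) auto
  also have "exp s * (n * C * exp (s * n)) = n * C * exp (s * Suc n)"
    by (simp add: algebra_simps exp_add)
  also have "C + \<dots> \<le> C * exp (s * Suc n) + n * C * exp (s * Suc n)"
    using assms(3,4) by (intro add_mono mult_left_le_one_le) (auto simp: mult_le_cancel_left1)
  finally show ?case by (simp add: algebra_simps)
qed simp

section \<open>The Markov property and the recursion for characteristic functions\<close>

context doeblin_kernel
begin

text \<open>One use of the Markov property: \<open>op w (Y n \<omega>)\<close> is the conditional
  expectation of \<open>w (Y (Suc n) \<omega>)\<close>, tested against a function of the past
  partial sum.\<close>

lemma chain_step:
  fixes \<phi> w h :: "_ \<Rightarrow> real"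
  assumes P: "prob_space P" and chain: "markov_chain_from P Y K x1" and n: "n \<ge> 1"
    and \<phi>: "\<phi> \<in> borel_measurable borel" "\<And>s. \<bar>\<phi> s\<bar> \<le> 1"
    and h: "bounded_measurable h" and w: "bounded_measurable w"
  shows "(\<integral>\<omega>. \<phi> (\<Sum>k\<in>{1..n}. h (Y k \<omega>)) * w (Y (Suc n) \<omega>) \<partial>P) =
         (\<integral>\<omega>. \<phi> (\<Sum>k\<in>{1..n}. h (Y k \<omega>)) * op w (Y n \<omega>) \<partial>P)"
proof -
  obtain C where C: "0 \<le> C" "\<And>x. \<bar>w x\<bar> \<le> C" using w by (meson bounded_measurableE)
  note [measurable] = bounded_measurableD[OF h] bounded_measurableD[OF w] \<phi>(1)
  define F where "F z = \<phi> (\<Sum>k\<in>{1..n}. h (z k)) * w (z (Suc n))" for z :: "nat \<Rightarrow> 'a"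
  have "(\<integral>\<omega>. F (\<lambda>i\<in>{1..Suc n}. Y i \<omega>) \<partial>P) =
         (\<integral>\<omega>. (\<integral>y. F ((\<lambda>i\<in>{1..n}. Y i \<omega>)(Suc n := y)) \<partial>K (Y n \<omega>)) \<partial>P)"
  proof (rule markov_chain_expectation[OF P chain n])
    have comp: "(\<lambda>z. z k) \<in> PiM {1..Suc n} (\<lambda>_. borel) \<rightarrow>\<^sub>M (borel :: 'a measure)" if "k \<in> {1..Suc n}" for k
      using measurable_component_singleton[OF that, of "\<lambda>_. borel"] .
    show "F \<in> borel_measurable (PiM {1..Suc n} (\<lambda>_. borel))"
      unfolding F_def[abs_def]
      by (intro borel_measurable_times measurable_compose[OF _ \<phi>(1)] borel_measurable_sum
           measurable_compose[OF comp bounded_measurableD[OF h]]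
           measurable_compose[OF comp bounded_measurableD[OF w]]) auto
    show "\<bar>F z\<bar> \<le> 1 * C" for z unfolding F_def abs_mult using C \<phi>(2) by (intro mult_mono) auto
  qed
  also have "(\<lambda>\<omega>. F (\<lambda>i\<in>{1..Suc n}. Y i \<omega>)) = (\<lambda>\<omega>. \<phi> (\<Sum>k\<in>{1..n}. h (Y k \<omega>)) * w (Y (Suc n) \<omega>))"
    unfolding F_def by (intro ext arg_cong2[where f="(*)"] arg_cong[where f=\<phi>] sum.cong) auto
  also have "(\<lambda>\<omega>. \<integral>y. F ((\<lambda>i\<in>{1..n}. Y i \<omega>)(Suc n := y)) \<partial>K (Y n \<omega>)) =
      (\<lambda>\<omega>. \<phi> (\<Sum>k\<in>{1..n}. h (Y k \<omega>)) * op w (Y n \<omega>))"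
  proof (rule ext)
    fix \<omega>
    have "F ((\<lambda>i\<in>{1..n}. Y i \<omega>)(Suc n := y)) = \<phi> (\<Sum>k\<in>{1..n}. h (Y k \<omega>)) * w y" for y
      unfolding F_def by (intro arg_cong2[where f="(*)"] arg_cong[where f=\<phi>] sum.cong) auto
    then show "(\<integral>y. F ((\<lambda>i\<in>{1..n}. Y i \<omega>)(Suc n := y)) \<partial>K (Y n \<omega>)) =
        \<phi> (\<Sum>k\<in>{1..n}. h (Y k \<omega>)) * op w (Y n \<omega>)" by (simp add: op_def)
  qed
  finally show ?thesis .
qed

lemma integrable_chain_real:
  fixes \<phi> w h :: "_ \<Rightarrow> real"
  assumes P: "prob_space P" and chain: "markov_chain_from P Y K x1"
    and \<phi>: "\<phi> \<in> borel_measurable borel" "\<And>s. \<bar>\<phi> s\<bar> \<le> 1"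
    and h: "bounded_measurable h" and w: "bounded_measurable w"
  shows "integrable P (\<lambda>\<omega>. \<phi> (\<Sum>k\<in>{1..n}. h (Y k \<omega>)) * w (Y m \<omega>))"
proof -
  interpret P: prob_space P by fact
  have Y: "Y i \<in> P \<rightarrow>\<^sub>M borel" for i using chain unfolding markov_chain_from_def by blast
  obtain C where C: "0 \<le> C" "\<And>x. \<bar>w x\<bar> \<le> C" using w by (meson bounded_measurableE)
  show ?thesis
  proof (rule P.integrable_const_bound[of _ "1 * C"])
    show "(\<lambda>\<omega>. \<phi> (\<Sum>k\<in>{1..n}. h (Y k \<omega>)) * w (Y m \<omega>)) \<in> borel_measurable P"
      by (intro borel_measurable_times measurable_compose[OF _ \<phi>(1)] borel_measurable_sum
           measurable_compose[OF Y bounded_measurableD[OF h]]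
           measurable_compose[OF Y bounded_measurableD[OF w]])
    show "AE \<omega> in P. norm (\<phi> (\<Sum>k\<in>{1..n}. h (Y k \<omega>)) * w (Y m \<omega>)) \<le> 1 * C"
      unfolding real_norm_def abs_mult using C \<phi>(2) by (intro AE_I2 mult_mono) auto
  qed
qed

text \<open>The Markov property is stated for real functionals, so the complex product is split into
  cosine and sine parts, each of which has the required product form.\<close>

lemma chain_step_complex:
  assumes P: "prob_space P" and chain: "markov_chain_from P Y K x1" and n: "n \<ge> 1"
    and h: "bounded_measurable h" and w: "bounded_measurable w1" "bounded_measurable w2"
  shows "(\<integral>\<omega>. Complex (w1 (Y (Suc n) \<omega>)) (w2 (Y (Suc n) \<omega>)) * iexp (\<theta> * (\<Sum>k\<in>{1..n}. h (Y k \<omega>))) \<partial>P) =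
         (\<integral>\<omega>. Complex (op w1 (Y n \<omega>)) (op w2 (Y n \<omega>)) * iexp (\<theta> * (\<Sum>k\<in>{1..n}. h (Y k \<omega>))) \<partial>P)"
proof -
  have c: "(\<lambda>s. cos (\<theta> * s)) \<in> borel_measurable borel" "\<And>s. \<bar>cos (\<theta> * s)\<bar> \<le> 1"
    and s: "(\<lambda>s. sin (\<theta> * s)) \<in> borel_measurable borel" "\<And>s. \<bar>sin (\<theta> * s)\<bar> \<le> 1"
    by (auto intro!: borel_measurable_continuous_onI continuous_intros)
  note i = integrable_chain_real[OF P chain c h] integrable_chain_real[OF P chain s h]
  note i' = i[OF w(1)] i[OF w(2)] i[OF bounded_measurable_op[OF w(1)]] i[OF bounded_measurable_op[OF w(2)]]
  note st = chain_step[OF P chain n c h] chain_step[OF P chain n s h]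
  show ?thesis
    unfolding Complex_mult_iexp
    by (subst (1 2) integral_complex_parts)
       (simp_all only: Bochner_Integration.integral_diff Bochner_Integration.integral_add
         Bochner_Integration.integrable_diff Bochner_Integration.integrable_add i' st[OF w(1)] st[OF w(2)])
qed

text \<open>Two Poisson equations: the first removes order one; the second has right-hand side
  depending on \<open>a\<close>, and centering it brings in the asymptotic variance.\<close>

lemma corrector_exists:
  assumes h: "bounded_measurable h" and mean: "(\<integral>y. h y \<partial>\<nu>) = 0"
  obtains a b where "bounded_measurable a" "bounded_measurable b"
    "\<And>x. op (\<lambda>y. h y + a y) x = a x"
    "\<And>x. op (\<lambda>y. b y - (h y * h y / 2 + h y * a y)) x = b x - asymptotic_variance h / 2"
proof -
  define a where "a = op (poisson h)"
  have a: "bounded_measurable a" unfolding a_def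
    by (rule bounded_measurable_op[OF bounded_measurable_poisson[OF h mean]])
  define k where "k y = h y * h y / 2 + h y * a y" for y
  have hh: "bounded_measurable (\<lambda>y. h y * h y)" "bounded_measurable (\<lambda>y. h y * a y)"
    by (intro bounded_measurable_mult h a)+
  have k: "bounded_measurable k"
    unfolding k_def[abs_def] using bounded_measurable_add[OF bounded_measurable_cmult[OF hh(1), of "1/2"] hh(2)] by simp
  have ks: "(\<integral>y. k y \<partial>\<nu>) = asymptotic_variance h / 2"
  proof -
    have "(\<integral>y. k y \<partial>\<nu>) = (\<integral>y. h y * h y / 2 \<partial>\<nu>) + (\<integral>y. h y * a y \<partial>\<nu>)"
      unfolding k_def using integrable_stat[OF hh(1)] integrable_stat[OF hh(2)]
      by (intro Bochner_Integration.integral_add) auto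
    then show ?thesis by (simp add: asymptotic_variance_def a_def)
  qed
  \<comment> \<open>The wanted equation \<open>op (b - k) = b - sigma^2/2\<close> reads
    \<open>b - op b = - w\<close>, with \<open>op k\<close> and not \<open>k\<close> inside
    \<open>w\<close>; hence \<open>b\<close> is minus the Poisson solution for
    \<open>w\<close>.\<close>
  define w where "w y = op k y - asymptotic_variance h / 2" for y
  have w: "bounded_measurable w" unfolding w_def[abs_def]
    by (intro bounded_measurable_diff bounded_measurable_op k bounded_measurable_const)
  have wm: "(\<integral>y. w y \<partial>\<nu>) = 0"
  proof -
    have "(\<integral>y. w y \<partial>\<nu>) = (\<integral>y. op k y \<partial>\<nu>) - (\<integral>y. asymptotic_variance h / 2 \<partial>\<nu>)"
      unfolding w_def by (intro Bochner_Integration.integral_diff integrable_stat bounded_measurable_op k bounded_measurable_const)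
    then show ?thesis by (simp only: integral_stat_op[OF k] ks integral_stat_const)
  qed
  have pw: "bounded_measurable (poisson w)" by (rule bounded_measurable_poisson[OF w wm])
  define b where "b y = -1 * poisson w y" for y
  have b: "bounded_measurable b" unfolding b_def[abs_def] by (rule bounded_measurable_cmult[OF pw])
  show thesis
  proof (rule that[of a b])
    show "op (\<lambda>y. h y + a y) x = a x" for x unfolding a_def by (rule op_add_op_poisson[OF h mean])
    show "op (\<lambda>y. b y - (h y * h y / 2 + h y * a y)) x = b x - asymptotic_variance h / 2" for x
    proof -
      have "op (\<lambda>y. b y - k y) x = op b x - op k x" by (rule op_diff[OF b k])
      also have "op b x = - op (poisson w) x" unfolding b_def[abs_def] by (subst op_cmult) (rule mult_minus1)
      also have "op (poisson w) x = poisson w x - w x" using poisson_equation[OF w wm, of x] by simp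
      finally show ?thesis by (simp add: k_def[abs_def] b_def w_def)
    qed
  qed (rule a b)+
qed

text \<open>The function $1 + i\theta a + \theta^2 b$ is an eigenfunction of the kernel twisted by
  $e^{i\theta h}$, up to $O(\theta^3)$, with eigenvalue $1 - \theta^2 \sigma^2 / 2$.\<close>
lemma twisted_eigenfunction:
  assumes h: "bounded_measurable h" and a: "bounded_measurable a" and b: "bounded_measurable b"
    and ea: "\<And>x. op (\<lambda>y. h y + a y) x = a x"
    and eb: "\<And>x. op (\<lambda>y. b y - (h y * h y / 2 + h y * a y)) x = b x - s / 2"
  obtains C where "0 \<le> C" "\<And>\<theta> x. 0 \<le> \<theta> \<Longrightarrow> \<theta> \<le> 1 \<Longrightarrow>
    cmod ((\<integral>y. iexp (\<theta> * h y) * (1 + \<i> * of_real (\<theta> * a y) + of_real (\<theta>\<^sup>2 * b y)) \<partial>K x) -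
      of_real (1 - \<theta>\<^sup>2 * s / 2) * (1 + \<i> * of_real (\<theta> * a x) + of_real (\<theta>\<^sup>2 * b x))) \<le> C * \<theta> ^ 3"
proof -
  obtain H1 H2 H3 where H0: "0 \<le> H1" "\<And>x. \<bar>h x\<bar> \<le> H1" "0 \<le> H2" "\<And>x. \<bar>a x\<bar> \<le> H2" "0 \<le> H3" "\<And>x. \<bar>b x\<bar> \<le> H3"
    using h a b by (meson bounded_measurableE)
  define H where "H = H1 + H2 + H3"
  have Hp: "0 \<le> H" using H0 by (simp add: H_def)
  have H: "\<bar>h x\<bar> \<le> H" "\<bar>a x\<bar> \<le> H" "\<bar>b x\<bar> \<le> H" for x
    using H0(2)[of x] H0(4)[of x] H0(6)[of x] H0(1,3,5) by (auto simp: H_def)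
  define C1 where "C1 = H ^ 3 * (1 + 2 * H) + H\<^sup>2 + H ^ 3"
  define C where "C = C1 + \<bar>s\<bar> * H"
  define k where "k y = b y - (h y * h y / 2 + h y * a y)" for y
  have k: "bounded_measurable k"
  proof -
    have "bounded_measurable (\<lambda>y. b y - (1/2 * (h y * h y) + h y * a y))"
      by (intro bounded_measurable_diff bounded_measurable_add bounded_measurable_cmult bounded_measurable_mult h a b)
    then show ?thesis by (simp add: k_def[abs_def])
  qed
  have ha: "bounded_measurable (\<lambda>y. h y + a y)" by (rule bounded_measurable_add[OF h a])
  note [measurable] = bounded_measurableD[OF h] bounded_measurableD[OF a] bounded_measurableD[OF b]
  have "cmod ((\<integral>y. iexp (\<theta> * h y) * (1 + \<i> * of_real (\<theta> * a y) + of_real (\<theta>\<^sup>2 * b y)) \<partial>K x) -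
      of_real (1 - \<theta>\<^sup>2 * s / 2) * (1 + \<i> * of_real (\<theta> * a x) + of_real (\<theta>\<^sup>2 * b x))) \<le> C * \<theta> ^ 3"
    if \<theta>: "0 \<le> \<theta>" "\<theta> \<le> 1" for \<theta> x
  proof -
    interpret K: prob_space "K x" by (rule prob_kernel)
    define g where "g y = 1 + \<i> * complex_of_real (\<theta> * a y) + of_real (\<theta>\<^sup>2 * b y)" for y
    \<comment> \<open>The integrand up to order two. Its real part contains \<open>k\<close> and its
      imaginary part \<open>h + a\<close>, so \<open>eb\<close> and \<open>ea\<close> evaluate the
      integral exactly.\<close>
    define L where "L y = complex_of_real (1 + \<theta>\<^sup>2 * k y) + \<i> * of_real (\<theta> * (h y + a y))" for y
    have b1: "bounded_measurable (\<lambda>y. 1 + \<theta>\<^sup>2 * k y)"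
      by (intro bounded_measurable_add bounded_measurable_cmult bounded_measurable_const k)
    have b2: "bounded_measurable (\<lambda>y. \<theta> * (h y + a y))"
      by (intro bounded_measurable_cmult ha)
    have Li: "integrable (K x) L" unfolding L_def
      by (intro Bochner_Integration.integrable_add Bochner_Integration.integrable_mult_right
           integrable_of_real integrable_K b1 b2)
    have Le: "(\<integral>y. L y \<partial>K x) = complex_of_real (1 + \<theta>\<^sup>2 * (b x - s / 2)) + \<i> * of_real (\<theta> * a x)"
    proof -
      have "(\<integral>y. L y \<partial>K x) = complex_of_real (op (\<lambda>y. 1 + \<theta>\<^sup>2 * k y) x) + \<i> * of_real (op (\<lambda>y. \<theta> * (h y + a y)) x)"
        unfolding L_def op_def by (rule integral_complex_parts[OF integrable_K[OF b1] integrable_K[OF b2]])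
      also have "op (\<lambda>y. 1 + \<theta>\<^sup>2 * k y) x = 1 + \<theta>\<^sup>2 * op k x"
        by (simp only: op_add[OF bounded_measurable_const bounded_measurable_cmult[OF k]] op_const op_cmult)
      also have "op (\<lambda>y. \<theta> * (h y + a y)) x = \<theta> * a x" by (simp only: op_cmult ea)
      also have "op k x = b x - s / 2" unfolding k_def[abs_def] by (rule eb)
      finally show ?thesis .
    qed
    have pt: "cmod (iexp (\<theta> * h y) * g y - L y) \<le> C1 * \<theta> ^ 3" for y
      unfolding g_def L_def k_def C1_def by (rule perturbed_exp_bound[OF H \<theta>])
    have "(\<lambda>y. iexp (\<theta> * h y) * g y) \<in> borel_measurable borel" unfolding g_def[abs_def] by measurable
    then have gm: "(\<lambda>y. iexp (\<theta> * h y) * g y) \<in> borel_measurable (K x)"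
      by (subst measurable_cong_sets[OF sets_K refl])
    have gi: "integrable (K x) (\<lambda>y. iexp (\<theta> * h y) * g y)"
    proof (rule K.integrable_const_bound[OF _ gm])
      have "cmod (g y) \<le> 1 + H + H" for y
      proof -
        have sq: "\<theta>\<^sup>2 \<le> 1" using \<theta> by (simp add: power_le_one)
        have "cmod (g y) \<le> cmod 1 + cmod (\<i> * of_real (\<theta> * a y)) + cmod (complex_of_real (\<theta>\<^sup>2 * b y))"
          unfolding g_def by (meson norm_triangle_ineq add_right_mono order_trans)
        then have "cmod (g y) \<le> 1 + \<bar>\<theta> * a y\<bar> + \<bar>\<theta>\<^sup>2 * b y\<bar>"
          by (simp only: norm_mult norm_of_real norm_ii mult_1 norm_one)
        moreover have "\<bar>\<theta> * a y\<bar> \<le> 1 * H" "\<bar>\<theta>\<^sup>2 * b y\<bar> \<le> 1 * H"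
          unfolding abs_mult using H \<theta> sq by (intro mult_mono; simp)+
        ultimately show ?thesis by linarith
      qed
      then show "AE y in K x. cmod (iexp (\<theta> * h y) * g y) \<le> 1 + H + H" by (simp add: norm_mult)
    qed
    have "cmod ((\<integral>y. iexp (\<theta> * h y) * g y \<partial>K x) - (\<integral>y. L y \<partial>K x)) = cmod (\<integral>y. iexp (\<theta> * h y) * g y - L y \<partial>K x)"
      using gi Li by simp
    also have "\<dots> \<le> (\<integral>y. cmod (iexp (\<theta> * h y) * g y - L y) \<partial>K x)" by (rule integral_norm_bound)
    also have "\<dots> \<le> (\<integral>y. C1 * \<theta> ^ 3 \<partial>K x)"
      by (intro integral_mono pt) (use gi Li in auto)
    also have "\<dots> = C1 * \<theta> ^ 3" using K.prob_space by simp
    finally have 1: "cmod ((\<integral>y. iexp (\<theta> * h y) * g y \<partial>K x) - (\<integral>y. L y \<partial>K x)) \<le> C1 * \<theta> ^ 3" .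
    have 2: "cmod ((\<integral>y. L y \<partial>K x) - of_real (1 - \<theta>\<^sup>2 * s / 2) * g x) \<le> (\<bar>s\<bar> * H) * \<theta> ^ 3"
      unfolding Le g_def by (rule perturbed_eigenvalue_bound[OF H(2,3) \<theta>])
    have "cmod ((\<integral>y. iexp (\<theta> * h y) * g y \<partial>K x) - of_real (1 - \<theta>\<^sup>2 * s / 2) * g x) \<le> C1 * \<theta> ^ 3 + (\<bar>s\<bar> * H) * \<theta> ^ 3"
      using norm_triangle_le[OF add_mono[OF 1 2]] by (simp add: algebra_simps)
    then show ?thesis unfolding C_def g_def by (simp add: algebra_simps)
  qed
  moreover have "0 \<le> C" using Hp by (simp add: C_def C1_def)
  ultimately show thesis using that by blast
qed

text \<open>Weighting the exponential by the approximate eigenfunction gives a quantity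
  \<open>x\<close> with an almost exact scalar recursion. The weight is within
  \<open>O(\<theta>)\<close> of \<open>1\<close>, so it changes neither end in the limit, and the
  errors \<open>C * \<theta> ^ 3\<close> of fewer than \<open>N\<close> steps add up to
  \<open>O(\<theta>)\<close>.\<close>

theorem chain_char_tendsto:
  assumes P: "prob_space P" and chain: "markov_chain_from P Y K x1"
    and h: "bounded_measurable h" and mean: "(\<integral>y. h y \<partial>\<nu>) = 0"
  shows "(\<lambda>N. \<integral>\<omega>. iexp (1 / sqrt (real N) * (\<Sum>k\<in>{1..N}. h (Y k \<omega>))) \<partial>P) \<longlonglongrightarrow>
    of_real (exp (- asymptotic_variance h / 2))"
proof -
  interpret P: prob_space P by fact
  have Y [measurable]: "Y i \<in> P \<rightarrow>\<^sub>M borel" for i using chain unfolding markov_chain_from_def by blast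
  have Y1: "Y 1 \<omega> = x1" if "\<omega> \<in> space P" for \<omega> using chain that unfolding markov_chain_from_def by blast
  define s where "s = asymptotic_variance h"
  obtain a b where a: "bounded_measurable a" and b: "bounded_measurable b"
    and ea: "\<And>x. op (\<lambda>y. h y + a y) x = a x"
    and eb: "\<And>x. op (\<lambda>y. b y - (h y * h y / 2 + h y * a y)) x = b x - s / 2"
    using corrector_exists[OF h mean] unfolding s_def by blast
  obtain H1 H2 where H0: "0 \<le> H1" "\<And>x. \<bar>a x\<bar> \<le> H1" "0 \<le> H2" "\<And>x. \<bar>b x\<bar> \<le> H2"
    using a b by (meson bounded_measurableE)
  define g where "g \<theta> y = 1 + \<i> * complex_of_real (\<theta> * a y) + of_real (\<theta>\<^sup>2 * b y)" for \<theta> y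
  obtain C where C: "0 \<le> C" "\<And>\<theta> x. 0 \<le> \<theta> \<Longrightarrow> \<theta> \<le> 1 \<Longrightarrow>
    cmod ((\<integral>y. iexp (\<theta> * h y) * g \<theta> y \<partial>K x) - of_real (1 - \<theta>\<^sup>2 * s / 2) * g \<theta> x) \<le> C * \<theta> ^ 3"
    using twisted_eigenfunction[OF h a b ea eb] unfolding g_def by blast
  note [measurable] = bounded_measurableD[OF h] bounded_measurableD[OF a] bounded_measurableD[OF b]
  define S where "S n \<omega> = (\<Sum>k\<in>{1..n}. h (Y k \<omega>))" for n \<omega>
  have Sm [measurable]: "S n \<in> borel_measurable P" for n unfolding S_def[abs_def] by measurable
  define x where "x \<theta> n = (\<integral>\<omega>. g \<theta> (Y n \<omega>) * iexp (\<theta> * S n \<omega>) \<partial>P)" for \<theta> n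
  have g1: "cmod (g \<theta> y - 1) \<le> \<theta> * (H1 + H2)" if \<theta>: "0 \<le> \<theta>" "\<theta> \<le> 1" for \<theta> y
  proof -
    have sq: "\<theta>\<^sup>2 \<le> \<theta>" using \<theta> by (simp add: power2_eq_square mult_left_le)
    have "cmod (g \<theta> y - 1) = cmod (\<i> * of_real (\<theta> * a y) + complex_of_real (\<theta>\<^sup>2 * b y))"
      unfolding g_def by (simp add: algebra_simps)
    also have "\<dots> \<le> cmod (\<i> * of_real (\<theta> * a y)) + cmod (complex_of_real (\<theta>\<^sup>2 * b y))"
      by (rule norm_triangle_ineq)
    also have "\<dots> = \<bar>\<theta> * a y\<bar> + \<bar>\<theta>\<^sup>2 * b y\<bar>"
      by (simp only: norm_mult norm_of_real norm_ii mult_1)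
    also have "\<dots> \<le> \<theta> * H1 + \<theta> * H2"
      unfolding abs_mult using H0 \<theta> sq by (intro add_mono mult_mono) auto
    finally show ?thesis by (simp add: algebra_simps)
  qed
  have gm [measurable]: "g \<theta> \<in> borel_measurable borel" for \<theta> unfolding g_def[abs_def] by measurable
  have gb: "cmod (g \<theta> y) \<le> 1 + (H1 + H2)" if \<theta>: "0 \<le> \<theta>" "\<theta> \<le> 1" for \<theta> y
  proof -
    have "cmod (g \<theta> y) \<le> cmod 1 + cmod (g \<theta> y - 1)" using norm_triangle_ineq[of 1 "g \<theta> y - 1"] by simp
    moreover have "\<theta> * (H1 + H2) \<le> 1 * (H1 + H2)" using \<theta> H0 by (intro mult_right_mono) auto
    ultimately show ?thesis using g1[OF \<theta>, of y] by simp
  qed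
  have gi: "integrable P (\<lambda>\<omega>. g \<theta> (Y n \<omega>) * iexp (\<theta> * S m \<omega>))" if \<theta>: "0 \<le> \<theta>" "\<theta> \<le> 1" for \<theta> n m
    by (rule P.integrable_const_bound[of _ "1 + (H1 + H2)"]) (use gb[OF \<theta>] in \<open>auto simp: norm_mult\<close>)
  have iexpm: "(\<lambda>\<omega>. iexp (\<theta> * S n \<omega>)) \<in> borel_measurable P" for \<theta> n by measurable
  have ei: "integrable P (\<lambda>\<omega>. iexp (\<theta> * S n \<omega>))" for \<theta> n
    by (rule P.integrable_const_bound[of _ 1]) (simp_all only: iexpm norm_exp_i_times order_refl simp_thms eventually_True)
  have step: "cmod (x \<theta> (Suc n) - of_real (1 - \<theta>\<^sup>2 * s / 2) * x \<theta> n) \<le> C * \<theta> ^ 3"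
    if \<theta>: "0 \<le> \<theta>" "\<theta> \<le> 1" and n: "n \<ge> 1" for \<theta> n
  proof -
    define w where "w y = iexp (\<theta> * h y) * g \<theta> y" for y
    have wm [measurable]: "w \<in> borel_measurable borel" unfolding w_def[abs_def] by measurable
    have wb: "cmod (w y) \<le> 1 + (H1 + H2)" for y using gb[OF \<theta>, of y] by (simp add: w_def norm_mult)
    have w1: "bounded_measurable (\<lambda>y. Re (w y))"
      by (rule bounded_measurableI[of _ "1 + (H1 + H2)"])
         (use wb abs_Re_le_cmod order_trans in \<open>auto, blast\<close>)
    have w2: "bounded_measurable (\<lambda>y. Im (w y))"
      by (rule bounded_measurableI[of _ "1 + (H1 + H2)"])
         (use wb abs_Im_le_cmod order_trans in \<open>auto, blast\<close>)
    define J where "J y = Complex (op (\<lambda>y. Re (w y)) y) (op (\<lambda>y. Im (w y)) y)" for y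
    have Jw: "J y = (\<integral>z. w z \<partial>K y)" for y
    proof -
      interpret Ky: prob_space "K y" by (rule prob_kernel)
      have "w \<in> borel_measurable (K y)" by (subst measurable_cong_sets[OF sets_K refl]) (rule wm)
      then have "integrable (K y) w" by (intro Ky.integrable_const_bound[of _ "1 + (H1 + H2)"]) (use wb in auto)
      then show ?thesis unfolding J_def op_def by (simp add: complex_eq_iff)
    qed
    have J: "cmod (J y - of_real (1 - \<theta>\<^sup>2 * s / 2) * g \<theta> y) \<le> C * \<theta> ^ 3" for y
      unfolding Jw w_def by (rule C(2)[OF \<theta>])
    have Jm [measurable]: "J \<in> borel_measurable borel"
      unfolding J_def[abs_def] Complex_eq
      using bounded_measurableD[OF bounded_measurable_op[OF w1]] bounded_measurableD[OF bounded_measurable_op[OF w2]]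
      by measurable
    \<comment> \<open>The last summand of \<open>S (Suc n)\<close> is absorbed into
      \<open>w\<close>, so the remaining phase depends on the first \<open>n\<close> states and the
      Markov property applies.\<close>
    have "(\<lambda>\<omega>. g \<theta> (Y (Suc n) \<omega>) * iexp (\<theta> * S (Suc n) \<omega>)) =
        (\<lambda>\<omega>. Complex (Re (w (Y (Suc n) \<omega>))) (Im (w (Y (Suc n) \<omega>))) * iexp (\<theta> * S n \<omega>))"
      unfolding complex.collapse by (simp add: fun_eq_iff w_def S_def exp_add algebra_simps)
    then have "x \<theta> (Suc n) = (\<integral>\<omega>. Complex (Re (w (Y (Suc n) \<omega>))) (Im (w (Y (Suc n) \<omega>))) * iexp (\<theta> * S n \<omega>) \<partial>P)"
      unfolding x_def by simp
    also have "\<dots> = (\<integral>\<omega>. J (Y n \<omega>) * iexp (\<theta> * S n \<omega>) \<partial>P)"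
      unfolding S_def J_def by (rule chain_step_complex[OF P chain n h w1 w2])
    finally have xs: "x \<theta> (Suc n) = (\<integral>\<omega>. J (Y n \<omega>) * iexp (\<theta> * S n \<omega>) \<partial>P)" .
    define D where "D \<omega> = (J (Y n \<omega>) - of_real (1 - \<theta>\<^sup>2 * s / 2) * g \<theta> (Y n \<omega>)) * iexp (\<theta> * S n \<omega>)" for \<omega>
    have Dm: "D \<in> borel_measurable P" unfolding D_def[abs_def] by measurable
    have Db: "cmod (D \<omega>) \<le> C * \<theta> ^ 3" for \<omega> using J[of "Y n \<omega>"] by (simp add: D_def norm_mult)
    have Di: "integrable P D" by (rule P.integrable_const_bound[of _ "C * \<theta> ^ 3"]) (use Db Dm in auto)
    have "(\<integral>\<omega>. J (Y n \<omega>) * iexp (\<theta> * S n \<omega>) \<partial>P) =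
        (\<integral>\<omega>. D \<omega> + of_real (1 - \<theta>\<^sup>2 * s / 2) * (g \<theta> (Y n \<omega>) * iexp (\<theta> * S n \<omega>)) \<partial>P)"
      by (intro Bochner_Integration.integral_cong refl) (simp add: D_def algebra_simps)
    also have "\<dots> = (\<integral>\<omega>. D \<omega> \<partial>P) + of_real (1 - \<theta>\<^sup>2 * s / 2) * x \<theta> n"
      unfolding x_def using Di gi[OF \<theta>, of n n]
      by (subst Bochner_Integration.integral_add) auto
    finally have "x \<theta> (Suc n) - of_real (1 - \<theta>\<^sup>2 * s / 2) * x \<theta> n = (\<integral>\<omega>. D \<omega> \<partial>P)" using xs by simp
    moreover have "cmod (\<integral>\<omega>. D \<omega> \<partial>P) \<le> (\<integral>\<omega>. C * \<theta> ^ 3 \<partial>P)"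
      by (rule order_trans[OF integral_norm_bound integral_mono]) (use Di Db in auto)
    ultimately show ?thesis by (simp add: P.prob_space)
  qed
  define \<theta> where "\<theta> N = 1 / sqrt (real N)" for N :: nat
  have \<theta>b: "0 \<le> \<theta> N" "\<theta> N \<le> 1" if "N \<ge> 1" for N using that by (auto simp: \<theta>_def)
  have \<theta>2: "(\<theta> N)\<^sup>2 = 1 / real N" for N by (simp add: \<theta>_def power_divide)
  have \<theta>lim: "\<theta> \<longlonglongrightarrow> 0" unfolding \<theta>_def
    by (intro tendsto_divide_0[OF tendsto_const] filterlim_at_top_imp_at_infinity filterlim_compose[OF sqrt_at_top filterlim_real_sequentially])
  define r where "r N = 1 - s / (2 * real N)" for N :: nat
  have r: "1 - (\<theta> N)\<^sup>2 * s / 2 = r N" for N by (simp add: \<theta>2 r_def)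
  define E where "E N = (\<integral>\<omega>. iexp (\<theta> N * S N \<omega>) \<partial>P)" for N
  define B where "B N = C * exp (\<bar>s\<bar> / 2) * \<theta> N + \<theta> N * (H1 + H2)" for N
  have bound: "cmod (E N - of_real (r N ^ (N - 1)) * x (\<theta> N) 1) \<le> B N" if N: "N \<ge> 1" for N
  proof -
    \<comment> \<open>Time starts at \<open>1\<close>, where the state is deterministic, so only
      \<open>N - 1\<close> steps lead to time \<open>N\<close>.\<close>
    have "cmod (x (\<theta> N) (Suc (N - 1)) - of_real (r N ^ (N - 1)) * x (\<theta> N) (Suc 0)) \<le>
        real (N - 1) * (C * \<theta> N ^ 3) * exp (\<bar>s\<bar> / (2 * N) * real (N - 1))"
    proof (rule recursion_error_bound[where x="\<lambda>n. x (\<theta> N) (Suc n)"])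
      show "cmod (x (\<theta> N) (Suc (Suc n)) - of_real (r N) * x (\<theta> N) (Suc n)) \<le> C * \<theta> N ^ 3" for n
        using step[OF \<theta>b[OF N], of "Suc n"] by (simp add: r)
      have "\<bar>r N\<bar> \<le> 1 + \<bar>s\<bar> / (2 * N)" unfolding r_def
        using abs_triangle_ineq4[of 1 "s / (2 * real N)"] by (simp add: abs_mult)
      also have "\<dots> \<le> exp (\<bar>s\<bar> / (2 * N))" by (rule exp_ge_add_one_self)
      finally show "\<bar>r N\<bar> \<le> exp (\<bar>s\<bar> / (2 * N))" .
    qed (use C \<theta>b[OF N] in auto)
    also have "\<dots> \<le> real N * (C * \<theta> N ^ 3) * exp (\<bar>s\<bar> / 2)"
    proof (intro mult_mono)
      have "\<bar>s\<bar> / (2 * N) * real (N - 1) \<le> \<bar>s\<bar> / (2 * N) * real N" by (intro mult_left_mono) auto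
      then show "exp (\<bar>s\<bar> / (2 * N) * real (N - 1)) \<le> exp (\<bar>s\<bar> / 2)" using N by simp
    qed (use C \<theta>b[OF N] in auto)
    also have "\<dots> = C * exp (\<bar>s\<bar> / 2) * \<theta> N"
    proof -
      have "\<theta> N ^ 3 = \<theta> N * (\<theta> N)\<^sup>2" by (simp add: power2_eq_square power3_eq_cube)
      then show ?thesis using N unfolding \<theta>2 by simp
    qed
    finally have 1: "cmod (x (\<theta> N) N - of_real (r N ^ (N - 1)) * x (\<theta> N) 1) \<le> C * exp (\<bar>s\<bar> / 2) * \<theta> N"
      using N by simp
    have "E N - x (\<theta> N) N = (\<integral>\<omega>. (1 - g (\<theta> N) (Y N \<omega>)) * iexp (\<theta> N * S N \<omega>) \<partial>P)"
      unfolding E_def x_def using gi[OF \<theta>b[OF N], of N N] ei[of "\<theta> N" N]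
      by (subst Bochner_Integration.integral_diff[symmetric]) (auto simp: algebra_simps)
    also have "cmod \<dots> \<le> (\<integral>\<omega>. \<theta> N * (H1 + H2) \<partial>P)"
    proof (rule order_trans[OF integral_norm_bound integral_mono])
      have "(\<lambda>\<omega>. (1 - g (\<theta> N) (Y N \<omega>)) * iexp (\<theta> N * S N \<omega>)) =
          (\<lambda>\<omega>. iexp (\<theta> N * S N \<omega>) - g (\<theta> N) (Y N \<omega>) * iexp (\<theta> N * S N \<omega>))"
        by (simp add: fun_eq_iff algebra_simps)
      then show "integrable P (\<lambda>\<omega>. cmod ((1 - g (\<theta> N) (Y N \<omega>)) * iexp (\<theta> N * S N \<omega>)))"
        using gi[OF \<theta>b[OF N], of N N] ei[of "\<theta> N" N] by simp
    qed (use g1[OF \<theta>b[OF N]] in \<open>auto simp: norm_mult norm_minus_commute\<close>)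
    finally have 2: "cmod (E N - x (\<theta> N) N) \<le> \<theta> N * (H1 + H2)" by (simp add: P.prob_space)
    show ?thesis unfolding B_def using norm_triangle_le[OF add_mono[OF 2 1]] by (simp add: algebra_simps)
  qed
  have Blim: "B \<longlonglongrightarrow> 0"
  proof -
    have "B \<longlonglongrightarrow> C * exp (\<bar>s\<bar> / 2) * 0 + 0 * (H1 + H2)" unfolding B_def by (intro tendsto_intros \<theta>lim)
    then show ?thesis by simp
  qed
  have x1lim: "(\<lambda>N. x (\<theta> N) 1) \<longlonglongrightarrow> 1"
  proof -
    have xeq: "x t 1 = g t x1 * iexp (t * h x1)" for t
    proof -
      have "x t 1 = (\<integral>\<omega>. g t x1 * iexp (t * h x1) \<partial>P)"
        unfolding x_def by (intro Bochner_Integration.integral_cong refl) (simp add: Y1[simplified] S_def)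
      then show ?thesis by (simp add: P.prob_space)
    qed
    have "(\<lambda>N. g (\<theta> N) x1 * iexp (\<theta> N * h x1)) \<longlonglongrightarrow> (1 + \<i> * of_real (0 * a x1) + of_real (0\<^sup>2 * b x1)) * iexp (0 * h x1)"
      unfolding g_def by (intro tendsto_intros \<theta>lim)
    then show ?thesis unfolding xeq by simp
  qed
  have rlim: "(\<lambda>N. r N ^ (N - 1)) \<longlonglongrightarrow> exp (- s / 2)"
  proof -
    have "(\<lambda>N. (1 + (- s / 2) / real N) ^ N) \<longlonglongrightarrow> exp (- s / 2)" by (rule tendsto_exp_limit_sequentially)
    then have 1: "(\<lambda>N. r N ^ N) \<longlonglongrightarrow> exp (- s / 2)" by (simp add: r_def)
    have "r \<longlonglongrightarrow> 1 - 0"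
      unfolding r_def
      by (intro tendsto_diff tendsto_const tendsto_divide_0[OF tendsto_const] filterlim_at_top_imp_at_infinity
           filterlim_tendsto_pos_mult_at_top[OF tendsto_const] filterlim_real_sequentially) simp
    then have 2: "r \<longlonglongrightarrow> 1" by simp
    \<comment> \<open>The exponential limit is available for the power \<open>N\<close>; dividing by
      \<open>r N\<close>, which tends to \<open>1\<close> and is eventually positive, lowers it to
      \<open>N - 1\<close>.\<close>
    have "(\<lambda>N. r N ^ N / r N) \<longlonglongrightarrow> exp (- s / 2) / 1" by (intro tendsto_divide 1 2) simp
    moreover have "\<forall>\<^sub>F N in sequentially. r N ^ N / r N = r N ^ (N - 1)"
      using order_tendstoD(1)[OF 2, of 0, simplified] eventually_ge_at_top[of 1]
    proof eventually_elim
      case (elim N)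
      then show ?case by (cases N) auto
    qed
    ultimately show ?thesis using Lim_transform_eventually by fastforce
  qed
  have main: "(\<lambda>N. of_real (r N ^ (N - 1)) * x (\<theta> N) 1) \<longlonglongrightarrow> complex_of_real (exp (- s / 2)) * 1"
    by (intro tendsto_mult tendsto_of_real rlim x1lim)
  have "(\<lambda>N. E N - of_real (r N ^ (N - 1)) * x (\<theta> N) 1) \<longlonglongrightarrow> 0"
    by (rule Lim_null_comparison[OF _ Blim]) (use bound in \<open>auto intro: eventually_sequentiallyI[of 1]\<close>)
  from tendsto_add[OF this main] have "E \<longlonglongrightarrow> of_real (exp (- s / 2))" by simp
  then show ?thesis unfolding E_def \<theta>_def S_def s_def .
qed

lemma asymptotic_variance_nonneg:
  assumes P: "prob_space P" and chain: "markov_chain_from P Y K x1"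
    and h: "bounded_measurable h" and mean: "(\<integral>y. h y \<partial>\<nu>) = 0"
  shows "0 \<le> asymptotic_variance h"
proof -
  interpret P: prob_space P by fact
  have "cmod (of_real (exp (- asymptotic_variance h / 2))) \<le> 1"
  proof (rule Lim_bounded[OF tendsto_norm[OF chain_char_tendsto[OF assms]], of 0], intro allI impI)
    fix N
    have "cmod (\<integral>\<omega>. iexp (1 / sqrt (real N) * (\<Sum>k\<in>{1..N}. h (Y k \<omega>))) \<partial>P) \<le>
        (\<integral>\<omega>. cmod (iexp (1 / sqrt (real N) * (\<Sum>k\<in>{1..N}. h (Y k \<omega>)))) \<partial>P)"
      by (rule integral_norm_bound)
    also have "\<dots> = 1" by (simp add: P.prob_space del: of_real_mult of_real_sum)
    finally show "cmod (\<integral>\<omega>. iexp (1 / sqrt (real N) * (\<Sum>k\<in>{1..N}. h (Y k \<omega>))) \<partial>P) \<le> 1" .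
  qed
  then show ?thesis by simp
qed

end

subsection \<open>The Metropolis--Hastings kernel\<close>

locale absorbing_kernel = markov_kernel K for K :: "'a::topological_space \<Rightarrow> 'a measure" +
  fixes S :: "'a set"
  assumes absorbing_sets [measurable]: "S \<in> sets borel"
    and absorbing: "\<And>x. x \<in> S \<Longrightarrow> AE y in K x. y \<in> S"
begin

lemma AE_chain_absorbing:
  assumes P: "prob_space P" and chain: "markov_chain_from P Y K x1" and x1: "x1 \<in> S" and n: "n \<ge> 1"
  shows "AE \<omega> in P. Y n \<omega> \<in> S"
  using n
proof (induction n rule: dec_induct)
  case base
  show ?case using chain x1 unfolding markov_chain_from_def by (intro AE_I2) metis
next
  case (step n)
  interpret P: prob_space P by fact
  have Y [measurable]: "Y i \<in> P \<rightarrow>\<^sub>M borel" for i using chain unfolding markov_chain_from_def by blast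
  \<comment> \<open>This rectangle restricts only time \<open>Suc n\<close>, to the complement of
    \<open>S\<close>; its probability is the chance of having left \<open>S\<close> by then.\<close>
  define A where "A i = (if i = Suc n then - S else UNIV)" for i
  have A: "A i \<in> sets borel" for i by (auto simp: A_def)
  have "measure P {\<omega>\<in>space P. \<forall>i\<in>{1..Suc n}. Y i \<omega> \<in> A i}
        = (\<integral>\<omega>. indicator {\<omega>\<in>space P. \<forall>i\<in>{1..n}. Y i \<omega> \<in> A i} \<omega> * measure (K (Y n \<omega>)) (A (Suc n)) \<partial>P)"
    using chain step.hyps A unfolding markov_chain_from_def by blast
  also have "\<dots> = (\<integral>\<omega>. 0 \<partial>P)"
  proof (rule integral_cong_AE)
    have "{\<omega>\<in>space P. \<forall>i\<in>{1..n}. Y i \<omega> \<in> A i} \<in> sets P" using A by measurable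
    moreover have "(\<lambda>\<omega>. measure (K (Y n \<omega>)) (A (Suc n))) \<in> borel_measurable P" using A by measurable
    ultimately show "(\<lambda>\<omega>. indicator {\<omega>\<in>space P. \<forall>i\<in>{1..n}. Y i \<omega> \<in> A i} \<omega> *
        measure (K (Y n \<omega>)) (A (Suc n))) \<in> borel_measurable P" by measurable
    show "AE \<omega> in P. indicator {\<omega>\<in>space P. \<forall>i\<in>{1..n}. Y i \<omega> \<in> A i} \<omega> * measure (K (Y n \<omega>)) (A (Suc n)) = 0"
      using step.IH
    proof eventually_elim
      case (elim \<omega>)
      have "emeasure (K (Y n \<omega>)) (- S) = 0"
        using absorbing[OF elim] by (subst (asm) AE_iff_measurable[of "- S"]) auto
      then show ?case by (simp add: A_def measure_def)
    qed
  qed simp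
  finally have "measure P {\<omega>\<in>space P. \<forall>i\<in>{1..Suc n}. Y i \<omega> \<in> A i} = 0" by simp
  moreover have "{\<omega>\<in>space P. \<forall>i\<in>{1..Suc n}. Y i \<omega> \<in> A i} = {\<omega>\<in>space P. Y (Suc n) \<omega> \<notin> S}"
    by (auto simp: A_def)
  ultimately have "emeasure P {\<omega>\<in>space P. Y (Suc n) \<omega> \<notin> S} = 0" by (simp add: P.emeasure_eq_measure)
  then show ?case by (subst AE_iff_measurable[OF _ refl]) auto
qed

lemma AE_kernel_pow_absorbing: "x \<in> S \<Longrightarrow> AE y in kernel_pow K k x. y \<in> S"
proof (induction k)
  case 0
  have "Measurable.pred borel (\<lambda>y. y \<in> S)" by measurable
  then show ?case using 0 unfolding kernel_pow.simps by (subst AE_return) auto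
next
  case (Suc k)
  have "K \<in> kernel_pow K k x \<rightarrow>\<^sub>M subprob_algebra borel"
    by (subst measurable_cong_sets[OF sets_kernel_pow refl]) auto
  then have "(AE y in kernel_pow K k x \<bind> K. y \<in> S) \<longleftrightarrow> (AE z in kernel_pow K k x. AE y in K z. y \<in> S)"
    by (rule AE_bind) measurable
  moreover have "AE z in kernel_pow K k x. AE y in K z. y \<in> S"
    using Suc.IH[OF Suc.prems] by eventually_elim (rule absorbing)
  ultimately show ?case unfolding kernel_pow.simps by blast
qed

context
  fixes K' :: "'a \<Rightarrow> 'a measure"
  assumes kernel': "markov_kernel K'" and eq: "\<And>x. x \<in> S \<Longrightarrow> K' x = K x"
begin

text \<open>The kernels agree on \<open>S\<close> and the chain almost surely never leaves
  \<open>S\<close>, so the integrals defining the chain property coincide.\<close>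

lemma markov_chain_from_restrict:
  assumes P: "prob_space P" and chain: "markov_chain_from P Y K x1" and x1: "x1 \<in> S"
  shows "markov_chain_from P Y K' x1"
  unfolding markov_chain_from_def
proof (intro conjI allI impI)
  fix n :: nat and A :: "nat \<Rightarrow> 'a set"
  assume n: "n \<ge> 1" and A: "\<forall>i. A i \<in> sets borel"
  interpret K': markov_kernel K' by (rule kernel')
  have Y [measurable]: "Y i \<in> P \<rightarrow>\<^sub>M borel" for i using chain unfolding markov_chain_from_def by blast
  note [measurable] = A[rule_format]
  have "measure P {\<omega>\<in>space P. \<forall>i\<in>{1..Suc n}. Y i \<omega> \<in> A i}
        = (\<integral>\<omega>. indicator {\<omega>\<in>space P. \<forall>i\<in>{1..n}. Y i \<omega> \<in> A i} \<omega> * measure (K (Y n \<omega>)) (A (Suc n)) \<partial>P)"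
    using chain n A unfolding markov_chain_from_def by blast
  also have "\<dots> = (\<integral>\<omega>. indicator {\<omega>\<in>space P. \<forall>i\<in>{1..n}. Y i \<omega> \<in> A i} \<omega> * measure (K' (Y n \<omega>)) (A (Suc n)) \<partial>P)"
  proof (rule integral_cong_AE)
    have ind: "(indicator {\<omega>\<in>space P. \<forall>i\<in>{1..n}. Y i \<omega> \<in> A i} :: _ \<Rightarrow> real) \<in> borel_measurable P" by measurable
    have m: "(\<lambda>\<omega>. measure (K (Y n \<omega>)) (A (Suc n))) \<in> borel_measurable P" by measurable
    have m': "(\<lambda>\<omega>. measure (K' (Y n \<omega>)) (A (Suc n))) \<in> borel_measurable P" by measurable
    show "(\<lambda>\<omega>. indicator {\<omega>\<in>space P. \<forall>i\<in>{1..n}. Y i \<omega> \<in> A i} \<omega> * measure (K (Y n \<omega>)) (A (Suc n))) \<in> borel_measurable P"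
      by (rule borel_measurable_times[OF ind m])
    show "(\<lambda>\<omega>. indicator {\<omega>\<in>space P. \<forall>i\<in>{1..n}. Y i \<omega> \<in> A i} \<omega> * measure (K' (Y n \<omega>)) (A (Suc n))) \<in> borel_measurable P"
      by (rule borel_measurable_times[OF ind m'])
    show "AE \<omega> in P. indicator {\<omega>\<in>space P. \<forall>i\<in>{1..n}. Y i \<omega> \<in> A i} \<omega> * measure (K (Y n \<omega>)) (A (Suc n)) =
        indicator {\<omega>\<in>space P. \<forall>i\<in>{1..n}. Y i \<omega> \<in> A i} \<omega> * measure (K' (Y n \<omega>)) (A (Suc n))"
      using AE_chain_absorbing[OF P chain x1 n] by eventually_elim (simp only: eq)
  qed
  finally show "measure P {\<omega>\<in>space P. \<forall>i\<in>{1..Suc n}. Y i \<omega> \<in> A i}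
        = (\<integral>\<omega>. indicator {\<omega>\<in>space P. \<forall>i\<in>{1..n}. Y i \<omega> \<in> A i} \<omega> * measure (K' (Y n \<omega>)) (A (Suc n)) \<partial>P)" .
qed (use chain in \<open>auto simp: markov_chain_from_def\<close>)

lemma kernel_pow_restrict:
  assumes "x \<in> S"
  shows "kernel_pow K' k x = kernel_pow K k x"
proof (induction k)
  case (Suc k)
  interpret K': markov_kernel K' by (rule kernel')
  have m: "L \<in> kernel_pow K k x \<rightarrow>\<^sub>M subprob_algebra borel" if "markov_kernel L" for L
    by (subst measurable_cong_sets[OF sets_kernel_pow refl]) (rule markov_kernel.kernel[OF that])
  have "kernel_pow K k x \<bind> K' = kernel_pow K k x \<bind> K"
    by (rule bind_cong_AE[OF refl m[OF kernel'] m[OF markov_kernel_axioms]])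
       (use AE_kernel_pow_absorbing[OF assms, of k] in eventually_elim, rule eq)
  then show ?case by (simp add: Suc)
qed simp

end

end

section \<open>Reversibility and minorization of the Metropolis--Hastings kernel\<close>

lemma mh_alpha_range: "0 \<le> mh_alpha \<pi> q x y" "mh_alpha \<pi> q x y \<le> 1"
  if "\<And>x. 0 \<le> \<pi> x" "\<And>x y. 0 \<le> q x y"
  using that by (auto simp: mh_alpha_def)

text \<open>Both sides equal \<open>min (\<pi> x * q x y) (\<pi> y * q y x)\<close>, which is
  symmetric; this includes the degenerate branch of \<open>mh_alpha\<close>, where the minimum is
  zero.\<close>

lemma mh_detailed_balance:
  assumes "\<And>x. 0 \<le> \<pi> x" "\<And>x y. 0 \<le> q x y"
  shows "\<pi> x * (q x y * mh_alpha \<pi> q x y) = \<pi> y * (q y x * mh_alpha \<pi> q y x)"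
proof -
  have "\<pi> x * (q x y * mh_alpha \<pi> q x y) = min (\<pi> x * q x y) (\<pi> y * q y x)" for x y
  proof (cases "\<pi> x * q x y > 0")
    case True
    then have "(\<pi> x * q x y) * min ((\<pi> y * q y x) / (\<pi> x * q x y)) 1 = min (\<pi> y * q y x) (\<pi> x * q x y)"
      by (subst min_mult_distrib_left) auto
    then show ?thesis using True by (simp add: mh_alpha_def mult.assoc min.commute)
  next
    case False
    moreover have "0 \<le> \<pi> x * q x y" using assms by simp
    ultimately have "\<pi> x * q x y = 0" by linarith
    moreover have "0 \<le> \<pi> y * q y x" using assms by simp
    ultimately show ?thesis using False by (simp add: mh_alpha_def del: mult_eq_0_iff)
  qed
  then show ?thesis by (simp add: min.commute)
qed

locale metropolis_hastings =
  fixes \<pi> :: "'a::euclidean_space \<Rightarrow> real" and q :: "'a \<Rightarrow> 'a \<Rightarrow> real"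
  assumes pi_meas [measurable]: "\<pi> \<in> borel_measurable borel" and pi_nonneg: "\<And>x. 0 \<le> \<pi> x"
    and pi_density: "(\<integral>\<^sup>+x. ennreal (\<pi> x) \<partial>lborel) = 1"
    and q_meas: "(\<lambda>(x, y). q x y) \<in> borel_measurable borel" and q_nonneg: "\<And>x y. 0 \<le> q x y"
    and q_density: "\<And>x. (\<integral>\<^sup>+y. ennreal (q x y) \<partial>lborel) = 1"
begin

definition accept :: "'a \<Rightarrow> 'a \<Rightarrow> real" where
  "accept x y = q x y * mh_alpha \<pi> q x y"

lemma accept_nonneg: "0 \<le> accept x y"
  unfolding accept_def using mh_alpha_range(1)[of \<pi> q] pi_nonneg q_nonneg by simp

lemma accept_le: "accept x y \<le> q x y"
  unfolding accept_def using mh_alpha_range(2)[of \<pi> q] pi_nonneg q_nonneg by (simp add: mult_left_le)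

lemma q_meas_pair [measurable]: "(\<lambda>p. q (fst p) (snd p)) \<in> borel_measurable (borel \<Otimes>\<^sub>M borel)"
  using q_meas by (simp add: borel_prod case_prod_beta')

lemma q_meas_pair' [measurable]: "(\<lambda>p. q (snd p) (fst p)) \<in> borel_measurable (borel \<Otimes>\<^sub>M borel)"
  using measurable_compose[OF measurable_Pair[OF measurable_snd measurable_fst] q_meas_pair] by simp

lemma accept_meas_pair [measurable]: "(\<lambda>p. accept (fst p) (snd p)) \<in> borel_measurable (borel \<Otimes>\<^sub>M borel)"
  unfolding accept_def mh_alpha_def by measurable

lemma accept_meas [measurable]: "accept x \<in> borel_measurable borel"
  using measurable_compose[OF measurable_Pair1' accept_meas_pair, of x] by simp

lemma nn_integral_accept_le: "(\<integral>\<^sup>+y. ennreal (accept x y) \<partial>lborel) \<le> 1"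
  using nn_integral_mono[of lborel "\<lambda>y. ennreal (accept x y)" "\<lambda>y. ennreal (q x y)"] accept_le[of x]
  by (simp add: q_density ennreal_leI)

lemma nn_integral_accept_rej: "(\<integral>\<^sup>+y. ennreal (accept x y) \<partial>lborel) + ennreal (mh_rej \<pi> q x) = 1"
proof -
  have i: "integrable lborel (accept x)"
    using nn_integral_accept_le[of x] accept_nonneg
    by (intro integrableI_nonneg) (auto intro: le_less_trans)
  have eq: "(\<integral>\<^sup>+y. ennreal (accept x y) \<partial>lborel) = ennreal (\<integral>y. accept x y \<partial>lborel)"
    using accept_nonneg by (intro nn_integral_eq_integral i) auto
  have "(\<integral>y. accept x y \<partial>lborel) \<le> 1"
    using nn_integral_accept_le[of x] unfolding eq by simp
  moreover have "0 \<le> (\<integral>y. accept x y \<partial>lborel)" using accept_nonneg by simp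
  ultimately show ?thesis
    unfolding eq mh_rej_def accept_def[symmetric] by (simp add: ennreal_plus[symmetric] del: ennreal_plus)
qed

text \<open>Written with the nonnegative integral, the rejection probability is visibly measurable
  in \<open>x\<close>.\<close>

lemma rej_nn: "ennreal (mh_rej \<pi> q x) = 1 - (\<integral>\<^sup>+y. ennreal (accept x y) \<partial>lborel)"
proof -
  have "(\<integral>\<^sup>+y. ennreal (accept x y) \<partial>lborel) \<noteq> \<infinity>"
    using nn_integral_accept_le[of x] by (auto simp: top_unique)
  then show ?thesis
    using ennreal_add_diff_cancel_left[of "\<integral>\<^sup>+y. ennreal (accept x y) \<partial>lborel" "ennreal (mh_rej \<pi> q x)"]
    by (simp add: nn_integral_accept_rej)
qed

lemma rej_meas [measurable]: "(\<lambda>x. ennreal (mh_rej \<pi> q x)) \<in> borel_measurable borel"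
  unfolding rej_nn by measurable

lemma sets_mh_kernel [simp]: "sets (mh_kernel \<pi> q x) = sets borel"
  unfolding mh_kernel_def by (simp add: sets.sigma_sets_eq[of borel, simplified])

text \<open>\<open>measure_of\<close> returns the prescribed values only for a countably additive
  set function; here it is the sum of a density measure and a scaled point mass.\<close>

lemma emeasure_mh_kernel:
  assumes "A \<in> sets borel"
  shows "emeasure (mh_kernel \<pi> q x) A =
    (\<integral>\<^sup>+y. indicator A y * ennreal (accept x y) \<partial>lborel) + ennreal (mh_rej \<pi> q x) * indicator A x"
proof -
  let ?\<mu> = "\<lambda>A. (\<integral>\<^sup>+y. indicator A y * ennreal (accept x y) \<partial>lborel) + ennreal (mh_rej \<pi> q x) * indicator A x"
  have eq: "?\<mu> A = emeasure (density lborel (\<lambda>y. ennreal (accept x y))) A +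
      emeasure (scale_measure (ennreal (mh_rej \<pi> q x)) (return borel x)) A" if "A \<in> sets borel" for A
    using that by (simp add: emeasure_density mult.commute)
  have "countably_additive (sets borel) ?\<mu>"
    unfolding countably_additive_def
  proof (intro allI impI)
    fix A :: "nat \<Rightarrow> 'a set"
    assume A: "range A \<subseteq> sets borel" "disjoint_family A" "(\<Union>i. A i) \<in> sets borel"
    then have "A i \<in> sets borel" for i by auto
    then have "(\<Sum>i. ?\<mu> (A i)) = (\<Sum>i. emeasure (density lborel (\<lambda>y. ennreal (accept x y))) (A i) +
      emeasure (scale_measure (ennreal (mh_rej \<pi> q x)) (return borel x)) (A i))"
      by (intro arg_cong[where f=suminf] ext eq)
    also have "\<dots> = (\<Sum>i. emeasure (density lborel (\<lambda>y. ennreal (accept x y))) (A i)) +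
      (\<Sum>i. emeasure (scale_measure (ennreal (mh_rej \<pi> q x)) (return borel x)) (A i))"
      by (rule suminf_add[symmetric]) auto
    also have "\<dots> = emeasure (density lborel (\<lambda>y. ennreal (accept x y))) (\<Union>i. A i) +
      emeasure (scale_measure (ennreal (mh_rej \<pi> q x)) (return borel x)) (\<Union>i. A i)"
      using A by (intro arg_cong2[where f="(+)"] suminf_emeasure) auto
    also have "\<dots> = ?\<mu> (\<Union>i. A i)" by (rule eq[OF A(3), symmetric])
    finally show "(\<Sum>i. ?\<mu> (A i)) = ?\<mu> (\<Union>i. A i)" .
  qed
  then show ?thesis
    unfolding mh_kernel_def accept_def[symmetric]
    by (intro emeasure_measure_of_sigma)
       (use assms sets.sigma_algebra_axioms[of "borel :: 'a measure"] in \<open>auto simp: positive_def\<close>)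
qed

lemma space_mh_kernel [simp]: "space (mh_kernel \<pi> q x) = UNIV"
  using sets_eq_imp_space_eq[OF sets_mh_kernel] by simp

lemma prob_space_mh_kernel: "prob_space (mh_kernel \<pi> q x)"
  by (rule prob_spaceI) (simp add: emeasure_mh_kernel nn_integral_accept_rej)

sublocale markov_kernel "mh_kernel \<pi> q"
proof (rule markov_kernel.intro)
  show "mh_kernel \<pi> q \<in> borel \<rightarrow>\<^sub>M subprob_algebra borel"
  proof (rule measurable_subprob_algebra)
    show "subprob_space (mh_kernel \<pi> q x)" for x by (rule prob_space_imp_subprob_space[OF prob_space_mh_kernel])
    fix A :: "'a set" assume [measurable]: "A \<in> sets borel"
    show "(\<lambda>x. emeasure (mh_kernel \<pi> q x) A) \<in> borel_measurable borel"
      unfolding emeasure_mh_kernel[OF \<open>A \<in> sets borel\<close>] by measurable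
  qed simp
qed (rule prob_space_mh_kernel)

definition target :: "'a measure" where
  "target = density lborel (\<lambda>x. ennreal (\<pi> x))"

lemma sets_target [simp]: "sets target = sets borel"
  by (simp add: target_def)

lemma prob_target: "prob_space target"
  by (rule prob_spaceI) (simp add: target_def emeasure_density pi_density)

text \<open>Detailed balance makes the accepted flow symmetric, so Fubini turns inflow into
  \<open>A\<close> into outflow from \<open>A\<close>; together with the rejected mass, which stays
  put, this restores the mass of \<open>A\<close>.\<close>

lemma stationary_target: "target \<bind> mh_kernel \<pi> q = target"
proof (rule measure_eqI)
  have m: "mh_kernel \<pi> q \<in> target \<rightarrow>\<^sub>M subprob_algebra borel"
    by (subst measurable_cong_sets[OF sets_target refl]) (rule kernel)
  have ne: "space target \<noteq> {}" by (rule prob_space.not_empty[OF prob_target])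
  show "sets (target \<bind> mh_kernel \<pi> q) = sets target" by (simp add: sets_bind[OF sets_mh_kernel ne])
  fix A assume "A \<in> sets (target \<bind> mh_kernel \<pi> q)"
  then have A [measurable]: "A \<in> sets borel" by (simp add: sets_bind[OF sets_mh_kernel ne])
  define f where "f x y = ennreal (\<pi> x * accept x y)" for x y
  have f_sym: "f x y = f y x" for x y
    unfolding f_def accept_def using mh_detailed_balance[of \<pi> q, OF pi_nonneg q_nonneg] by simp
  have f: "f x y = ennreal (\<pi> x) * ennreal (accept x y)" for x y
    unfolding f_def by (simp add: ennreal_mult pi_nonneg accept_nonneg)
  have fm [measurable]: "(\<lambda>p. f (fst p) (snd p)) \<in> borel_measurable (borel \<Otimes>\<^sub>M borel)"
    unfolding f_def by measurable
  have [measurable]: "(\<lambda>p. f (snd p) (fst p)) \<in> borel_measurable (borel \<Otimes>\<^sub>M borel)"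
    using fm by (simp only: f_sym)
  have "emeasure (target \<bind> mh_kernel \<pi> q) A = (\<integral>\<^sup>+x. emeasure (mh_kernel \<pi> q x) A \<partial>target)"
    by (rule emeasure_bind[OF ne m A])
  also have "\<dots> = (\<integral>\<^sup>+x. ennreal (\<pi> x) * emeasure (mh_kernel \<pi> q x) A \<partial>lborel)"
    unfolding target_def by (rule nn_integral_density) measurable
  also have "\<dots> = (\<integral>\<^sup>+x. (\<integral>\<^sup>+y. indicator A y * f x y \<partial>lborel) + ennreal (\<pi> x) * ennreal (mh_rej \<pi> q x) * indicator A x \<partial>lborel)"
  proof (rule nn_integral_cong)
    fix x
    have "ennreal (\<pi> x) * (\<integral>\<^sup>+y. indicator A y * ennreal (accept x y) \<partial>lborel) =
        (\<integral>\<^sup>+y. ennreal (\<pi> x) * (indicator A y * ennreal (accept x y)) \<partial>lborel)"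
      by (rule nn_integral_cmult[symmetric]) measurable
    also have "\<dots> = (\<integral>\<^sup>+y. indicator A y * f x y \<partial>lborel)"
      unfolding f by (simp only: mult.left_commute)
    finally show "ennreal (\<pi> x) * emeasure (mh_kernel \<pi> q x) A =
        (\<integral>\<^sup>+y. indicator A y * f x y \<partial>lborel) + ennreal (\<pi> x) * ennreal (mh_rej \<pi> q x) * indicator A x"
      by (simp only: emeasure_mh_kernel[OF A] distrib_left mult.assoc)
  qed
  also have "\<dots> = (\<integral>\<^sup>+x. (\<integral>\<^sup>+y. indicator A y * f x y \<partial>lborel) \<partial>lborel) +
      (\<integral>\<^sup>+x. ennreal (\<pi> x) * ennreal (mh_rej \<pi> q x) * indicator A x \<partial>lborel)"
    by (rule nn_integral_add) measurable
  also have "(\<integral>\<^sup>+x. (\<integral>\<^sup>+y. indicator A y * f x y \<partial>lborel) \<partial>lborel) =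
      (\<integral>\<^sup>+y. (\<integral>\<^sup>+x. indicator A y * f x y \<partial>lborel) \<partial>lborel)"
    by (rule lborel_pair.Fubini') measurable
  also have "\<dots> = (\<integral>\<^sup>+x. (\<integral>\<^sup>+y. indicator A x * f x y \<partial>lborel) \<partial>lborel)" by (simp only: f_sym)
  also have "\<dots> + (\<integral>\<^sup>+x. ennreal (\<pi> x) * ennreal (mh_rej \<pi> q x) * indicator A x \<partial>lborel) =
      (\<integral>\<^sup>+x. (\<integral>\<^sup>+y. indicator A x * f x y \<partial>lborel) + ennreal (\<pi> x) * ennreal (mh_rej \<pi> q x) * indicator A x \<partial>lborel)"
    by (rule nn_integral_add[symmetric]) measurable
  also have "\<dots> = (\<integral>\<^sup>+x. ennreal (\<pi> x) * indicator A x \<partial>lborel)"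
  proof (rule nn_integral_cong)
    fix x
    have "(\<integral>\<^sup>+y. indicator A x * f x y \<partial>lborel) = indicator A x * (ennreal (\<pi> x) * (\<integral>\<^sup>+y. ennreal (accept x y) \<partial>lborel))"
      unfolding f by (simp add: nn_integral_cmult)
    then have "(\<integral>\<^sup>+y. indicator A x * f x y \<partial>lborel) + ennreal (\<pi> x) * ennreal (mh_rej \<pi> q x) * indicator A x =
        ennreal (\<pi> x) * indicator A x * ((\<integral>\<^sup>+y. ennreal (accept x y) \<partial>lborel) + ennreal (mh_rej \<pi> q x))"
      by (simp add: algebra_simps)
    then show "(\<integral>\<^sup>+y. indicator A x * f x y \<partial>lborel) + ennreal (\<pi> x) * ennreal (mh_rej \<pi> q x) * indicator A x =
        ennreal (\<pi> x) * indicator A x" by (simp add: nn_integral_accept_rej)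
  qed
  also have "\<dots> = emeasure target A" unfolding target_def by (simp add: emeasure_density)
  finally show "emeasure (target \<bind> mh_kernel \<pi> q) A = emeasure target A" .
qed

text \<open>Off the support the kernel is replaced by the target itself; the chain started on the
  support never notices, and the minorization then holds at every point.\<close>
definition mh_kernel_on :: "'a set \<Rightarrow> 'a \<Rightarrow> 'a measure" where
  "mh_kernel_on S x = (if x \<in> S then mh_kernel \<pi> q x else target)"

context
  fixes S :: "'a set" and \<epsilon> B :: real
  assumes S [measurable]: "S \<in> sets borel" and eps: "0 < \<epsilon>"
    and pi_pos: "\<And>x. x \<in> S \<Longrightarrow> 0 < \<pi> x" and pi_zero: "\<And>x. x \<notin> S \<Longrightarrow> \<pi> x = 0"
    and pi_bound: "\<And>x. \<pi> x \<le> B" and q_bound: "\<And>x y. x \<in> S \<Longrightarrow> y \<in> S \<Longrightarrow> \<epsilon> \<le> q x y"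
begin

lemma AE_target_S: "AE x in target. x \<in> S"
proof -
  have "AE x in lborel. 0 < ennreal (\<pi> x) \<longrightarrow> x \<in> S"
  proof (intro AE_I2 impI)
    fix x assume "0 < ennreal (\<pi> x)"
    then show "x \<in> S" using pi_zero[of x] by (cases "x \<in> S") auto
  qed
  then show ?thesis unfolding target_def by (subst AE_density) auto
qed

lemma S_nonempty: "S \<noteq> {}"
proof
  assume "S = {}"
  then have "\<pi> x = 0" for x using pi_zero[of x] by blast
  then have "(\<integral>\<^sup>+x. ennreal (\<pi> x) \<partial>lborel) = 0" by simp
  then show False using pi_density by simp
qed

lemma B_pos: "0 < B"
proof -
  obtain x where "x \<in> S" using S_nonempty by blast
  then show ?thesis using pi_pos[of x] pi_bound[of x] by simp
qed

text \<open>On \<open>S\<close> the accepted density is the smaller of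
  \<open>\<pi> y * q y x / \<pi> x\<close> and \<open>q x y\<close>. The first dominates because
  \<open>\<pi> x \<le> B\<close>, the second because \<open>\<pi> y / B \<le> 1\<close>; this is the
  origin of the constant \<open>\<epsilon> / B\<close>.\<close>

lemma accept_minorization:
  assumes x: "x \<in> S"
  shows "\<epsilon> / B * \<pi> y \<le> accept x y"
proof (cases "y \<in> S")
  case True
  have q: "0 < q x y" using q_bound[OF x True] eps by simp
  have pix: "0 < \<pi> x" by (rule pi_pos[OF x])
  have "\<epsilon> / B * \<pi> y = \<pi> y * \<epsilon> / B" by simp
  also have "\<dots> \<le> \<pi> y * q y x / \<pi> x"
    using q_bound[OF True x] pi_nonneg[of y] pi_bound[of x] pix eps by (intro frac_le mult_left_mono) auto
  finally have 1: "\<epsilon> / B * \<pi> y \<le> \<pi> y * q y x / \<pi> x" .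
  have "\<pi> y / B \<le> 1" using pi_bound[of y] B_pos by simp
  then have "\<epsilon> * (\<pi> y / B) \<le> \<epsilon> * 1" using eps by (intro mult_left_mono) auto
  then have 2: "\<epsilon> / B * \<pi> y \<le> q x y" using q_bound[OF x True] by simp
  have "accept x y = min (\<pi> y * q y x / \<pi> x) (q x y)"
  proof -
    have "accept x y = q x y * min ((\<pi> y * q y x) / (\<pi> x * q x y)) 1"
      unfolding accept_def mh_alpha_def using q pix by simp
    also have "\<dots> = min (q x y * ((\<pi> y * q y x) / (\<pi> x * q x y))) (q x y * 1)"
      using q by (subst min_mult_distrib_left) simp
    finally show ?thesis using q by simp
  qed
  then show ?thesis using 1 2 by simp
next
  case False
  then show ?thesis using pi_zero[OF False] accept_nonneg by simp
qed

lemma mh_kernel_minorization: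
  assumes x: "x \<in> S" and A [measurable]: "A \<in> sets borel"
  shows "\<epsilon> / B * measure target A \<le> measure (mh_kernel \<pi> q x) A"
proof -
  interpret T: prob_space target by (rule prob_target)
  interpret K: prob_space "mh_kernel \<pi> q x" by (rule prob_kernel)
  have eB: "0 \<le> \<epsilon> / B" using eps B_pos by simp
  have "ennreal (\<epsilon> / B * measure target A) = ennreal (\<epsilon> / B) * emeasure target A"
    unfolding T.emeasure_eq_measure by (rule ennreal_mult'[OF eB])
  also have "\<dots> = (\<integral>\<^sup>+y. ennreal (\<epsilon> / B) * (ennreal (\<pi> y) * indicator A y) \<partial>lborel)"
    unfolding target_def by (simp add: emeasure_density nn_integral_cmult)
  also have "\<dots> \<le> (\<integral>\<^sup>+y. indicator A y * ennreal (accept x y) \<partial>lborel)"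
  proof (rule nn_integral_mono)
    fix y
    have "ennreal (\<epsilon> / B) * ennreal (\<pi> y) \<le> ennreal (accept x y)"
      using accept_minorization[OF x, of y] eB pi_nonneg by (simp add: ennreal_mult[symmetric] ennreal_leI)
    then show "ennreal (\<epsilon> / B) * (ennreal (\<pi> y) * indicator A y) \<le> indicator A y * ennreal (accept x y)"
      by (auto simp: indicator_def)
  qed
  also have "\<dots> \<le> emeasure (mh_kernel \<pi> q x) A" by (simp add: emeasure_mh_kernel)
  also have "\<dots> = ennreal (measure (mh_kernel \<pi> q x) A)" by (rule K.emeasure_eq_measure)
  finally show ?thesis by simp
qed

text \<open>A proposal outside \<open>S\<close> has target density zero and is rejected, and a
  rejection leaves the state in \<open>S\<close>.\<close>

lemma absorbing_mh_kernel: "absorbing_kernel (mh_kernel \<pi> q) S"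
proof (intro absorbing_kernel.intro absorbing_kernel_axioms.intro markov_kernel_axioms)
  fix x assume x: "x \<in> S"
  have "emeasure (mh_kernel \<pi> q x) (- S) = (\<integral>\<^sup>+y. indicator (- S) y * ennreal (accept x y) \<partial>lborel)"
    using x by (simp add: emeasure_mh_kernel)
  also have "\<dots> = (\<integral>\<^sup>+(y::'a). 0 \<partial>lborel)"
  proof (rule nn_integral_cong)
    fix y show "indicator (- S) y * ennreal (accept x y) = 0"
      using pi_zero[of y] by (cases "y \<in> S") (auto simp: accept_def mh_alpha_def)
  qed
  finally have "emeasure (mh_kernel \<pi> q x) (- S) = 0" by simp
  then show "AE y in mh_kernel \<pi> q x. y \<in> S" by (subst AE_iff_measurable[of "- S"]) auto
qed (rule S)

lemma doeblin_mh_kernel_on: "doeblin_kernel (mh_kernel_on S) target (\<epsilon> / B)"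
proof -
  interpret T: prob_space target by (rule prob_target)
  have sp: "space target = UNIV" using sets_eq_imp_space_eq[OF sets_target] by simp
  obtain x0 where x0: "x0 \<in> S" using S_nonempty by blast
  \<comment> \<open>The minorization on the whole space compares total masses. The bound is needed
    off \<open>S\<close>, where the new kernel is the target itself.\<close>
  have d1: "\<epsilon> / B \<le> 1"
    using mh_kernel_minorization[OF x0, of UNIV] T.prob_space prob_space.prob_space[OF prob_kernel, of x0] sp by simp
  show ?thesis
  proof (intro doeblin_kernel.intro markov_kernel.intro doeblin_kernel_axioms.intro)
    show km: "mh_kernel_on S \<in> borel \<rightarrow>\<^sub>M subprob_algebra borel"
      unfolding mh_kernel_on_def[abs_def]
    proof (rule measurable_If_set[OF kernel])
      show "(\<lambda>x. target) \<in> borel \<rightarrow>\<^sub>M subprob_algebra borel"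
        by (rule measurable_const) (simp add: space_subprob_algebra prob_space_imp_subprob_space[OF prob_target])
    qed auto
    show "prob_space (mh_kernel_on S x)" for x
      unfolding mh_kernel_on_def using prob_kernel prob_target by auto
    have m: "L \<in> target \<rightarrow>\<^sub>M subprob_algebra borel" if "L \<in> borel \<rightarrow>\<^sub>M subprob_algebra borel" for L
      by (subst measurable_cong_sets[OF sets_target refl]) (rule that)
    show "target \<bind> mh_kernel_on S = target"
    proof -
      \<comment> \<open>The kernel was altered only on a null set of the target, so stationarity
        survives.\<close>
      have "target \<bind> mh_kernel_on S = target \<bind> mh_kernel \<pi> q"
        by (rule bind_cong_AE[OF refl m[OF km] m[OF kernel]])
           (use AE_target_S in eventually_elim, simp add: mh_kernel_on_def)
      then show ?thesis by (simp only: stationary_target)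
    qed
    show "\<epsilon> / B * measure target A \<le> measure (mh_kernel_on S x) A" if "A \<in> sets borel" for x A
      using mh_kernel_minorization[OF _ that, of x] d1 mult_right_mono[OF d1, of "measure target A"]
      by (auto simp: mh_kernel_on_def)
    show "0 < \<epsilon> / B" using eps B_pos by simp
  qed (use prob_target in auto)
qed

end

end

subsection \<open>The multivariate central limit theorem\<close>

context markov_kernel
begin

lemma op_sum:
  assumes "\<And>i. i \<in> I \<Longrightarrow> bounded_measurable (g i)"
  shows "op (\<lambda>y. \<Sum>i\<in>I. t i * g i y) x = (\<Sum>i\<in>I. t i * op (g i) x)"
  unfolding op_def using assms
  by (subst Bochner_Integration.integral_sum) (auto intro!: Bochner_Integration.integrable_mult_right integrable_K)

lemma op_pow_sum:
  assumes "\<And>i. i \<in> I \<Longrightarrow> bounded_measurable (g i)"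
  shows "(op ^^ k) (\<lambda>y. \<Sum>i\<in>I. t i * g i y) x = (\<Sum>i\<in>I. t i * (op ^^ k) (g i) x)"
proof (induction k arbitrary: x)
  case (Suc k)
  have "(op ^^ k) (\<lambda>y. \<Sum>i\<in>I. t i * g i y) = (\<lambda>x. \<Sum>i\<in>I. t i * (op ^^ k) (g i) x)"
    using Suc.IH by (rule ext)
  then have "(op ^^ Suc k) (\<lambda>y. \<Sum>i\<in>I. t i * g i y) x = op (\<lambda>x. \<Sum>i\<in>I. t i * (op ^^ k) (g i) x) x"
    by (simp only: funpow.simps o_apply)
  also have "\<dots> = (\<Sum>i\<in>I. t i * op ((op ^^ k) (g i)) x)"
    using assms by (intro op_sum bounded_measurable_op_pow)
  finally show ?case by (simp only: funpow.simps o_apply)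
qed simp

end

text \<open>Bilinearity is checked lag by lag, where it is linearity of \<open>op ^^ k\<close>, and
  then summed; uniqueness of sums transfers it to the Poisson term.\<close>

lemma (in doeblin_kernel) asymptotic_variance_sum:
  assumes I: "finite I" and g: "\<And>i. i \<in> I \<Longrightarrow> bounded_measurable (g i)" "\<And>i. i \<in> I \<Longrightarrow> (\<integral>y. g i y \<partial>\<nu>) = 0"
  shows "asymptotic_variance (\<lambda>x. \<Sum>i\<in>I. t i * g i x) =
    (\<Sum>i\<in>I. \<Sum>j\<in>I. t i * t j * ((\<integral>y. g i y * g j y \<partial>\<nu>) + 2 * (\<integral>y. g i y * op (poisson (g j)) y \<partial>\<nu>)))"
proof -
  define h where "h x = (\<Sum>i\<in>I. t i * g i x)" for x
  have h: "bounded_measurable h" unfolding h_def[abs_def]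
    using g(1) by (intro bounded_measurable_sum bounded_measurable_cmult)
  have hm: "(\<integral>y. h y \<partial>\<nu>) = 0"
    unfolding h_def using g integrable_stat
    by (subst Bochner_Integration.integral_sum) auto
  have cov: "(\<integral>y. h y * (op ^^ k) h y \<partial>\<nu>) = (\<Sum>i\<in>I. \<Sum>j\<in>I. t i * t j * (\<integral>y. g i y * (op ^^ k) (g j) y \<partial>\<nu>))" for k
  proof -
    have i: "integrable \<nu> (\<lambda>y. t i * t j * (g i y * (op ^^ k) (g j) y))" if "i \<in> I" "j \<in> I" for i j
      using that g(1) by (intro integrable_stat bounded_measurable_cmult bounded_measurable_mult bounded_measurable_op_pow)
    have "(op ^^ k) h y = (\<Sum>j\<in>I. t j * (op ^^ k) (g j) y)" for y
      unfolding h_def[abs_def] by (rule op_pow_sum[OF g(1)])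
    then have "h y * (op ^^ k) h y = (\<Sum>i\<in>I. \<Sum>j\<in>I. t i * t j * (g i y * (op ^^ k) (g j) y))" for y
      by (simp add: h_def sum_product mult_ac)
    then have "(\<integral>y. h y * (op ^^ k) h y \<partial>\<nu>) = (\<integral>y. (\<Sum>i\<in>I. \<Sum>j\<in>I. t i * t j * (g i y * (op ^^ k) (g j) y)) \<partial>\<nu>)"
      by simp
    also have "\<dots> = (\<Sum>i\<in>I. \<Sum>j\<in>I. (\<integral>y. t i * t j * (g i y * (op ^^ k) (g j) y) \<partial>\<nu>))"
      using i by (simp add: Bochner_Integration.integral_sum Bochner_Integration.integrable_sum del: integral_mult_right_zero integral_mult_right)
    finally show ?thesis by simp
  qed
  have "(\<lambda>k. \<integral>y. h y * (op ^^ Suc k) h y \<partial>\<nu>) sums (\<Sum>i\<in>I. \<Sum>j\<in>I. t i * t j * (\<integral>y. g i y * op (poisson (g j)) y \<partial>\<nu>))"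
    unfolding cov by (intro sums_sum sums_mult sums_autocovariance g)
  with sums_autocovariance[OF h hm h] have "(\<integral>y. h y * op (poisson h) y \<partial>\<nu>) =
      (\<Sum>i\<in>I. \<Sum>j\<in>I. t i * t j * (\<integral>y. g i y * op (poisson (g j)) y \<partial>\<nu>))"
    by (rule sums_unique2)
  then have "asymptotic_variance h = (\<Sum>i\<in>I. \<Sum>j\<in>I. t i * t j * (\<integral>y. g i y * g j y \<partial>\<nu>)) +
      2 * (\<Sum>i\<in>I. \<Sum>j\<in>I. t i * t j * (\<integral>y. g i y * op (poisson (g j)) y \<partial>\<nu>))"
    unfolding asymptotic_variance_def using cov[of 0] by simp
  then show ?thesis
    unfolding h_def by (simp add: sum_distrib_left sum.distrib[symmetric] algebra_simps)
qed

lemma sums_vec: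
  fixes f :: "nat \<Rightarrow> 'b::real_normed_vector ^ 'd"
  assumes "\<And>i. (\<lambda>k. f k $ i) sums (s $ i)"
  shows "f sums s"
  using assms unfolding sums_def by (intro vec_tendstoI) simp

lemma quadratic_form_matrix:
  fixes t :: "real^'d" and A :: "real^'d^'d"
  shows "t \<bullet> (A *v t) = (\<Sum>i\<in>UNIV. \<Sum>j\<in>UNIV. t $ i * t $ j * A $ i $ j)"
  by (simp add: inner_vec_def matrix_vector_mult_def sum_distrib_left mult_ac)

text \<open>The Cramer--Wold reduction: for each \<open>t\<close> the scalar result applies to the
  projected, centered observable, and the quadratic form of \<open>\<Sigma>\<close> at
  \<open>t\<close> is its asymptotic variance.\<close>

theorem metropolis_hastings_clt:
  fixes \<pi> :: "real^'n \<Rightarrow> real" and G :: "real^'n \<Rightarrow> real^'d"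
  assumes mh: "metropolis_hastings \<pi> q"
    and S [measurable]: "S \<in> sets borel" and eps: "0 < \<epsilon>"
    and pi_pos: "\<And>x. x \<in> S \<Longrightarrow> 0 < \<pi> x" and pi_zero: "\<And>x. x \<notin> S \<Longrightarrow> \<pi> x = 0"
    and pi_bound: "\<And>x. \<pi> x \<le> B" and q_bound: "\<And>x y. x \<in> S \<Longrightarrow> y \<in> S \<Longrightarrow> \<epsilon> \<le> q x y"
    and G [measurable]: "G \<in> borel_measurable borel" and G_bound: "\<And>x. x \<in> S \<Longrightarrow> norm (G x) \<le> C"
    and P: "prob_space P" and chain: "markov_chain_from P Y (mh_kernel \<pi> q) x1" and x1: "x1 \<in> S"
  defines "m \<equiv> \<integral>x. \<pi> x *\<^sub>R G x \<partial>lborel"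
  defines "Cov \<equiv> stat_cov \<pi> (mh_kernel \<pi> q) G m"
  defines "\<Sigma> \<equiv> Cov 0 + 2 *\<^sub>R (\<Sum>k. Cov (Suc k))"
  shows "summable (\<lambda>k. Cov (Suc k))"
    and "\<exists>\<mu>. centered_gaussian \<Sigma> \<mu> \<and>
      weak_conv_to (\<lambda>N. distr P borel (\<lambda>\<omega>. sqrt (real N) *\<^sub>R
         ((1 / real N) *\<^sub>R (\<Sum>n\<in>{1..N}. G (Y n \<omega>)) - m))) \<mu>"
proof -
  interpret MH: metropolis_hastings \<pi> q by fact
  note ctx = S eps pi_pos pi_zero pi_bound q_bound
  define K' where "K' = MH.mh_kernel_on S"
  interpret D: doeblin_kernel K' MH.target "\<epsilon> / B"
    unfolding K'_def by (rule MH.doeblin_mh_kernel_on[OF ctx])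
  interpret A: absorbing_kernel "mh_kernel \<pi> q" S
    by (rule MH.absorbing_mh_kernel[OF ctx])
  interpret P: prob_space P by fact
  have K'_eq: "K' x = mh_kernel \<pi> q x" if "x \<in> S" for x using that by (simp add: K'_def MH.mh_kernel_on_def)
  have chain': "markov_chain_from P Y K' x1"
    by (rule A.markov_chain_from_restrict[OF D.markov_kernel_axioms K'_eq P chain x1])
  have kpow: "kernel_pow K' k x = kernel_pow (mh_kernel \<pi> q) k x" if "x \<in> S" for k x
    by (rule A.kernel_pow_restrict[OF D.markov_kernel_axioms K'_eq that])
  have Y [measurable]: "Y n \<in> P \<rightarrow>\<^sub>M borel" for n using chain unfolding markov_chain_from_def by blast
  have Gi [measurable]: "(\<lambda>x. G x $ i) \<in> borel_measurable borel" for i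
    using measurable_compose[OF G borel_measurable_nth] .
  have pi_int: "integrable lborel \<pi>"
    using MH.pi_density MH.pi_nonneg by (intro integrableI_nonneg) auto
  have pi_integral: "(\<integral>x. \<pi> x \<partial>lborel) = 1"
    using MH.pi_density MH.pi_nonneg by (simp add: integral_eq_nn_integral)
  have C0: "0 \<le> C" using G_bound[OF x1] norm_ge_zero order_trans by blast
  have piG_int: "integrable lborel (\<lambda>x. \<pi> x *\<^sub>R G x)"
  proof (rule Bochner_Integration.integrable_bound[OF integrable_mult_right[OF pi_int, of C]])
    show "(\<lambda>x. \<pi> x *\<^sub>R G x) \<in> borel_measurable lborel" by measurable
    show "AE x in lborel. norm (\<pi> x *\<^sub>R G x) \<le> norm (C * \<pi> x)"
    proof (rule AE_I2)
      fix x show "norm (\<pi> x *\<^sub>R G x) \<le> norm (C * \<pi> x)"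
        using pi_zero[of x] G_bound[of x] MH.pi_nonneg[of x] C0
        by (cases "x \<in> S") (auto simp: mult.commute[of C] intro!: mult_left_mono)
    qed
  qed
  \<comment> \<open>Truncation to \<open>S\<close> makes the coordinate bounded everywhere; the mean
    under the target is unaffected because \<open>\<pi>\<close> vanishes off
    \<open>S\<close>.\<close>
  define g where "g i x = indicator S x * (G x $ i - m $ i)" for i x
  have g: "bounded_measurable (g i)" for i
  proof (rule bounded_measurableI)
    show "g i \<in> borel_measurable borel" unfolding g_def[abs_def] by measurable
    fix x
    have "\<bar>G x $ i - m $ i\<bar> \<le> C + norm m" if "x \<in> S"
      using component_le_norm_cart[of "G x" i] component_le_norm_cart[of m i] G_bound[OF that] by linarith
    then show "\<bar>g i x\<bar> \<le> C + norm m" using C0 by (auto simp: g_def indicator_def)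
  qed
  have target_int: "(\<integral>x. u x \<partial>MH.target) = (\<integral>x. \<pi> x * u x \<partial>lborel)" if "bounded_measurable u" for u
    unfolding MH.target_def using bounded_measurableD[OF that] MH.pi_nonneg
    by (subst integral_density) auto
  have gm: "(\<integral>x. g i x \<partial>MH.target) = 0" for i
  proof -
    have "(\<integral>x. g i x \<partial>MH.target) = (\<integral>x. (\<pi> x *\<^sub>R G x) $ i - \<pi> x * m $ i \<partial>lborel)"
      unfolding target_int[OF g]
    proof (intro Bochner_Integration.integral_cong refl)
      fix x show "\<pi> x * g i x = (\<pi> x *\<^sub>R G x) $ i - \<pi> x * m $ i"
        using pi_zero[of x] by (cases "x \<in> S") (auto simp: g_def algebra_simps)
    qed
    also have "\<dots> = (\<integral>x. (\<pi> x *\<^sub>R G x) $ i \<partial>lborel) - (\<integral>x. \<pi> x * m $ i \<partial>lborel)"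
      using integrable_bounded_linear[OF bounded_linear_vec_nth piG_int, of i] pi_int by (intro Bochner_Integration.integral_diff) auto
    also have "(\<integral>x. (\<pi> x *\<^sub>R G x) $ i \<partial>lborel) = m $ i"
      unfolding m_def by (rule integral_bounded_linear[OF bounded_linear_vec_nth piG_int])
    finally show ?thesis by (simp add: pi_integral)
  qed
  \<comment> \<open>Three changes cancel out: off \<open>S\<close> the weight \<open>\<pi>\<close>
    is zero, from points of \<open>S\<close> the powers of both kernels coincide, and these powers
    charge only \<open>S\<close>, where \<open>g\<close> is the untruncated observable.\<close>
  have Cov: "Cov k $ i $ j = (\<integral>x. g i x * (D.op ^^ k) (g j) x \<partial>MH.target)" for k i j
  proof -
    have "(\<integral>x. g i x * (D.op ^^ k) (g j) x \<partial>MH.target) = (\<integral>x. \<pi> x * (g i x * (D.op ^^ k) (g j) x) \<partial>lborel)"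
      by (intro target_int bounded_measurable_mult g D.bounded_measurable_op_pow)
    also have "\<dots> = (\<integral>x. \<pi> x * (G x $ i - m $ i) * (\<integral>y. (G y $ j - m $ j) \<partial>kernel_pow (mh_kernel \<pi> q) k x) \<partial>lborel)"
    proof (intro Bochner_Integration.integral_cong refl)
      fix x
      show "\<pi> x * (g i x * (D.op ^^ k) (g j) x) =
          \<pi> x * (G x $ i - m $ i) * (\<integral>y. (G y $ j - m $ j) \<partial>kernel_pow (mh_kernel \<pi> q) k x)"
      proof (cases "x \<in> S")
        case True
        have s: "sets (kernel_pow (mh_kernel \<pi> q) k x) = sets borel" by (rule MH.sets_kernel_pow)
        have "(D.op ^^ k) (g j) x = (\<integral>y. g j y \<partial>kernel_pow (mh_kernel \<pi> q) k x)"
          using D.integral_kernel_pow[OF g, of k x j] kpow[OF True, of k] by simp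
        also have "\<dots> = (\<integral>y. (G y $ j - m $ j) \<partial>kernel_pow (mh_kernel \<pi> q) k x)"
        proof (rule integral_cong_AE)
          show "g j \<in> borel_measurable (kernel_pow (mh_kernel \<pi> q) k x)"
            by (subst measurable_cong_sets[OF s refl]) (rule bounded_measurableD[OF g])
          show "(\<lambda>y. G y $ j - m $ j) \<in> borel_measurable (kernel_pow (mh_kernel \<pi> q) k x)"
            by (subst measurable_cong_sets[OF s refl]) measurable
          show "AE y in kernel_pow (mh_kernel \<pi> q) k x. g j y = G y $ j - m $ j"
            using A.AE_kernel_pow_absorbing[OF True, of k] by eventually_elim (simp add: g_def)
        qed
        finally show ?thesis using True by (simp add: g_def)
      qed (simp add: pi_zero)
    qed
    finally show ?thesis by (simp add: Cov_def stat_cov_def)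
  qed
  define L where "L = (\<chi> i j. \<integral>x. g i x * D.op (D.poisson (g j)) x \<partial>MH.target)"
  have sums: "(\<lambda>k. Cov (Suc k)) sums L"
    by (intro sums_vec) (simp only: Cov L_def vec_lambda_beta D.sums_autocovariance[OF g gm g])
  then show "summable (\<lambda>k. Cov (Suc k))" by (rule sums_summable)
  have \<Sigma>: "\<Sigma> = Cov 0 + 2 *\<^sub>R L" unfolding \<Sigma>_def using sums_unique[OF sums] by simp
  define h where "h t x = (\<Sum>i\<in>UNIV. t $ i * g i x)" for t x
  have h: "bounded_measurable (h t)" for t
    unfolding h_def[abs_def] by (intro bounded_measurable_sum bounded_measurable_cmult g)
  have hm: "(\<integral>x. h t x \<partial>MH.target) = 0" for t
    unfolding h_def using D.integrable_stat[OF g] gm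
    by (subst Bochner_Integration.integral_sum) auto
  have form: "t \<bullet> (\<Sigma> *v t) = D.asymptotic_variance (h t)" for t
    unfolding h_def[abs_def] by (subst D.asymptotic_variance_sum[OF _ g gm])
      (auto simp: quadratic_form_matrix \<Sigma> Cov L_def)
  have psd: "0 \<le> t \<bullet> (\<Sigma> *v t)" for t
    unfolding form by (rule D.asymptotic_variance_nonneg[OF P chain' h hm])
  from centered_gaussian_exists[OF psd] obtain \<mu> where \<mu>: "centered_gaussian \<Sigma> \<mu>"
    "gaussian_char (\<lambda>t. t \<bullet> (\<Sigma> *v t)) \<mu>" by blast
  define Z where "Z N \<omega> = sqrt (real N) *\<^sub>R ((1 / real N) *\<^sub>R (\<Sum>n\<in>{1..N}. G (Y n \<omega>)) - m)" for N \<omega>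
  have Zm: "Z N \<in> borel_measurable P" for N unfolding Z_def[abs_def] by measurable
  have "weak_conv_to (\<lambda>N. distr P borel (Z N)) \<mu>"
  proof (rule weak_conv_to_char)
    show "prob_space (distr P borel (Z N))" for N by (rule P.prob_space_distr[OF Zm])
    show "prob_space \<mu>" "sets \<mu> = sets borel" using \<mu>(2) by (auto simp: gaussian_char_def)
    fix t :: "real^'d"
    have "(\<integral>x. iexp (t \<bullet> x) \<partial>distr P borel (Z N)) =
        (\<integral>\<omega>. iexp (1 / sqrt (real N) * (\<Sum>k\<in>{1..N}. h t (Y k \<omega>))) \<partial>P)" if N: "N \<ge> 1" for N
    proof -
      have "(\<integral>x. iexp (t \<bullet> x) \<partial>distr P borel (Z N)) = (\<integral>\<omega>. iexp (t \<bullet> Z N \<omega>) \<partial>P)"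
        by (rule integral_distr[OF Zm]) (auto intro!: borel_measurable_continuous_onI continuous_intros)
      also have "\<dots> = (\<integral>\<omega>. iexp (1 / sqrt (real N) * (\<Sum>k\<in>{1..N}. h t (Y k \<omega>))) \<partial>P)"
      proof (rule integral_cong_AE)
        note [measurable] = Zm bounded_measurableD[OF h]
        show "(\<lambda>\<omega>. iexp (t \<bullet> Z N \<omega>)) \<in> borel_measurable P" by measurable
        show "(\<lambda>\<omega>. iexp (1 / sqrt (real N) * (\<Sum>k\<in>{1..N}. h t (Y k \<omega>)))) \<in> borel_measurable P" by measurable
        have "AE \<omega> in P. \<forall>k\<in>{1..N}. Y k \<omega> \<in> S"
          using A.AE_chain_absorbing[OF P chain x1] by (intro AE_finite_allI) auto
        then show "AE \<omega> in P. iexp (t \<bullet> Z N \<omega>) = iexp (1 / sqrt (real N) * (\<Sum>k\<in>{1..N}. h t (Y k \<omega>)))"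
        proof eventually_elim
          case (elim \<omega>)
          have hk: "h t (Y k \<omega>) = t \<bullet> G (Y k \<omega>) - t \<bullet> m" if "k \<in> {1..N}" for k
            using elim that by (simp add: h_def g_def inner_vec_def right_diff_distrib sum_subtractf)
          have "(\<Sum>k\<in>{1..N}. h t (Y k \<omega>)) = (\<Sum>k\<in>{1..N}. t \<bullet> G (Y k \<omega>)) - real N * (t \<bullet> m)"
            using hk by (simp add: sum_subtractf)
          moreover have "t \<bullet> Z N \<omega> = sqrt (real N) * ((1 / real N) * (\<Sum>k\<in>{1..N}. t \<bullet> G (Y k \<omega>)) - t \<bullet> m)"
            by (simp add: Z_def inner_diff_right inner_sum_right)
          \<comment> \<open>For \<open>N \<ge> 1\<close> the scaled deviation of the mean equals the
            sum of centered terms divided by \<open>sqrt (real N)\<close>; the case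
            \<open>N = 0\<close> is dropped since only large \<open>N\<close> count.\<close>
          moreover have "sqrt (real N) * ((1 / real N) * a - b) = 1 / sqrt (real N) * (a - real N * b)" for a b
          proof -
            have "s * ((1 / (s * s)) * a - b) = 1 / s * (a - (s * s) * b)" if "s \<noteq> 0" for s
              using that by (simp add: field_simps)
            from this[of "sqrt (real N)"] show ?thesis
              using N by (simp only: real_sqrt_mult_self abs_of_nat) simp
          qed
          ultimately show ?case by simp
        qed
      qed
      finally show ?thesis .
    qed
    moreover have "(\<lambda>N. \<integral>\<omega>. iexp (1 / sqrt (real N) * (\<Sum>k\<in>{1..N}. h t (Y k \<omega>))) \<partial>P) \<longlonglongrightarrow> (\<integral>x. iexp (t \<bullet> x) \<partial>\<mu>)"
      using D.chain_char_tendsto[OF P chain' h hm, of t] \<mu>(2) by (simp only: gaussian_char_def form)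
    ultimately show "(\<lambda>N. \<integral>x. iexp (t \<bullet> x) \<partial>distr P borel (Z N)) \<longlonglongrightarrow> (\<integral>x. iexp (t \<bullet> x) \<partial>\<mu>)"
      by (subst tendsto_cong[OF eventually_sequentiallyI[of 1]])
  qed simp
  then show "\<exists>\<mu>. centered_gaussian \<Sigma> \<mu> \<and>
      weak_conv_to (\<lambda>N. distr P borel (\<lambda>\<omega>. sqrt (real N) *\<^sub>R
         ((1 / real N) *\<^sub>R (\<Sum>n\<in>{1..N}. G (Y n \<omega>)) - m))) \<mu>"
    using \<mu>(1) unfolding Z_def[abs_def] by blast
qed

section \<open>Verification of the hypotheses for the conditional density on the simplex\<close>

theorem theorem1:
  fixes M :: "'a measure" and X :: "'a \<Rightarrow> real^('n::finite option)"
    and fX :: "real^('n option) \<Rightarrow> real"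
    and f :: "'n option \<Rightarrow> real \<Rightarrow> real" and F :: "'n option \<Rightarrow> real \<Rightarrow> real"
    and c :: "real^('n option) \<Rightarrow> real"
    and fS :: "real \<Rightarrow> real" and v :: real
    and \<pi> :: "real^'n \<Rightarrow> real"
    and q :: "real^'n \<Rightarrow> real^'n \<Rightarrow> real"
    and P :: "'b measure" and Y :: "nat \<Rightarrow> 'b \<Rightarrow> real^'n" and x1 :: "real^'n"
  assumes d_ge_3: "CARD('n) \<ge> 2"
    and M: "prob_space M"
    and X_distr: "distributed M lborel X (\<lambda>x. ennreal (fX x))"
    and fX_nonneg: "\<forall>x. 0 \<le> fX x"
    and support: "support_of (distr M borel X) = {x. \<forall>i. 0 \<le> x $ i}"
    and fX_zero_outside: "\<forall>x. \<not> (\<forall>i. 0 \<le> x $ i) \<longrightarrow> fX x = 0"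
    and marg_distr: "\<forall>j. distributed M lborel (\<lambda>\<omega>. X \<omega> $ j) (\<lambda>t. ennreal (f j t))"
    and f_nonneg: "\<forall>j t. 0 \<le> f j t"
    and F_def: "\<forall>j t. F j t = measure M {\<omega>\<in>space M. X \<omega> $ j \<le> t}"
    and copula: "copula_density c"
    and copula_of_X: "\<forall>x. measure M {\<omega>\<in>space M. \<forall>i. X \<omega> $ i \<le> x $ i}
                          = copula_of_density c (\<chi> j. F j (x $ j))"
    and factor: "\<forall>x. fX x = c (\<chi> j. F j (x $ j)) * (\<Prod>j\<in>UNIV. f j (x $ j))"
    and S_distr: "distributed M lborel (\<lambda>\<omega>. \<Sum>j\<in>UNIV. X \<omega> $ j) (\<lambda>s. ennreal (fS s))"
    and fS_nonneg: "\<forall>s. 0 \<le> fS s"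
    and v_pos: "v > 0"
    and fS_v_pos: "fS v > 0"
    and fS_v_version: "fS v = (\<integral>x. fX (full_vec v x) \<partial>lborel)"
    and pi_def: "\<forall>x. \<pi> x = fX (full_vec v x) / fS v"
    and q_nonneg: "\<forall>x y. 0 \<le> q x y"
    and q_meas: "(\<lambda>(x, y). q x y) \<in> borel_measurable borel"
    and q_density: "\<forall>x. (\<integral>\<^sup>+ y. ennreal (q x y) \<partial>lborel) = 1"
    and chain: "markov_chain_from P Y (mh_kernel \<pi> q) x1"
    and P: "prob_space P"
    and x1_supp: "x1 \<in> {x. (\<forall>i. 0 \<le> x $ i) \<and> (\<Sum>i\<in>UNIV. x $ i) \<le> v}"
    and C1: "(INF xy \<in> {x. \<forall>i. 0 \<le> x $ i \<and> x $ i \<le> v} \<times> {x. \<forall>i. 0 \<le> x $ i \<and> x $ i \<le> v}.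
               q (fst xy) (snd xy)) > 0"
    and C2: "\<forall>j. (\<forall>t\<in>{0..v}. f j t > 0) \<and> (\<exists>B. \<forall>t\<in>{0..v}. f j t \<le> B)"
    and C3: "(\<forall>u\<in>{u. \<forall>j. u $ j \<in> F j ` {0..v}}. c u > 0) \<and>
             (\<exists>B. \<forall>u\<in>{u. \<forall>j. u $ j \<in> F j ` {0..v}}. c u \<le> B)"
  shows "let AC = (\<integral>x. \<pi> x *\<^sub>R full_vec v x \<partial>lborel);
             Cov = stat_cov \<pi> (mh_kernel \<pi> q) (full_vec v) AC;
             \<Sigma> = Cov 0 + 2 *\<^sub>R (\<Sum>k. Cov (Suc k))
         in summable (\<lambda>k. Cov (Suc k)) \<and>
            (\<exists>\<mu>. centered_gaussian \<Sigma> \<mu> \<and>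
              weak_conv_to (\<lambda>N. distr P borel (\<lambda>\<omega>. sqrt (real N) *\<^sub>R
                 ((1 / real N) *\<^sub>R (\<Sum>n\<in>{1..N}. full_vec v (Y n \<omega>)) - AC))) \<mu>)"
proof -
  define S where "S = {x :: real^'n. (\<forall>i. 0 \<le> x $ i) \<and> (\<Sum>i\<in>UNIV. x $ i) \<le> v}"
  have "closed S" unfolding S_def
    by (intro closed_Collect_conj closed_Collect_all closed_Collect_le continuous_intros)
  then have S [measurable]: "S \<in> sets borel" by simp
  \<comment> \<open>The simplex lies in the cube \<open>[0, v]^d'\<close>, the set on which
    \<open>C1\<close> bounds the proposal from below.\<close>
  have S_nth: "0 \<le> x $ i" "x $ i \<le> v" if "x \<in> S" for x i
  proof -
    have "x $ i \<le> (\<Sum>i\<in>UNIV. x $ i)" using that by (intro member_le_sum) (auto simp: S_def)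
    then show "0 \<le> x $ i" "x $ i \<le> v" using that by (auto simp: S_def)
  qed
  have full_None: "full_vec v x $ None = v - (\<Sum>j\<in>UNIV. x $ j)" for x :: "real^'n"
    by (simp add: full_vec_def join_last_def)
  have full_Some: "full_vec v x $ Some i = x $ i" for x :: "real^'n" and i
    by (simp add: full_vec_def join_last_def)
  have full_nonneg: "(\<forall>i. 0 \<le> full_vec v x $ i) \<longleftrightarrow> x \<in> S" for x :: "real^'n"
    by (simp add: split_option_all full_None full_Some S_def conj_commute)
  have full_range: "0 \<le> full_vec v x $ i" "full_vec v x $ i \<le> v" if "x \<in> S" for x :: "real^'n" and i
  proof -
    show "0 \<le> full_vec v x $ i" using full_nonneg that by blast
    show "full_vec v x $ i \<le> v"
      using S_nth[OF that] by (cases i) (auto simp: full_None full_Some intro: sum_nonneg)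
  qed
  have full_cont: "continuous_on UNIV (full_vec v :: real^'n \<Rightarrow> _)"
    unfolding full_vec_def[abs_def] join_last_def
  proof (rule continuous_on_vec_lambda)
    show "continuous_on UNIV (\<lambda>x :: real^'n. case i of None \<Rightarrow> v - (\<Sum>j\<in>UNIV. x $ j) | Some j \<Rightarrow> x $ j)" for i
      by (cases i) (auto intro!: continuous_intros)
  qed
  then have full_meas [measurable]: "(full_vec v :: real^'n \<Rightarrow> _) \<in> borel_measurable borel"
    by (rule borel_measurable_continuous_onI)
  have "(\<lambda>x. ennreal (fX x)) \<in> borel_measurable borel"
    using distributed_borel_measurable[OF X_distr] by simp
  \<comment> \<open>\<open>distributed\<close> yields measurability of the extended-real density
    only; nonnegativity of \<open>fX\<close> allows the way back.\<close>
  then have "(\<lambda>x. enn2real (ennreal (fX x))) \<in> borel_measurable borel" by measurable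
  then have fX_meas [measurable]: "fX \<in> borel_measurable borel" using fX_nonneg by simp
  have \<pi>: "\<pi> = (\<lambda>x. fX (full_vec v x) / fS v)" using pi_def by auto
  have pi_meas: "\<pi> \<in> borel_measurable borel" unfolding \<pi> by measurable
  have pi_nonneg: "0 \<le> \<pi> x" for x using fX_nonneg fS_v_pos by (simp add: \<pi>)
  \<comment> \<open>A non-integrable function would have integral \<open>0\<close> by convention,
    contradicting \<open>fS v > 0\<close>.\<close>
  have "integrable lborel (\<lambda>x :: real^'n. fX (full_vec v x))"
    using fS_v_version fS_v_pos not_integrable_integral_eq by fastforce
  then have pi_int: "integrable lborel \<pi>" unfolding \<pi> by simp
  have "(\<integral>x. \<pi> x \<partial>lborel) = 1" using fS_v_version fS_v_pos by (simp add: \<pi>)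
  then have pi_density: "(\<integral>\<^sup>+x. ennreal (\<pi> x) \<partial>lborel) = 1"
    using pi_nonneg by (subst nn_integral_eq_integral[OF pi_int]) auto
  have MH: "metropolis_hastings \<pi> q"
    by unfold_locales (use pi_meas pi_nonneg pi_density q_meas q_nonneg q_density in auto)
  have pi_zero: "\<pi> x = 0" if "x \<notin> S" for x
    using fX_zero_outside full_nonneg[of x] that by (simp add: \<pi>)
  have F_mem: "(\<chi> j. F j (full_vec v x $ j)) \<in> {u. \<forall>j. u $ j \<in> F j ` {0..v}}" if "x \<in> S" for x
    using full_range[OF that] by auto
  have pi_pos: "0 < \<pi> x" if "x \<in> S" for x
  proof -
    have "0 < c (\<chi> j. F j (full_vec v x $ j))" using C3 F_mem[OF that] by blast
    moreover have "0 < (\<Prod>j\<in>UNIV. f j (full_vec v x $ j))"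
      using C2 full_range[OF that] by (intro prod_pos) auto
    ultimately show ?thesis using factor fS_v_pos by (simp add: \<pi>)
  qed
  obtain Bf where Bf: "\<And>j t. t \<in> {0..v} \<Longrightarrow> f j t \<le> Bf j" using C2 by metis
  obtain Bc where Bc: "\<And>u. u \<in> {u. \<forall>j. u $ j \<in> F j ` {0..v}} \<Longrightarrow> c u \<le> Bc" using C3 by blast
  \<comment> \<open>The copula factorization bounds \<open>fX\<close> on the simplex by the bound
    for \<open>c\<close> times the product of the bounds for the marginal densities.\<close>
  define B where "B = Bc * (\<Prod>j\<in>UNIV. Bf j) / fS v"
  have pi_le: "\<pi> x \<le> B" if "x \<in> S" for x
  proof -
    have c0: "0 < c (\<chi> j. F j (full_vec v x $ j))" using C3 F_mem[OF that] by blast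
    have "c (\<chi> j. F j (full_vec v x $ j)) * (\<Prod>j\<in>UNIV. f j (full_vec v x $ j)) \<le> Bc * (\<Prod>j\<in>UNIV. Bf j)"
    proof (rule mult_mono)
      show "c (\<chi> j. F j (full_vec v x $ j)) \<le> Bc" by (rule Bc[OF F_mem[OF that]])
      then show "0 \<le> Bc" using c0 by linarith
      show "(\<Prod>j\<in>UNIV. f j (full_vec v x $ j)) \<le> (\<Prod>j\<in>UNIV. Bf j)"
        using Bf full_range[OF that] f_nonneg by (intro prod_mono) auto
      show "0 \<le> (\<Prod>j\<in>UNIV. f j (full_vec v x $ j))" using f_nonneg by (intro prod_nonneg) auto
    qed
    then show ?thesis using factor fS_v_pos by (simp add: \<pi> B_def divide_right_mono)
  qed
  have x1: "x1 \<in> S" using x1_supp by (simp add: S_def)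
  \<comment> \<open>Off the simplex the claim is \<open>0 \<le> B\<close>, which follows from the
    positive value of \<open>\<pi>\<close> at the starting point.\<close>
  have pi_bound: "\<pi> x \<le> B" for x
    using pi_le[of x] pi_zero[of x] pi_le[OF x1] pi_pos[OF x1] by (cases "x \<in> S") auto
  define \<epsilon> where "\<epsilon> = (INF xy \<in> {x. \<forall>i. 0 \<le> x $ i \<and> x $ i \<le> v} \<times> {x. \<forall>i. 0 \<le> x $ i \<and> x $ i \<le> v}.
      q (fst xy) (snd xy))"
  have q_bound: "\<epsilon> \<le> q x y" if "x \<in> S" "y \<in> S" for x y
  proof -
    \<comment> \<open>The infimum of reals is a lower bound only for sets bounded below;
      nonnegativity of \<open>q\<close> provides that.\<close>
    have "\<epsilon> \<le> q (fst (x, y)) (snd (x, y))"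
      unfolding \<epsilon>_def
      by (rule cINF_lower) (use S_nth[OF that(1)] S_nth[OF that(2)] q_nonneg in \<open>auto intro!: bdd_belowI[of _ 0]\<close>)
    then show ?thesis by simp
  qed
  have full_bound: "norm (full_vec v x) \<le> (\<Sum>i\<in>(UNIV :: 'n option set). v)" if "x \<in> S" for x :: "real^'n"
    by (rule order_trans[OF norm_le_l1_cart sum_mono]) (use full_range[OF that] in auto)
  show ?thesis
    unfolding Let_def
    using metropolis_hastings_clt[OF MH S C1[folded \<epsilon>_def] pi_pos pi_zero pi_bound q_bound full_meas full_bound P chain x1]
    by blast
qed

end
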